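(* The natural homomorphisms $$i_{\hat{\mathcal U}^0}\colon\hat{\mathcal U}^0\to\dot{\mathcal U}^0,\qquad i_{\hat{\mathcal U}^{\ge0}}\colon\hat{\mathcal U}^{\ge0}\to\dot{\mathcal U}^{\ge0},\qquad i_{\hat{\mathcal U}}\colon\hat{\mathcal U}\to\dot{\mathcal U}$$ are injective.
   Context: Let $\mathcal A=\mathbb Z[v,v^{-1}]$, $[i]=\frac{v^i-v^{-i}}{v-v^{-1}}$, $[n]!=[1]\cdots[n]$. Let $U=U_v(sl_2)$ be the $\mathbb Q(v)$-algebra generated by $K,K^{-1},E,F$ with relations $KK^{-1}=K^{-1}K=1$, $KE=v^2EK$, $KF=v^{-2}FK$, $EF-FE=\frac{K-K^{-1}}{v-v^{-1}}$. Put $e=(v-v^{-1})E$, $F^{(n)}=F^n/[n]!$, and let $\mathcal U\subset U$ be the $\mathcal A$-subalgebra generated by $K,K^{-1},e$ and $F^{(n)}$ ($n\ge1$). Put $\mathcal U^0=\mathcal A[K,K^{-1}]$, $\mathcal U^+=\mathcal A[e]$, $\mathcal U^{\ge0}=\mathcal U^0\mathcal U^+$ (subalgebras of $\mathcal U$). For $m\in\mathbb Z$, $i\ge0$ put $\{H+m\}_i=\prod_{k=0}^{i-1}(v^{m-k}K-v^{-m+k}K^{-1})$. For $n\ge0$: $\mathcal U^0_n$ is the ideal of $\mathcal U^0$ generated by $\{H+m\}_n$, $m\in\mathbb Z$; $\mathcal U^+_n=e^n\mathcal A[e]$; $\mathcal U^{\ge0}_n=\sum_{i+j=n}\mathcal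 U^0_i\mathcal U^+_j$, a two-sided ideal of $\mathcal U^{\ge0}$; $\mathcal U_n$ is the two-sided ideal of $\mathcal U$ generated by the elements $\{H+m\}_ie^{n-i}$ ($m\in\mathbb Z$, $0\le i\le n$). For each of $*=0$, $*=\ge0$ and no superscript, set $\hat{\mathcal U}^*=\varprojlim_n\mathcal U^*/\mathcal U^*_n$ and $\dot{\mathcal U}^*=\varprojlim_n\mathcal U^*/(\mathcal U^*_1)^n$. One has $\mathcal U^*_n\subset(\mathcal U^*_1)^n$, and the identity of $\mathcal U^*$ induces the homomorphism $i_{\hat{\mathcal U}^*}\colon\hat{\mathcal U}^*\to\dot{\mathcal U}^*$. *)

theory Defs
  imports
    "HOL-Library.Poly_Mapping"
    "HOL-Computational_Algebra.Polynomial"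
    "HOL-Computational_Algebra.Fraction_Field"
    "HOL-Algebra.Generated_Rings"
    "HOL-Algebra.Ideal_Product"
    "HOL-Algebra.QuotRing"
    "HOL-Algebra.Algebraic_Closure_Type"
begin

section \<open>The coefficient ring\<close>

type_synonym qv = "rat poly fract"

definition qv_v :: qv where
  "qv_v = Fract [:0, 1:] 1"

text \<open>\<open>\<Z>[v, v\<inverse>]\<close> as a subring of \<open>\<rat>(v)\<close>.\<close>

definition laurent :: "qv set" where
  "laurent = generate_ring ring_of_type_algebra {qv_v, inverse qv_v}"

definition qint :: "nat \<Rightarrow> qv" where
  "qint i = (qv_v ^ i - inverse qv_v ^ i) / (qv_v - inverse qv_v)"

definition qfact :: "nat \<Rightarrow> qv" where
  "qfact n = (\<Prod>i=1..n. qint i)"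


section \<open>The quantized enveloping algebra of $sl_2$\<close>

text \<open>
  The free associative algebra on a set of letters is the monoid algebra of the free monoid.
  The convolution product of \<^theory>\<open>HOL-Library.Poly_Mapping\<close> expects the monoid of exponents
  to be written additively, so concatenation of words is addition here.
\<close>

datatype 'a word = Word "'a list"

instantiation word :: (type) monoid_add
begin

definition zero_word :: "'a word" where
  "zero_word = Word []"

fun plus_word :: "'a word \<Rightarrow> 'a word \<Rightarrow> 'a word" where
  "plus_word (Word xs) (Word ys) = Word (xs @ ys)"

instance
proof
  fix a b c :: "'a word"
  show "a + b + c = a + (b + c)" by (cases a; cases b; cases c) simp
  show "0 + a = a" by (cases a) (simp add: zero_word_def)
  show "a + 0 = a" by (cases a) (simp add: zero_word_def)
qed

end

datatype gen = GK | GKinv | GE | GF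

type_synonym free_alg = "gen word \<Rightarrow>\<^sub>0 qv"

definition fgen :: "gen \<Rightarrow> free_alg" where
  "fgen g = Poly_Mapping.single (Word [g]) 1"

definition fscalar :: "qv \<Rightarrow> free_alg" where
  "fscalar c = Poly_Mapping.single 0 c"

definition usl2_relators :: "free_alg set" where
  "usl2_relators =
    {fgen GK * fgen GKinv - 1,
     fgen GKinv * fgen GK - 1,
     fgen GK * fgen GE - fscalar (qv_v ^ 2) * fgen GE * fgen GK,
     fgen GK * fgen GF - fscalar (inverse qv_v ^ 2) * fgen GF * fgen GK,
     fgen GE * fgen GF - fgen GF * fgen GE
       - fscalar (inverse (qv_v - inverse qv_v)) * (fgen GK - fgen GKinv)}"

definition usl2_ideal :: "free_alg set" where
  "usl2_ideal = genideal ring_of_type_algebra usl2_relators"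

definition usl2_rel :: "free_alg \<Rightarrow> free_alg \<Rightarrow> bool" where
  "usl2_rel x y \<longleftrightarrow> x - y \<in> usl2_ideal"


lemma ring_of_type_algebra_sel [simp]:
  "carrier ring_of_type_algebra = UNIV"
  "x \<otimes>\<^bsub>ring_of_type_algebra\<^esub> y = x * y"
  "\<one>\<^bsub>ring_of_type_algebra\<^esub> = 1"
  "\<zero>\<^bsub>ring_of_type_algebra\<^esub> = 0"
  "x \<oplus>\<^bsub>ring_of_type_algebra\<^esub> y = x + y"
  by (simp_all add: ring_of_type_algebra_def)

lemma ring_of_type_algebra_ring: "ring (ring_of_type_algebra :: 'a::ring_1 ring)"
proof (rule ringI)
  show "abelian_group (ring_of_type_algebra :: 'a ring)"
    by (rule abelian_groupI) (auto simp: algebra_simps intro: exI[of _ "- x" for x])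
  show "Group.monoid (ring_of_type_algebra :: 'a ring)"
    by (rule monoidI) (auto simp: algebra_simps)
qed (auto simp: algebra_simps)

lemma ring_of_type_algebra_minus [simp]: "\<ominus>\<^bsub>ring_of_type_algebra\<^esub> x = - x"
  using abelian_group.minus_equality[OF ring.is_abelian_group[OF ring_of_type_algebra_ring], of "- x" x]
  by simp

lemma ideal_usl2: "ideal usl2_ideal ring_of_type_algebra"
  unfolding usl2_ideal_def
  by (rule ring.genideal_ideal[OF ring_of_type_algebra_ring]) simp

lemma usl2_ideal_zero: "0 \<in> usl2_ideal"
  and usl2_ideal_add: "x \<in> usl2_ideal \<Longrightarrow> y \<in> usl2_ideal \<Longrightarrow> x + y \<in> usl2_ideal"
  and usl2_ideal_uminus: "x \<in> usl2_ideal \<Longrightarrow> - x \<in> usl2_ideal"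
  and usl2_ideal_lmult: "x \<in> usl2_ideal \<Longrightarrow> a * x \<in> usl2_ideal"
  and usl2_ideal_rmult: "x \<in> usl2_ideal \<Longrightarrow> x * a \<in> usl2_ideal"
proof -
  interpret ideal usl2_ideal "ring_of_type_algebra :: free_alg ring" by (rule ideal_usl2)
  show "0 \<in> usl2_ideal" using additive_subgroup.zero_closed[OF is_additive_subgroup] by simp
  show "x \<in> usl2_ideal \<Longrightarrow> y \<in> usl2_ideal \<Longrightarrow> x + y \<in> usl2_ideal" using additive_subgroup.a_closed[OF is_additive_subgroup, of x y] by simp
  show "x \<in> usl2_ideal \<Longrightarrow> - x \<in> usl2_ideal" using I_l_closed[of x "- 1"] by simp
  show "x \<in> usl2_ideal \<Longrightarrow> a * x \<in> usl2_ideal" using I_l_closed[of x a] by simp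
  show "x \<in> usl2_ideal \<Longrightarrow> x * a \<in> usl2_ideal" using I_r_closed[of x a] by simp
qed

text \<open>
  The class \<^class>\<open>ring_1\<close> requires \<open>1 \<noteq> 0\<close>. That the quotient is nonzero follows from the counit
  \<open>K \<mapsto> 1\<close>, \<open>E \<mapsto> 0\<close>, \<open>F \<mapsto> 0\<close>.
\<close>

fun counit_word :: "gen word \<Rightarrow> qv" where
  "counit_word (Word gs) = (if set gs \<subseteq> {GK, GKinv} then 1 else 0)"

definition counit :: "free_alg \<Rightarrow> qv" where
  "counit x = (\<Sum>w\<in>Poly_Mapping.keys x. Poly_Mapping.lookup x w * counit_word w)"

lemma counit_word_add: "counit_word (a + b) = counit_word a * counit_word b"
  by (cases a; cases b) auto

lemma counit_zero: "counit 0 = 0"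
  by (simp add: counit_def)

lemma counit_add: "counit (x + y) = counit x + counit y"
  unfolding counit_def by (rule setsum_keys_plus_distrib) (auto simp: algebra_simps)

lemma counit_single: "counit (Poly_Mapping.single w c) = c * counit_word w"
  by (auto simp: counit_def)

lemma counit_sum: "counit (sum f A) = (\<Sum>a\<in>A. counit (f a))"
  by (induction A rule: infinite_finite_induct) (simp_all add: counit_zero counit_add)

lemma sum_single_lookup:
  "x = (\<Sum>w\<in>Poly_Mapping.keys x. Poly_Mapping.single w (Poly_Mapping.lookup x w))"
  by (rule poly_mapping_eqI)
     (auto simp: lookup_sum lookup_single when_def in_keys_iff)

lemma counit_mult: "counit (x * y) = counit x * counit y"
proof -
  have "counit (x * y) = counit
     ((\<Sum>w\<in>Poly_Mapping.keys x. Poly_Mapping.single w (Poly_Mapping.lookup x w)) *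
      (\<Sum>w\<in>Poly_Mapping.keys y. Poly_Mapping.single w (Poly_Mapping.lookup y w)))"
    using sum_single_lookup[of x] sum_single_lookup[of y] by simp
  also have "\<dots> = counit x * counit y"
    by (simp add: counit_def[of x] counit_def[of y] sum_product counit_sum counit_single
        Poly_Mapping.mult_single counit_word_add mult_ac)
  finally show ?thesis .
qed

lemma counit_uminus: "counit (- x) = - counit x"
  using counit_add[of x "- x"] by (simp add: counit_zero eq_neg_iff_add_eq_0 add.commute)

lemma counit_diff: "counit (x - y) = counit x - counit y"
  using counit_add[of x "- y"] by (simp add: counit_uminus)

lemma counit_one: "counit 1 = 1"
  using counit_single[of 0 1] by (simp add: zero_word_def[symmetric] del: counit_word.simps)
     (simp add: zero_word_def)

lemma one_notin_usl2_ideal: "1 \<notin> usl2_ideal"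
proof -
  have "ideal {x. counit x = 0} ring_of_type_algebra"
  proof (rule idealI)
    show "subgroup {x. counit x = 0} (add_monoid ring_of_type_algebra)"
    proof -
      have "\<ominus>\<^bsub>ring_of_type_algebra\<^esub> x = - x" for x :: free_alg by simp
      hence "inv\<^bsub>add_monoid ring_of_type_algebra\<^esub> x = - x" for x :: free_alg
        by (simp add: a_inv_def)
      thus ?thesis
        by (auto simp: subgroup_def counit_zero counit_add counit_uminus)
    qed
  qed (auto simp: ring_of_type_algebra_ring counit_mult)
  moreover have "usl2_relators \<subseteq> {x. counit x = 0}"
    by (auto simp: usl2_relators_def counit_diff counit_mult counit_one fgen_def fscalar_def
        counit_single)
  ultimately have "usl2_ideal \<subseteq> {x. counit x = 0}"
    unfolding usl2_ideal_def by (rule ring.genideal_minimal[OF ring_of_type_algebra_ring])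
  thus ?thesis by (auto simp: counit_one)
qed

quotient_type usl2 = free_alg / usl2_rel
proof (rule equivpI)
  show "reflp usl2_rel" by (auto intro!: reflpI simp: usl2_rel_def usl2_ideal_zero)
  show "symp usl2_rel"
  proof (rule sympI)
    fix x y assume "usl2_rel x y"
    thus "usl2_rel y x" using usl2_ideal_uminus[of "x - y"] by (simp add: usl2_rel_def)
  qed
  show "transp usl2_rel"
  proof (rule transpI)
    fix x y z assume "usl2_rel x y" "usl2_rel y z"
    thus "usl2_rel x z" using usl2_ideal_add[of "x - y" "y - z"] by (simp add: usl2_rel_def)
  qed
qed

instantiation usl2 :: ring_1
begin

lift_definition zero_usl2 :: usl2 is 0 .
lift_definition one_usl2 :: usl2 is 1 .

lift_definition plus_usl2 :: "usl2 \<Rightarrow> usl2 \<Rightarrow> usl2" is "(+)"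
proof -
  fix a b c d assume "usl2_rel a b" "usl2_rel c d"
  thus "usl2_rel (a + c) (b + d)"
    using usl2_ideal_add[of "a - b" "c - d"] by (simp add: usl2_rel_def algebra_simps)
qed

lift_definition uminus_usl2 :: "usl2 \<Rightarrow> usl2" is uminus
proof -
  fix a b assume "usl2_rel a b"
  thus "usl2_rel (- a) (- b)" using usl2_ideal_uminus[of "a - b"] by (simp add: usl2_rel_def)
qed

lift_definition minus_usl2 :: "usl2 \<Rightarrow> usl2 \<Rightarrow> usl2" is "(-)"
proof -
  fix a b c d assume "usl2_rel a b" "usl2_rel c d"
  thus "usl2_rel (a - c) (b - d)"
    using usl2_ideal_add[OF _ usl2_ideal_uminus, of "a - b" "c - d"]
    by (simp add: usl2_rel_def algebra_simps)
qed

lift_definition times_usl2 :: "usl2 \<Rightarrow> usl2 \<Rightarrow> usl2" is "(*)"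
proof -
  fix a b c d assume *: "usl2_rel a b" "usl2_rel c d"
  have "a * c - b * d = (a - b) * c + b * (c - d)" by (simp add: algebra_simps)
  with * show "usl2_rel (a * c) (b * d)"
    by (simp add: usl2_rel_def usl2_ideal_add usl2_ideal_lmult usl2_ideal_rmult)
qed

instance
proof
  show "(0::usl2) \<noteq> 1"
  proof transfer
    show "\<not> usl2_rel 0 1"
      using usl2_ideal_uminus[of "- 1"] one_notin_usl2_ideal by (auto simp: usl2_rel_def)
  qed
qed (transfer; simp add: usl2_rel_def usl2_ideal_zero algebra_simps)+

end

lift_definition usl2_scalar :: "qv \<Rightarrow> usl2" is fscalar .
lift_definition uK :: usl2 is "fgen GK" .
lift_definition uKinv :: usl2 is "fgen GKinv" .
lift_definition uE :: usl2 is "fgen GE" .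
lift_definition uF :: usl2 is "fgen GF" .

definition ue :: usl2 where
  "ue = usl2_scalar (qv_v - inverse qv_v) * uE"

definition uFdiv :: "nat \<Rightarrow> usl2" where
  "uFdiv n = usl2_scalar (inverse (qfact n)) * uF ^ n"

text \<open>
  \<open>H_shift m i\<close> is $\{H+m\}_i$. The factors commute with one another, but \<open>usl2\<close> is not a
  commutative type, hence the ordered product.
\<close>

definition H_shift :: "int \<Rightarrow> nat \<Rightarrow> usl2" where
  "H_shift m i = prod_list (map (\<lambda>k.
     usl2_scalar (qv_v powi (m - int k)) * uK - usl2_scalar (qv_v powi (- m + int k)) * uKinv) [0..<i])"


section \<open>The integral form, its subalgebras and their filtrations\<close>

text \<open>The \<open>\<Z>[v, v\<inverse>]\<close>-subalgebra of \<open>usl2\<close> generated by a set.\<close>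

definition laurent_subalgebra :: "usl2 set \<Rightarrow> usl2 set" where
  "laurent_subalgebra S = generate_ring ring_of_type_algebra (usl2_scalar ` laurent \<union> S)"

text \<open>
  Products of additive subgroups, such as $\mathcal U^0 \mathcal U^+$, consist of all finite sums
  of products. This is what \<^const>\<open>ideal_prod\<close> computes, also when the arguments are not ideals.
\<close>

abbreviation span_prod :: "usl2 set \<Rightarrow> usl2 set \<Rightarrow> usl2 set" where
  "span_prod \<equiv> ideal_prod ring_of_type_algebra"

text \<open>
  \<open>U_int\<close>, \<open>U0\<close>, \<open>U_plus\<close> and \<open>Uge0\<close> are $\mathcal U$, $\mathcal U^0$, $\mathcal U^+$ and
  $\mathcal U^{\ge 0}$; the suffix \<open>_filt\<close> marks the filtrations by their subsets with lower index \<open>n\<close>.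
\<close>

definition U_int :: "usl2 set" where
  "U_int = laurent_subalgebra ({uK, uKinv, ue} \<union> {uFdiv n | n. n \<ge> 1})"

definition U0 :: "usl2 set" where
  "U0 = laurent_subalgebra {uK, uKinv}"

definition U_plus :: "usl2 set" where
  "U_plus = laurent_subalgebra {ue}"

definition Uge0 :: "usl2 set" where
  "Uge0 = span_prod U0 U_plus"

abbreviation usl2_subring :: "usl2 set \<Rightarrow> usl2 ring" where
  "usl2_subring S \<equiv> ring_of_type_algebra\<lparr>carrier := S\<rparr>"

definition U0_filt :: "nat \<Rightarrow> usl2 set" where
  "U0_filt n = genideal (usl2_subring U0) {H_shift m n | m. True}"

definition U_plus_filt :: "nat \<Rightarrow> usl2 set" where
  "U_plus_filt n = (\<lambda>x. ue ^ n * x) ` U_plus"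

definition Uge0_filt :: "nat \<Rightarrow> usl2 set" where
  "Uge0_filt n = {\<Sum>i\<le>n. x i | x. \<forall>i\<le>n. x i \<in> span_prod (U0_filt i) (U_plus_filt (n - i))}"

definition U_int_filt :: "nat \<Rightarrow> usl2 set" where
  "U_int_filt n = genideal (usl2_subring U_int) {H_shift m i * ue ^ (n - i) | m i. i \<le> n}"


section \<open>Completions\<close>

text \<open>
  The inverse limit of the quotients \<open>R Quot I n\<close>, as the ring of compatible sequences of cosets.
  For \<open>m \<le> n\<close> (and hence \<open>I n \<subseteq> I m\<close>) the canonical projection \<open>R Quot I n \<rightarrow> R Quot I m\<close>
  sends a coset \<open>X\<close> to \<open>I m + X\<close>.
\<close>

definition completion :: "('a, 'b) ring_scheme \<Rightarrow> (nat \<Rightarrow> 'a set) \<Rightarrow> (nat \<Rightarrow> 'a set) ring" where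
  "completion R I =
    \<lparr>carrier = {x. (\<forall>n. x n \<in> carrier (R Quot I n)) \<and>
                   (\<forall>m n. m \<le> n \<longrightarrow> set_add R (I m) (x n) = x m)},
     monoid.mult = (\<lambda>x y n. x n \<otimes>\<^bsub>R Quot I n\<^esub> y n),
     one = (\<lambda>n. \<one>\<^bsub>R Quot I n\<^esub>),
     ring.zero = (\<lambda>n. \<zero>\<^bsub>R Quot I n\<^esub>),
     add = (\<lambda>x y n. x n \<oplus>\<^bsub>R Quot I n\<^esub> y n)\<rparr>"

text \<open>
  If \<open>I n \<subseteq> J n\<close> for all \<open>n\<close>, then the identity of \<open>R\<close> induces the maps
  \<open>R Quot I n \<rightarrow> R Quot J n\<close>, \<open>X \<mapsto> J n + X\<close>, and hence a map from the completion with respect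
  to \<open>I\<close> to that with respect to \<open>J\<close>.
\<close>

definition completion_map ::
    "('a, 'b) ring_scheme \<Rightarrow> (nat \<Rightarrow> 'a set) \<Rightarrow> (nat \<Rightarrow> 'a set) \<Rightarrow> nat \<Rightarrow> 'a set" where
  "completion_map R J x = (\<lambda>n. set_add R (J n) (x n))"

definition ideal_powers :: "('a, 'b) ring_scheme \<Rightarrow> 'a set \<Rightarrow> nat \<Rightarrow> 'a set" where
  "ideal_powers R I n = I [^]\<^bsub>ideals_set R\<^esub> n"

text \<open>
  \<open>hat_\<close> and \<open>dot_\<close> are the completions $\hat{\mathcal U}^*$ and $\dot{\mathcal U}^*$.
  That the \<open>i_hat_\<close> maps are well defined is proved in \<open>i_hat_ring_hom\<close> below.
\<close>

definition hat_U0 where "hat_U0 = completion (usl2_subring U0) U0_filt"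
definition hat_Uge0 where "hat_Uge0 = completion (usl2_subring Uge0) Uge0_filt"
definition hat_U_int where "hat_U_int = completion (usl2_subring U_int) U_int_filt"

definition dot_U0 where
  "dot_U0 = completion (usl2_subring U0) (ideal_powers (usl2_subring U0) (U0_filt 1))"
definition dot_Uge0 where
  "dot_Uge0 = completion (usl2_subring Uge0) (ideal_powers (usl2_subring Uge0) (Uge0_filt 1))"
definition dot_U_int where
  "dot_U_int = completion (usl2_subring U_int) (ideal_powers (usl2_subring U_int) (U_int_filt 1))"

definition i_hat_U0 where
  "i_hat_U0 = completion_map (usl2_subring U0) (ideal_powers (usl2_subring U0) (U0_filt 1))"
definition i_hat_Uge0 where
  "i_hat_Uge0 = completion_map (usl2_subring Uge0) (ideal_powers (usl2_subring Uge0) (Uge0_filt 1))"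
definition i_hat_U_int where
  "i_hat_U_int = completion_map (usl2_subring U_int) (ideal_powers (usl2_subring U_int) (U_int_filt 1))"


section \<open>The induced maps are ring homomorphisms\<close>

lemma set_add_coset:
  assumes I: "ideal I R" and J: "ideal J R" and IJ: "I \<subseteq> J" and a: "a \<in> carrier R"
  shows "set_add R J (I +>\<^bsub>R\<^esub> a) = J +>\<^bsub>R\<^esub> a"
proof -
  interpret I: ideal I R by (rule I)
  interpret J: ideal J R by (rule J)
  show ?thesis
  proof (intro equalityI subsetI)
    fix x assume "x \<in> set_add R J (I +>\<^bsub>R\<^esub> a)"
    then obtain j i where "j \<in> J" "i \<in> I" "x = j \<oplus>\<^bsub>R\<^esub> (i \<oplus>\<^bsub>R\<^esub> a)"
      by (auto simp: set_add_def' a_r_coset_def')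
    moreover from this have "x = (j \<oplus>\<^bsub>R\<^esub> i) \<oplus>\<^bsub>R\<^esub> a"
      using a by (simp add: I.a_assoc I.Icarr J.Icarr)
    ultimately show "x \<in> J +>\<^bsub>R\<^esub> a"
      using IJ by (auto simp: a_r_coset_def' intro!: bexI[of _ "j \<oplus>\<^bsub>R\<^esub> i"]
          additive_subgroup.a_closed[OF J.is_additive_subgroup])
  next
    fix x assume "x \<in> J +>\<^bsub>R\<^esub> a"
    then obtain j where j: "j \<in> J" "x = j \<oplus>\<^bsub>R\<^esub> a" by (auto simp: a_r_coset_def')
    moreover have "\<zero>\<^bsub>R\<^esub> \<oplus>\<^bsub>R\<^esub> a \<in> I +>\<^bsub>R\<^esub> a"
      using additive_subgroup.zero_closed[OF I.is_additive_subgroup] by (auto simp: a_r_coset_def')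
    ultimately show "x \<in> set_add R J (I +>\<^bsub>R\<^esub> a)"
      using a by (auto simp: set_add_def')
  qed
qed

lemma completion_map_ring_hom:
  assumes I: "\<And>n. ideal (I n) R" and J: "\<And>n. ideal (J n) R"
    and IJ: "\<And>n. I n \<subseteq> J n" and J_dec: "\<And>m n. m \<le> n \<Longrightarrow> J n \<subseteq> J m"
  shows "completion_map R J \<in> ring_hom (completion R I) (completion R J)"
proof -
  interpret R: ring R using I[of 0] by (rule ideal.axioms(2))
  have rep: "\<exists>a \<in> carrier R. x n = I n +>\<^bsub>R\<^esub> a" if "x \<in> carrier (completion R I)" for x n
    using that by (auto simp: completion_def FactRing_simps)
  have map: "completion_map R J x n = J n +>\<^bsub>R\<^esub> a" if "x n = I n +>\<^bsub>R\<^esub> a" "a \<in> carrier R" for x n a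
    using that set_add_coset[OF I J IJ] by (simp add: completion_map_def)
  show ?thesis
  proof (rule ring_hom_memI)
    fix x assume x: "x \<in> carrier (completion R I)"
    have "set_add R (J m) (completion_map R J x n) = completion_map R J x m" if "m \<le> n" for m n
    proof -
      obtain a where a: "a \<in> carrier R" "x n = I n +>\<^bsub>R\<^esub> a" using rep[OF x] by blast
      obtain b where b: "b \<in> carrier R" "x m = I m +>\<^bsub>R\<^esub> b" using rep[OF x] by blast
      have "x m = set_add R (I m) (x n)" using x that by (simp add: completion_def)
      moreover have "\<zero>\<^bsub>R\<^esub> \<in> I k" for k
        by (rule additive_subgroup.zero_closed[OF ideal.axioms(1)[OF I]])
      hence "\<zero>\<^bsub>R\<^esub> \<oplus>\<^bsub>R\<^esub> (\<zero>\<^bsub>R\<^esub> \<oplus>\<^bsub>R\<^esub> a) \<in> set_add R (I m) (I n +>\<^bsub>R\<^esub> a)"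
        unfolding set_add_def' a_r_coset_def' by blast
      ultimately have "a \<in> I m +>\<^bsub>R\<^esub> b"
        using a b by simp
      hence "a \<in> J m +>\<^bsub>R\<^esub> b" using IJ[of m] by (auto simp: a_r_coset_def')
      hence *: "J m +>\<^bsub>R\<^esub> b = J m +>\<^bsub>R\<^esub> a"
        by (rule abelian_subgroup.a_repr_independence'[OF abelian_subgroupI3[OF ideal.axioms(1)[OF J] R.is_abelian_group] _ b(1)])
      thus ?thesis
        using set_add_coset[OF J J J_dec[OF that] a(1)] by (simp add: map[of x n, OF a(2,1)] map[of x m, OF b(2,1)] *)
    qed
    moreover have "completion_map R J x n \<in> carrier (R Quot J n)" for n
    proof -
      obtain a where "a \<in> carrier R" "x n = I n +>\<^bsub>R\<^esub> a" using rep[OF x] by blast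
      thus ?thesis using map[of x n] by (auto simp: FactRing_simps)
    qed
    ultimately show "completion_map R J x \<in> carrier (completion R J)"
      by (simp add: completion_def)
  next
    fix x y assume x: "x \<in> carrier (completion R I)" and y: "y \<in> carrier (completion R I)"
    have "completion_map R J (\<lambda>n. x n \<otimes>\<^bsub>R Quot I n\<^esub> y n) n =
            completion_map R J x n \<otimes>\<^bsub>R Quot J n\<^esub> completion_map R J y n
        \<and> completion_map R J (\<lambda>n. x n \<oplus>\<^bsub>R Quot I n\<^esub> y n) n =
            completion_map R J x n \<oplus>\<^bsub>R Quot J n\<^esub> completion_map R J y n" for n
    proof -
      obtain a where a: "a \<in> carrier R" "x n = I n +>\<^bsub>R\<^esub> a" using rep[OF x] by blast
      obtain b where b: "b \<in> carrier R" "y n = I n +>\<^bsub>R\<^esub> b" using rep[OF y] by blast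
      have "x n \<otimes>\<^bsub>R Quot I n\<^esub> y n = I n +>\<^bsub>R\<^esub> (a \<otimes>\<^bsub>R\<^esub> b)"
           "x n \<oplus>\<^bsub>R Quot I n\<^esub> y n = I n +>\<^bsub>R\<^esub> (a \<oplus>\<^bsub>R\<^esub> b)"
        using a b by (simp_all add: FactRing_def ideal.rcoset_mult_add[OF I] ideal.a_rcos_sum[OF I])
      thus ?thesis
        using a b map[of "\<lambda>n. x n \<otimes>\<^bsub>R Quot I n\<^esub> y n" n "a \<otimes>\<^bsub>R\<^esub> b"]
          map[of "\<lambda>n. x n \<oplus>\<^bsub>R Quot I n\<^esub> y n" n "a \<oplus>\<^bsub>R\<^esub> b"]
        by (simp add: map[of x n, OF a(2,1)] map[of y n, OF b(2,1)] FactRing_def ideal.rcoset_mult_add[OF J]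
            ideal.a_rcos_sum[OF J])
    qed
    thus "completion_map R J (x \<otimes>\<^bsub>completion R I\<^esub> y) =
            completion_map R J x \<otimes>\<^bsub>completion R J\<^esub> completion_map R J y"
      and "completion_map R J (x \<oplus>\<^bsub>completion R I\<^esub> y) =
            completion_map R J x \<oplus>\<^bsub>completion R J\<^esub> completion_map R J y"
      by (auto simp: completion_def)
  next
    show "completion_map R J \<one>\<^bsub>completion R I\<^esub> = \<one>\<^bsub>completion R J\<^esub>"
    proof
      fix n
      show "completion_map R J \<one>\<^bsub>completion R I\<^esub> n = \<one>\<^bsub>completion R J\<^esub> n"
        using map[of "\<one>\<^bsub>completion R I\<^esub>" n "\<one>\<^bsub>R\<^esub>"] by (simp add: completion_def FactRing_def)
    qed
  qed
qed

lemma ideal_powers_0: "ideal_powers R I 0 = carrier R"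
  and ideal_powers_Suc: "ideal_powers R I (Suc n) = ideal_prod R (ideal_powers R I n) I"
  by (simp_all add: ideal_powers_def ideals_set_def nat_pow_def)

lemma ideal_ideal_powers:
  assumes "ideal I R"
  shows "ideal (ideal_powers R I n) R"
proof -
  interpret R: ring R using assms by (rule ideal.axioms(2))
  show ?thesis
    by (induction n) (simp_all add: ideal_powers_0 ideal_powers_Suc R.oneideal
        R.ideal_prod_is_ideal assms)
qed

lemma ideal_powers_decreasing:
  assumes "ideal I R" "m \<le> n"
  shows "ideal_powers R I n \<subseteq> ideal_powers R I m"
proof -
  interpret R: ring R using assms(1) by (rule ideal.axioms(2))
  show ?thesis
    using assms(2)
  proof (induction n rule: dec_induct)
    case (step n)
    thus ?case
      using R.ideal_prod_inter[OF ideal_ideal_powers[OF assms(1)] assms(1), of n]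
      by (auto simp: ideal_powers_Suc)
  qed simp
qed

lemma completion_map_ideal_powers_ring_hom:
  assumes "\<And>n. ideal (I n) R" "\<And>n. I n \<subseteq> ideal_powers R (I 1) n"
  shows "completion_map R (ideal_powers R (I 1))
           \<in> ring_hom (completion R I) (completion R (ideal_powers R (I 1)))"
  by (rule completion_map_ring_hom[OF assms(1) ideal_ideal_powers[OF assms(1)] assms(2)
        ideal_powers_decreasing[OF assms(1)]])

lemma usl2_diffI: "x - y \<in> usl2_ideal \<Longrightarrow> abs_usl2 x = abs_usl2 y"
  using Quotient_rel_abs[OF Quotient_usl2, of x y] by (simp add: usl2_rel_def)

lemma relator_in_usl2_ideal: "x \<in> usl2_relators \<Longrightarrow> x \<in> usl2_ideal"
  unfolding usl2_ideal_def using ring.genideal_self[OF ring_of_type_algebra_ring, of usl2_relators]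
  by auto

lemma uK_uKinv: "uK * uKinv = 1" and uKinv_uK: "uKinv * uK = 1"
  and uK_uE: "uK * uE = usl2_scalar (qv_v ^ 2) * uE * uK"
  and uK_uF: "uK * uF = usl2_scalar (inverse qv_v ^ 2) * uF * uK"
  and uE_uF: "uE * uF - uF * uE = usl2_scalar (inverse (qv_v - inverse qv_v)) * (uK - uKinv)"
  by (transfer; simp add: usl2_rel_def, rule relator_in_usl2_ideal, simp add: usl2_relators_def)+

lemma qv_v_nonzero: "qv_v \<noteq> 0"
  by (simp add: qv_v_def Zero_fract_def eq_fract)

lemma usl2_scalar_mult: "usl2_scalar (a * b) = usl2_scalar a * usl2_scalar b"
  and usl2_scalar_diff: "usl2_scalar (a - b) = usl2_scalar a - usl2_scalar b"
  and usl2_scalar_one: "usl2_scalar 1 = 1"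
  by (transfer; simp add: usl2_rel_def fscalar_def Poly_Mapping.mult_single single_diff
        usl2_ideal_zero)+

lemma fscalar_commute: "fscalar c * x = x * fscalar c"
proof -
  have "fscalar c * Poly_Mapping.single w d = Poly_Mapping.single w d * fscalar c" for w d
    by (simp add: fscalar_def Poly_Mapping.mult_single mult.commute)
  hence "fscalar c * (\<Sum>w\<in>A. Poly_Mapping.single w (f w)) =
         (\<Sum>w\<in>A. Poly_Mapping.single w (f w)) * fscalar c" for A f
    by (simp add: sum_distrib_left sum_distrib_right)
  thus ?thesis by (metis sum_single_lookup)
qed

lemma usl2_scalar_commute: "usl2_scalar c * x = x * usl2_scalar c"
  by transfer (simp add: usl2_rel_def fscalar_commute usl2_ideal_zero)

lemma usl2_scalar_left_commute: "x * (usl2_scalar c * y) = usl2_scalar c * (x * y)"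
  by (metis mult.assoc usl2_scalar_commute)

lemma uK_ue: "uK * ue = usl2_scalar (qv_v ^ 2) * ue * uK"
  unfolding ue_def using uK_uE usl2_scalar_left_commute[of uK "qv_v - inverse qv_v" uE]
    usl2_scalar_left_commute[of "usl2_scalar (qv_v - inverse qv_v)" "qv_v ^ 2" "uE * uK"]
  by (simp add: mult.assoc)

lemma ue_uK: "ue * uK = usl2_scalar (inverse qv_v ^ 2) * uK * ue"
proof -
  have "usl2_scalar (inverse qv_v ^ 2) * uK * ue = usl2_scalar (inverse qv_v ^ 2 * qv_v ^ 2) * ue * uK"
    by (simp add: mult.assoc uK_ue usl2_scalar_mult)
  thus ?thesis by (simp add: qv_v_nonzero usl2_scalar_one power_mult_distrib[symmetric])
qed

lemma ue_uKinv: "ue * uKinv = usl2_scalar (qv_v ^ 2) * uKinv * ue"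
proof -
  have "ue * uKinv = uKinv * (uK * ue) * uKinv"
    by (simp add: mult.assoc[symmetric] uKinv_uK)
  also have "\<dots> = usl2_scalar (qv_v ^ 2) * uKinv * ue"
    by (simp add: uK_ue mult.assoc usl2_scalar_left_commute[of uKinv] uK_uKinv)
  finally show ?thesis .
qed

lemma laurent_subalgebra_one: "1 \<in> laurent_subalgebra S"
  and laurent_subalgebra_incl: "x \<in> S \<Longrightarrow> x \<in> laurent_subalgebra S"
  and laurent_subalgebra_scalar: "c \<in> laurent \<Longrightarrow> usl2_scalar c \<in> laurent_subalgebra S"
  and laurent_subalgebra_uminus: "x \<in> laurent_subalgebra S \<Longrightarrow> - x \<in> laurent_subalgebra S"
  and laurent_subalgebra_add:
    "x \<in> laurent_subalgebra S \<Longrightarrow> y \<in> laurent_subalgebra S \<Longrightarrow> x + y \<in> laurent_subalgebra S"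
  and laurent_subalgebra_mult:
    "x \<in> laurent_subalgebra S \<Longrightarrow> y \<in> laurent_subalgebra S \<Longrightarrow> x * y \<in> laurent_subalgebra S"
  unfolding laurent_subalgebra_def
  using generate_ring.one[of ring_of_type_algebra "usl2_scalar ` laurent \<union> S"]
    generate_ring.incl[of _ "usl2_scalar ` laurent \<union> S" ring_of_type_algebra]
    generate_ring.a_inv[of _ ring_of_type_algebra "usl2_scalar ` laurent \<union> S"]
    generate_ring.eng_add[of _ ring_of_type_algebra "usl2_scalar ` laurent \<union> S"]
    generate_ring.eng_mult[of _ ring_of_type_algebra "usl2_scalar ` laurent \<union> S"]
  by auto

lemma laurent_subalgebra_zero: "0 \<in> laurent_subalgebra S"
  using laurent_subalgebra_add[OF laurent_subalgebra_one laurent_subalgebra_uminus[OF laurent_subalgebra_one]]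
  by simp

lemma laurent_subalgebra_diff:
  "x \<in> laurent_subalgebra S \<Longrightarrow> y \<in> laurent_subalgebra S \<Longrightarrow> x - y \<in> laurent_subalgebra S"
  using laurent_subalgebra_add[OF _ laurent_subalgebra_uminus, of x S y] by simp

lemma laurent_subalgebra_power: "x \<in> laurent_subalgebra S \<Longrightarrow> x ^ n \<in> laurent_subalgebra S"
  by (induction n) (simp_all add: laurent_subalgebra_one laurent_subalgebra_mult)

lemmas laurent_subalgebra_closed =
  laurent_subalgebra_one laurent_subalgebra_zero laurent_subalgebra_uminus laurent_subalgebra_add
  laurent_subalgebra_diff laurent_subalgebra_mult laurent_subalgebra_power

lemma laurent_subalgebra_induct [consumes 1, case_names scalar incl one uminus add mult]:
  assumes "x \<in> laurent_subalgebra S"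
    and "\<And>c. c \<in> laurent \<Longrightarrow> P (usl2_scalar c)"
    and "\<And>x. x \<in> S \<Longrightarrow> P x"
    and "P 1"
    and "\<And>x. x \<in> laurent_subalgebra S \<Longrightarrow> P x \<Longrightarrow> P (- x)"
    and "\<And>x y. x \<in> laurent_subalgebra S \<Longrightarrow> P x \<Longrightarrow> y \<in> laurent_subalgebra S \<Longrightarrow> P y \<Longrightarrow> P (x + y)"
    and "\<And>x y. x \<in> laurent_subalgebra S \<Longrightarrow> P x \<Longrightarrow> y \<in> laurent_subalgebra S \<Longrightarrow> P y \<Longrightarrow> P (x * y)"
  shows "P x"
  using assms(1) unfolding laurent_subalgebra_def
  by (induction rule: generate_ring.induct) (use assms(2-) in \<open>auto simp: laurent_subalgebra_def\<close>)

lemma usl2_subring_ring: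
  assumes "1 \<in> S" "\<And>x. x \<in> S \<Longrightarrow> - x \<in> S" "\<And>x y. x \<in> S \<Longrightarrow> y \<in> S \<Longrightarrow> x + y \<in> S"
    "\<And>x y. x \<in> S \<Longrightarrow> y \<in> S \<Longrightarrow> x * y \<in> S"
  shows "ring (usl2_subring S)"
proof -
  have "0 \<in> S" using assms(3)[OF assms(1) assms(2)[OF assms(1)]] by simp
  show ?thesis
  proof (rule ringI)
    show "abelian_group (usl2_subring S)"
    proof (rule abelian_groupI)
      fix x assume "x \<in> carrier (usl2_subring S)"
      thus "\<exists>y\<in>carrier (usl2_subring S). y \<oplus>\<^bsub>usl2_subring S\<^esub> x = \<zero>\<^bsub>usl2_subring S\<^esub>"
        using assms(2)[of x] by (auto intro!: bexI[of _ "- x"])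
    qed (use assms \<open>0 \<in> S\<close> in \<open>auto simp: algebra_simps\<close>)
    show "Group.monoid (usl2_subring S)"
      by (rule monoidI) (use assms in \<open>auto simp: algebra_simps\<close>)
  qed (auto simp: algebra_simps)
qed

lemma laurent_subalgebra_ring: "ring (usl2_subring (laurent_subalgebra S))"
  by (rule usl2_subring_ring) (auto intro: laurent_subalgebra_closed)

lemma ideal_usl2_subring_iff:
  assumes "ring (usl2_subring S)"
  shows "ideal I (usl2_subring S) \<longleftrightarrow> I \<subseteq> S \<and> 0 \<in> I \<and> (\<forall>x\<in>I. \<forall>y\<in>I. x + y \<in> I)
           \<and> (\<forall>a\<in>S. \<forall>x\<in>I. a * x \<in> I \<and> x * a \<in> I)" (is "?l \<longleftrightarrow> ?r")
proof
  assume ?l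
  then interpret I: ideal I "usl2_subring S" .
  show ?r
    using I.a_subset additive_subgroup.zero_closed[OF I.is_additive_subgroup]
      additive_subgroup.a_closed[OF I.is_additive_subgroup] I.I_l_closed I.I_r_closed by auto
next
  assume r: ?r
  interpret S: ring "usl2_subring S" by (rule assms)
  have S1: "- 1 \<in> S"
    using S.add.inv_closed[of 1] S.one_closed S.l_neg[of 1]
    by (auto simp: a_inv_def[symmetric] eq_neg_iff_add_eq_0[symmetric])
  have "inv\<^bsub>add_monoid (usl2_subring S)\<^esub> x = - x" if "x \<in> I" for x
  proof -
    have "x \<in> S" using r that by auto
    moreover have "- x \<in> S" using S.m_closed[of "- 1" x] S1 \<open>x \<in> S\<close> by simp
    ultimately show ?thesis using S.minus_equality[of "- x" x] by (simp add: a_inv_def)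
  qed
  moreover have "- x \<in> I" if "x \<in> I" for x using r S1 that by force
  ultimately have "subgroup I (add_monoid (usl2_subring S))"
    using r by (auto simp: subgroup_def)
  thus ?l by (rule idealI[OF assms]) (use r in auto)
qed

lemma U0_ring: "ring (usl2_subring U0)"
  and U_plus_ring: "ring (usl2_subring U_plus)"
  and U_int_ring: "ring (usl2_subring U_int)"
  by (simp_all add: U0_def U_plus_def U_int_def laurent_subalgebra_ring)

lemma laurent_one: "1 \<in> laurent"
  and laurent_v: "qv_v \<in> laurent" "inverse qv_v \<in> laurent"
  and laurent_mult: "a \<in> laurent \<Longrightarrow> b \<in> laurent \<Longrightarrow> a * b \<in> laurent"
  unfolding laurent_def
  using generate_ring.one[of ring_of_type_algebra "{qv_v, inverse qv_v}"]
    generate_ring.incl[of _ "{qv_v, inverse qv_v}" ring_of_type_algebra]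
    generate_ring.eng_mult[of a ring_of_type_algebra "{qv_v, inverse qv_v}" b]
  by auto

lemma laurent_power: "a \<in> laurent \<Longrightarrow> a ^ n \<in> laurent"
  by (induction n) (simp_all add: laurent_one laurent_mult)

lemma laurent_powi: "qv_v powi k \<in> laurent"
  by (simp add: power_int_def laurent_v laurent_power)

definition H_factor :: "int \<Rightarrow> usl2" where
  "H_factor k = usl2_scalar (qv_v powi k) * uK - usl2_scalar (qv_v powi (- k)) * uKinv"

lemma H_shift_0: "H_shift m 0 = 1"
  and H_shift_Suc: "H_shift m (Suc i) = H_shift m i * H_factor (m - int i)"
  by (simp_all add: H_shift_def H_factor_def)

lemma H_shift_1: "H_shift m (Suc 0) = H_factor m"
  by (simp add: H_shift_Suc H_shift_0)

lemma ue_H_factor: "ue * H_factor k = H_factor (k - 2) * ue"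
proof -
  have "qv_v powi (k - 2) = qv_v powi k * inverse qv_v ^ 2"
    by (simp add: power_int_diff qv_v_nonzero field_simps)
  moreover have "qv_v powi (- (k - 2)) = qv_v powi (- k) * qv_v ^ 2"
    using power_int_add[of qv_v "- k" 2] by (simp add: qv_v_nonzero add.commute)
  ultimately show ?thesis
    unfolding H_factor_def
    by (simp add: right_diff_distrib left_diff_distrib usl2_scalar_left_commute[of ue] ue_uK ue_uKinv
        usl2_scalar_mult mult.assoc)
qed

lemma ue_H_shift: "ue * H_shift m i = H_shift (m - 2) i * ue"
proof (induction i)
  case (Suc i)
  have "ue * H_shift m (Suc i) = H_shift (m - 2) i * (ue * H_factor (m - int i))"
    by (simp add: H_shift_Suc mult.assoc[symmetric] Suc)
  also have "\<dots> = H_shift (m - 2) (Suc i) * ue"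
    by (simp add: ue_H_factor H_shift_Suc mult.assoc algebra_simps)
  finally show ?case .
qed (simp add: H_shift_0)

lemma U0_uK: "uK \<in> U0" "uKinv \<in> U0"
  and U_plus_ue: "ue \<in> U_plus"
  and U_int_gens: "uK \<in> U_int" "uKinv \<in> U_int" "ue \<in> U_int"
  by (simp_all add: U0_def U_plus_def U_int_def laurent_subalgebra_incl)

lemmas U0_closed = laurent_subalgebra_closed[where S = "{uK, uKinv}", folded U0_def]
  and U_plus_closed = laurent_subalgebra_closed[where S = "{ue}", folded U_plus_def]
  and U_int_closed =
    laurent_subalgebra_closed[where S = "{uK, uKinv, ue} \<union> {uFdiv n | n. n \<ge> 1}", folded U_int_def]

lemma usl2_scalar_U0: "c \<in> laurent \<Longrightarrow> usl2_scalar c \<in> U0"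
  and usl2_scalar_U_plus: "c \<in> laurent \<Longrightarrow> usl2_scalar c \<in> U_plus"
  and usl2_scalar_U_int: "c \<in> laurent \<Longrightarrow> usl2_scalar c \<in> U_int"
  by (simp_all add: U0_def U_plus_def U_int_def laurent_subalgebra_scalar)

lemma H_factor_U0: "H_factor k \<in> U0" and H_factor_U_int: "H_factor k \<in> U_int"
  unfolding H_factor_def
  by (intro U0_closed U_int_closed usl2_scalar_U0 usl2_scalar_U_int laurent_powi U0_uK U_int_gens)+

lemma H_shift_U0: "H_shift m i \<in> U0" and H_shift_U_int: "H_shift m i \<in> U_int"
  by (induction i)
     (simp_all add: H_shift_0 H_shift_Suc U0_closed U_int_closed H_factor_U0 H_factor_U_int)

lemma U0_filt_ideal: "ideal (U0_filt n) (usl2_subring U0)"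
  unfolding U0_filt_def by (rule ring.genideal_ideal[OF U0_ring]) (auto simp: H_shift_U0)

lemma U_int_filt_ideal: "ideal (U_int_filt n) (usl2_subring U_int)"
  unfolding U_int_filt_def
  by (rule ring.genideal_ideal[OF U_int_ring])
     (auto intro!: U_int_closed H_shift_U_int U_int_gens)

lemmas U0_filtD = U0_filt_ideal[unfolded ideal_usl2_subring_iff[OF U0_ring]]

lemma H_shift_U0_filt: "H_shift m n \<in> U0_filt n"
  unfolding U0_filt_def
  by (rule set_mp[OF ring.genideal_self[OF U0_ring]]) (auto simp: H_shift_U0)

lemma U_int_filt_gens: "i \<le> n \<Longrightarrow> H_shift m i * ue ^ (n - i) \<in> U_int_filt n"
  unfolding U_int_filt_def
  by (rule set_mp[OF ring.genideal_self[OF U_int_ring]])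
     (auto intro!: U_int_closed H_shift_U_int U_int_gens)

lemma ideal_prod_usl2_subring: "ideal_prod (usl2_subring S) I J = span_prod I J"
proof (intro equalityI subsetI)
  fix x assume "x \<in> ideal_prod (usl2_subring S) I J"
  thus "x \<in> span_prod I J"
    by induction (auto intro: ideal_prod.prod[of _ _ _ _ ring_of_type_algebra, simplified]
      ideal_prod.sum[of _ ring_of_type_algebra, simplified])
next
  fix x assume "x \<in> span_prod I J"
  thus "x \<in> ideal_prod (usl2_subring S) I J"
    by induction (auto intro: ideal_prod.prod[of _ _ _ _ "usl2_subring S", simplified]
      ideal_prod.sum[of _ "usl2_subring S", simplified])
qed

lemma span_prodI: "a \<in> A \<Longrightarrow> b \<in> B \<Longrightarrow> a * b \<in> span_prod A B"
  and span_prod_add: "x \<in> span_prod A B \<Longrightarrow> y \<in> span_prod A B \<Longrightarrow> x + y \<in> span_prod A B"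
  using ideal_prod.prod[of a A b B ring_of_type_algebra]
    ideal_prod.sum[of x ring_of_type_algebra A B y] by auto

lemma span_prod_induct [consumes 1, case_names prod add]:
  assumes "x \<in> span_prod A B" "\<And>a b. a \<in> A \<Longrightarrow> b \<in> B \<Longrightarrow> P (a * b)"
    and "\<And>x y. x \<in> span_prod A B \<Longrightarrow> P x \<Longrightarrow> y \<in> span_prod A B \<Longrightarrow> P y \<Longrightarrow> P (x + y)"
  shows "P x"
  using assms(1) by induction (use assms(2,3) in auto)

lemma power_in_ideal_powers:
  assumes "ideal I (usl2_subring S)" "x \<in> ideal_powers (usl2_subring S) I m" "y \<in> I"
  shows "x * y ^ n \<in> ideal_powers (usl2_subring S) I (m + n)"
proof (induction n)
  case (Suc n)
  have "x * y ^ Suc n = (x * y ^ n) * y" by (simp add: power_commutes mult.assoc)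
  thus ?case
    using span_prodI[OF Suc assms(3)] by (simp add: ideal_powers_Suc ideal_prod_usl2_subring)
qed (use assms in simp)

lemma H_shift_in_ideal_powers:
  assumes "ideal I (usl2_subring S)" "\<And>k. H_factor k \<in> I" "1 \<in> S"
  shows "H_shift m i \<in> ideal_powers (usl2_subring S) I i"
proof (induction i)
  case (Suc i)
  show ?case
    using span_prodI[OF Suc assms(2)]
    by (simp add: ideal_powers_Suc ideal_prod_usl2_subring H_shift_Suc)
qed (simp add: ideal_powers_0 H_shift_0 assms)

lemma U0_filt_subset: "U0_filt n \<subseteq> ideal_powers (usl2_subring U0) (U0_filt 1) n"
  unfolding U0_filt_def[of n]
  by (rule ring.genideal_minimal[OF U0_ring ideal_ideal_powers[OF U0_filt_ideal]])
     (auto intro!: H_shift_in_ideal_powers U0_filt_ideal U0_closed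
        simp: H_shift_U0_filt H_shift_1[symmetric])

lemma U_int_filt_subset: "U_int_filt n \<subseteq> ideal_powers (usl2_subring U_int) (U_int_filt 1) n"
proof -
  have 1: "H_factor k \<in> U_int_filt 1" for k
    using U_int_filt_gens[of 1 1 k] by (simp add: H_shift_1)
  have 2: "ue \<in> U_int_filt 1"
    using U_int_filt_gens[of 0 1] by (simp add: H_shift_0)
  have "H_shift m i * ue ^ (n - i) \<in> ideal_powers (usl2_subring U_int) (U_int_filt 1) n"
    if "i \<le> n" for m i
    using power_in_ideal_powers[OF U_int_filt_ideal
        H_shift_in_ideal_powers[OF U_int_filt_ideal 1 U_int_closed(1)] 2, of m i "n - i"] that
    by simp
  thus ?thesis
    unfolding U_int_filt_def[of n]
    by (intro ring.genideal_minimal[OF U_int_ring ideal_ideal_powers[OF U_int_filt_ideal]]) auto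
qed

lemma U0_filt_0: "U0_filt 0 = U0"
  using U0_filtD[of 0] H_shift_U0_filt[of 0 0] by (force simp: H_shift_0)

text \<open>Moving \<open>ue\<close> past \<open>U0\<close> twists by an automorphism of \<open>U0\<close> that preserves \<open>U0_filt i\<close>.\<close>

lemma ue_U0:
  assumes "x \<in> U0"
  shows "\<exists>y\<in>U0. ue * x = y * ue"
  using assms unfolding U0_def
proof (induction rule: laurent_subalgebra_induct)
  case (scalar c)
  thus ?case using usl2_scalar_commute by (metis laurent_subalgebra_scalar)
next
  case (incl x)
  have "usl2_scalar (inverse qv_v ^ 2) * uK \<in> U0" "usl2_scalar (qv_v ^ 2) * uKinv \<in> U0"
    by (intro U0_closed usl2_scalar_U0 U0_uK laurent_power laurent_v)+
  thus ?case using incl ue_uK ue_uKinv by (auto simp: U0_def)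
next
  case one
  thus ?case by (auto intro!: bexI[of _ 1] laurent_subalgebra_closed)
next
  case (uminus x)
  then obtain y where "y \<in> U0" "ue * x = y * ue" by (auto simp: U0_def)
  thus ?case by (auto simp: U0_def intro!: bexI[of _ "- y"] laurent_subalgebra_closed)
next
  case (add x x')
  then obtain y y' where "y \<in> U0" "ue * x = y * ue" "y' \<in> U0" "ue * x' = y' * ue"
    by (auto simp: U0_def)
  thus ?case
    by (auto simp: U0_def algebra_simps intro!: bexI[of _ "y + y'"] laurent_subalgebra_closed)
next
  case (mult x x')
  then obtain y y' where y: "y \<in> U0" "ue * x = y * ue" "y' \<in> U0" "ue * x' = y' * ue"
    by (auto simp: U0_def)
  have "ue * (x * x') = y * y' * ue"
    by (metis y(2,4) mult.assoc)
  thus ?case using y by (auto simp: U0_def intro!: laurent_subalgebra_closed)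
qed

lemma ue_U0_filt:
  assumes "x \<in> U0_filt i"
  shows "\<exists>y\<in>U0_filt i. ue * x = y * ue"
proof -
  let ?I = "{x \<in> U0. \<exists>y\<in>U0_filt i. ue * x = y * ue}"
  have "ideal ?I (usl2_subring U0)"
    unfolding ideal_usl2_subring_iff[OF U0_ring]
  proof (intro conjI ballI)
    show "0 \<in> ?I" using U0_filtD[of i] U0_closed(2) by force
    fix x x' assume "x \<in> ?I" "x' \<in> ?I"
    then obtain y y' where "x \<in> U0" "x' \<in> U0" "y \<in> U0_filt i" "ue * x = y * ue"
      "y' \<in> U0_filt i" "ue * x' = y' * ue" by auto
    thus "x + x' \<in> ?I"
      using U0_filtD[of i] by (auto simp: algebra_simps U0_closed intro!: bexI[of _ "y + y'"])
  next
    fix a x assume "a \<in> U0" "x \<in> ?I"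
    then obtain b y where *: "a \<in> U0" "x \<in> U0" "b \<in> U0" "ue * a = b * ue" "y \<in> U0_filt i"
      "ue * x = y * ue" using ue_U0[of a] by auto
    have "ue * (a * x) = b * y * ue" "ue * (x * a) = y * b * ue"
      by (metis *(4,6) mult.assoc)+
    thus "a * x \<in> ?I" "x * a \<in> ?I" using * U0_filtD[of i] by (auto simp: U0_closed)
  qed auto
  moreover have "{H_shift m i | m. True} \<subseteq> ?I"
    using ue_H_shift H_shift_U0_filt H_shift_U0 by blast
  ultimately have "U0_filt i \<subseteq> ?I"
    unfolding U0_filt_def[of i] by (rule ring.genideal_minimal[OF U0_ring])
  thus ?thesis using assms by auto
qed

lemma U_plus_U0_filt:
  assumes "r \<in> U_plus" "x \<in> U0_filt i"
  shows "r * x \<in> span_prod (U0_filt i) U_plus"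
  using assms unfolding U_plus_def
proof (induction arbitrary: x rule: laurent_subalgebra_induct)
  case (scalar c)
  thus ?case by (auto simp: usl2_scalar_commute intro!: span_prodI laurent_subalgebra_scalar)
next
  case (incl r)
  then obtain y where "y \<in> U0_filt i" "ue * x = y * ue" using ue_U0_filt by blast
  thus ?case using incl by (auto intro!: span_prodI laurent_subalgebra_incl)
next
  case one
  thus ?case using span_prodI[OF one laurent_subalgebra_one] by simp
next
  case (uminus r)
  have "- x \<in> U0_filt i"
    using uminus.prems U0_filtD[of i] U0_closed(3)[OF U0_closed(1)] by force
  thus ?case using uminus.IH[of "- x"] by simp
next
  case (add r s)
  thus ?case by (simp add: algebra_simps span_prod_add)
next
  case (mult r s)
  have "r * z \<in> span_prod (U0_filt i) (laurent_subalgebra {ue})"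
    if "z \<in> span_prod (U0_filt i) (laurent_subalgebra {ue})" for z
    using that
  proof (induction rule: span_prod_induct)
    case (prod a b)
    have "y * b \<in> span_prod (U0_filt i) (laurent_subalgebra {ue})"
      if "y \<in> span_prod (U0_filt i) (laurent_subalgebra {ue})" for y
      using that
      by (induction rule: span_prod_induct)
         (auto simp: algebra_simps intro!: span_prodI span_prod_add laurent_subalgebra_closed prod)
    from this[OF mult.IH(1)[OF prod(1)]] show ?case by (simp add: mult.assoc)
  qed (simp add: algebra_simps span_prod_add)
  thus ?case using mult.IH(2)[OF mult.prems] by (simp add: mult.assoc)
qed

lemma U_plus_commute:
  assumes "r \<in> U_plus"
  shows "r * ue ^ j = ue ^ j * r"
proof -
  have "r * ue = ue * r"
    using assms unfolding U_plus_def
    by (induction rule: laurent_subalgebra_induct)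
       (auto simp: usl2_scalar_commute algebra_simps, metis mult.assoc)
  thus ?thesis
    by (induction j) (simp_all, metis mult.assoc)
qed

text \<open>\<open>Uge0_part i j\<close> is $\mathcal U^0_i \mathcal U^+_j$.\<close>

abbreviation Uge0_part :: "nat \<Rightarrow> nat \<Rightarrow> usl2 set" where
  "Uge0_part i j \<equiv> span_prod (U0_filt i) (U_plus_filt j)"

lemma Uge0_eq_part: "Uge0 = Uge0_part 0 0"
proof -
  have "U_plus_filt 0 = U_plus" by (simp add: U_plus_filt_def)
  thus ?thesis by (simp add: Uge0_def U0_filt_0)
qed

lemma Uge0_part_absorb:
  assumes "x \<in> Uge0_part i j" "y \<in> Uge0"
  shows "x * y \<in> Uge0_part i j" "y * x \<in> Uge0_part i j"
proof -
  have filt_mult: "s * b \<in> U_plus_filt j" "b * s \<in> U_plus_filt j"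
    if b: "b \<in> U_plus_filt j" and s: "s \<in> U_plus" for b s
  proof -
    obtain q where q: "q \<in> U_plus" "b = ue ^ j * q" using b by (auto simp: U_plus_filt_def)
    have "s * b = ue ^ j * (s * q)" using q U_plus_commute[OF s] by (metis mult.assoc)
    moreover have "b * s = ue ^ j * (q * s)" using q by (simp add: mult.assoc)
    ultimately show "s * b \<in> U_plus_filt j" "b * s \<in> U_plus_filt j"
      using q s by (auto simp: U_plus_filt_def U_plus_closed)
  qed
  have left: "a * z * b \<in> Uge0_part i j"
    if "z \<in> span_prod (U0_filt i) U_plus" "a \<in> U0" "b \<in> U_plus_filt j" for z a b
    using that(1)
  proof (induction rule: span_prod_induct)
    case (prod c d)
    have "a * c \<in> U0_filt i" using U0_filtD[of i] prod that by auto
    from span_prodI[OF this filt_mult(1)[OF that(3) prod(2)]] show ?case by (simp add: mult.assoc)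
  qed (auto simp: algebra_simps intro: span_prod_add)
  have right: "a * (ue ^ j * z) * s \<in> Uge0_part i j"
    if "z \<in> span_prod U0 U_plus" "a \<in> U0_filt i" "s \<in> U_plus" for z a s
  proof -
    have *: "\<exists>d\<in>U0. ue ^ j * c = d * ue ^ j" if "c \<in> U0" for c
    proof (induction j)
      case (Suc j)
      then obtain d where d: "d \<in> U0" "ue ^ j * c = d * ue ^ j" by auto
      obtain d' where d': "d' \<in> U0" "ue * d = d' * ue" using ue_U0[OF d(1)] by auto
      have "ue ^ Suc j * c = d' * ue ^ Suc j"
        using d(2) d'(2) by (simp add: mult.assoc) (metis mult.assoc)
      thus ?case using d' by auto
    qed (use that in simp)
    from that(1) show ?thesis
    proof (induction rule: span_prod_induct)
      case (prod c r)
      obtain d where d: "d \<in> U0" "ue ^ j * c = d * ue ^ j" using * prod by auto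
      have "a * (ue ^ j * (c * r)) * s = a * ((ue ^ j * c) * r) * s" by (simp add: mult.assoc)
      also have "\<dots> = (a * d) * (ue ^ j * (r * s))" by (simp add: d mult.assoc)
      finally show ?case
        using d prod that U0_filtD[of i]
        by (auto simp: U_plus_filt_def U_plus_closed intro!: span_prodI)
    qed (auto simp: algebra_simps intro: span_prod_add)
  qed
  have U_plus_U0: "r * c \<in> span_prod U0 U_plus" if "r \<in> U_plus" "c \<in> U0" for r c
    using U_plus_U0_filt[of r c 0] that by (simp add: U0_filt_0)
  show "x * y \<in> Uge0_part i j"
    using assms(1)
  proof (induction rule: span_prod_induct)
    case (prod a b)
    then obtain q where q: "q \<in> U_plus" "b = ue ^ j * q" by (auto simp: U_plus_filt_def)
    from assms(2) show ?case
      unfolding Uge0_def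
    proof (induction rule: span_prod_induct)
      case (prod c s)
      from right[OF U_plus_U0[OF q(1) prod(1)] \<open>a \<in> U0_filt i\<close> prod(2)]
      show ?case by (simp add: q mult.assoc)
    qed (auto simp: algebra_simps intro: span_prod_add)
  qed (auto simp: algebra_simps intro: span_prod_add)
  show "y * x \<in> Uge0_part i j"
    using assms(1)
  proof (induction rule: span_prod_induct)
    case (prod a b)
    from assms(2) show ?case
      unfolding Uge0_def
    proof (induction rule: span_prod_induct)
      case (prod c s)
      from left[OF U_plus_U0_filt[OF prod(2) \<open>a \<in> U0_filt i\<close>] prod(1) \<open>b \<in> U_plus_filt j\<close>]
      show ?case by (simp add: mult.assoc)
    qed (auto simp: algebra_simps intro: span_prod_add)
  qed (auto simp: algebra_simps intro: span_prod_add)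
qed

lemma Uge0_part_subset: "Uge0_part i j \<subseteq> Uge0"
proof
  fix x assume "x \<in> Uge0_part i j"
  thus "x \<in> Uge0"
    unfolding Uge0_def
    by (induction rule: span_prod_induct)
       (use U0_filtD[of i] in \<open>auto simp: U_plus_filt_def U_plus_closed U_plus_ue
          intro!: span_prodI span_prod_add\<close>)
qed

lemma Uge0_part_zero: "0 \<in> Uge0_part i j"
  using span_prodI[of 0 "U0_filt i" "ue ^ j * 1" "U_plus_filt j"] U0_filtD[of i]
    imageI[OF U_plus_closed(1), of "\<lambda>x. ue ^ j * x"]
  by (simp add: U_plus_filt_def)

lemma Uge0_ring: "ring (usl2_subring Uge0)"
proof (rule usl2_subring_ring)
  show "1 \<in> Uge0" using span_prodI[OF U0_closed(1) U_plus_closed(1)] by (simp add: Uge0_def)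
  fix x y assume "x \<in> Uge0"
  thus "- x \<in> Uge0"
    unfolding Uge0_def
  proof (induction rule: span_prod_induct)
    case (prod a b)
    thus ?case using span_prodI[OF U0_closed(3)[OF prod(1)] prod(2)] by simp
  next
    case (add x y)
    have "- (x + y) = - x + - y" by simp
    thus ?case using span_prod_add[OF add.IH] by (simp only:)
  qed
  assume "y \<in> Uge0"
  with \<open>x \<in> Uge0\<close> show "x + y \<in> Uge0" by (simp add: Uge0_def span_prod_add)
  from \<open>x \<in> Uge0\<close> \<open>y \<in> Uge0\<close> show "x * y \<in> Uge0"
    using Uge0_part_absorb(1)[of x 0 0 y] by (simp add: Uge0_eq_part)
qed

lemma Uge0_sum: "(\<And>i. i \<in> A \<Longrightarrow> x i \<in> Uge0) \<Longrightarrow> sum x A \<in> Uge0"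
proof (induction A rule: infinite_finite_induct)
  case (insert a A)
  thus ?case by (auto simp: Uge0_def intro: span_prod_add)
qed (use Uge0_part_zero in \<open>auto simp: Uge0_eq_part\<close>)

lemma Uge0_filt_ideal: "ideal (Uge0_filt n) (usl2_subring Uge0)"
  unfolding ideal_usl2_subring_iff[OF Uge0_ring]
proof (intro conjI ballI)
  show "Uge0_filt n \<subseteq> Uge0"
    using Uge0_part_subset by (auto simp: Uge0_filt_def intro!: Uge0_sum)
  show "0 \<in> Uge0_filt n"
    using Uge0_part_zero by (auto simp: Uge0_filt_def intro!: exI[of _ "\<lambda>_. 0"])
next
  fix x y assume "x \<in> Uge0_filt n" "y \<in> Uge0_filt n"
  then obtain f g where "x = (\<Sum>i\<le>n. f i)" "y = (\<Sum>i\<le>n. g i)"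
    "\<forall>i\<le>n. f i \<in> Uge0_part i (n - i)" "\<forall>i\<le>n. g i \<in> Uge0_part i (n - i)"
    by (auto simp: Uge0_filt_def)
  thus "x + y \<in> Uge0_filt n"
    by (auto simp: Uge0_filt_def sum.distrib span_prod_add intro!: exI[of _ "\<lambda>i. f i + g i"])
next
  fix a x assume a: "a \<in> Uge0" and "x \<in> Uge0_filt n"
  then obtain f where f: "x = (\<Sum>i\<le>n. f i)" "\<forall>i\<le>n. f i \<in> Uge0_part i (n - i)"
    by (auto simp: Uge0_filt_def)
  have "a * x = (\<Sum>i\<le>n. a * f i)" "x * a = (\<Sum>i\<le>n. f i * a)"
    by (simp_all add: f sum_distrib_left sum_distrib_right)
  thus "a * x \<in> Uge0_filt n" "x * a \<in> Uge0_filt n"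
    unfolding Uge0_filt_def mem_Collect_eq using f(2) Uge0_part_absorb[OF _ a]
    by (metis (no_types, lifting))+
qed

lemma Uge0_part_filt:
  assumes "x \<in> Uge0_part i j"
  shows "x \<in> Uge0_filt (i + j)"
proof -
  let ?f = "\<lambda>k. if k = i then x else 0"
  have "x = (\<Sum>k\<le>i + j. ?f k)" by simp
  moreover have "\<forall>k\<le>i + j. ?f k \<in> Uge0_part k (i + j - k)" using assms Uge0_part_zero by auto
  ultimately show ?thesis
    unfolding Uge0_filt_def by (intro CollectI exI[of _ ?f] conjI)
qed

lemma U0_Uge0: "x \<in> U0 \<Longrightarrow> x \<in> Uge0"
  using span_prodI[OF _ U_plus_closed(1), of x U0] by (simp add: Uge0_def)

lemma U_plus_Uge0: "x \<in> U_plus \<Longrightarrow> x \<in> Uge0"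
  using span_prodI[OF U0_closed(1), of x U_plus] by (simp add: Uge0_def)

lemma Uge0_filt_subset: "Uge0_filt n \<subseteq> ideal_powers (usl2_subring Uge0) (Uge0_filt 1) n"
proof -
  let ?J = "\<lambda>n. ideal_powers (usl2_subring Uge0) (Uge0_filt 1) n"
  note J = ideal_ideal_powers[OF Uge0_filt_ideal[of 1], unfolded ideal_usl2_subring_iff[OF Uge0_ring]]
  have H: "H_factor k \<in> Uge0_filt 1" for k
    using span_prodI[OF H_shift_U0_filt[of k 1], of "ue ^ 0 * 1" "U_plus_filt 0"] U_plus_closed(1)
      Uge0_part_filt[of "H_factor k" 1 0]
    by (auto simp: U_plus_filt_def H_shift_1)
  have ue: "ue \<in> Uge0_filt 1"
    using span_prodI[of 1 "U0_filt 0" "ue ^ 1 * 1" "U_plus_filt 1"]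
      imageI[OF U_plus_closed(1), of "\<lambda>x. ue ^ 1 * x"]
      Uge0_part_filt[of ue 0 1] U0_closed(1)
    by (simp add: U_plus_filt_def U0_filt_0)
  have U0: "x \<in> ?J i" if "x \<in> U0_filt i" for x i
  proof -
    have "ideal (U0 \<inter> ?J i) (usl2_subring U0)"
      unfolding ideal_usl2_subring_iff[OF U0_ring]
      using J[of i] U0_closed U0_Uge0 by auto
    moreover have "H_shift m i \<in> ?J i" for m
      using H_shift_in_ideal_powers[OF Uge0_filt_ideal H U0_Uge0[OF U0_closed(1)]] .
    hence "{H_shift m i | m. True} \<subseteq> U0 \<inter> ?J i" using H_shift_U0 by auto
    ultimately have "U0_filt i \<subseteq> U0 \<inter> ?J i"
      unfolding U0_filt_def[of i] by (rule ring.genideal_minimal[OF U0_ring])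
    thus ?thesis using that by auto
  qed
  have part: "x \<in> ?J (i + j)" if "x \<in> Uge0_part i j" for x i j
    using that
  proof (induction rule: span_prod_induct)
    case (prod a b)
    then obtain q where q: "q \<in> U_plus" "b = ue ^ j * q" by (auto simp: U_plus_filt_def)
    have "a * ue ^ j \<in> ?J (i + j)"
      by (rule power_in_ideal_powers[OF Uge0_filt_ideal U0[OF prod(1)] ue])
    thus ?case using J[of "i + j"] U_plus_Uge0[OF q(1)] by (simp add: q mult.assoc[symmetric])
  qed (use J[of "i + j"] in auto)
  have "sum f A \<in> ?J n" if "\<And>i. i \<in> A \<Longrightarrow> f i \<in> ?J n" for f :: "nat \<Rightarrow> usl2" and A
    using that by (induction A rule: infinite_finite_induct) (use J[of n] in auto)
  moreover have "f i \<in> ?J n" if "i \<in> {..n}" "\<forall>i\<le>n. f i \<in> Uge0_part i (n - i)" for f i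
    using part[of "f i" i "n - i"] that by simp
  ultimately show ?thesis unfolding Uge0_filt_def by blast
qed

lemma i_hat_ring_hom:
  "i_hat_U0 \<in> ring_hom hat_U0 dot_U0"
  "i_hat_Uge0 \<in> ring_hom hat_Uge0 dot_Uge0"
  "i_hat_U_int \<in> ring_hom hat_U_int dot_U_int"
  unfolding i_hat_U0_def hat_U0_def dot_U0_def i_hat_Uge0_def hat_Uge0_def dot_Uge0_def
    i_hat_U_int_def hat_U_int_def dot_U_int_def
  by (rule completion_map_ideal_powers_ring_hom[OF U0_filt_ideal U0_filt_subset]
      completion_map_ideal_powers_ring_hom[OF Uge0_filt_ideal Uge0_filt_subset]
      completion_map_ideal_powers_ring_hom[OF U_int_filt_ideal U_int_filt_subset])+

end

theory Submission
  imports Defs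
begin

text \<open>
  Write $A = \mathbb{Z}[v, v^{-1}]$ and $\{i\} = v^i - v^{-i}$. An element of the kernel of one of
  the three maps is given by a sequence $z_n$ with $z_m - z_n \in \mathcal{U}^*_n$ for $m \ge n$ and
  $z_n \in (\mathcal{U}^*_1)^n$, and the claim is that $z_n \in \mathcal{U}^*_n$. The coherence of the
  whole sequence is essential: a single quotient $\mathcal{U}^*/\mathcal{U}^*_n$ is in general not
  separated for the $\mathcal{U}^*_1$-adic topology. For instance $\{6\}!$ divided by
  $v^4 - v^2 + 1 \equiv 1$ modulo $\{1\}$ is a nonzero class in $\mathcal{U}^0/\mathcal{U}^0_6$ that lies
  in every power of the ideal generated by $\{1\}$.

  \<^bold>\<open>Reduction to $A$.\<close> For every weight $\pm v^k$ the algebra acts on the module with basis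
  $F^{(a)} e^b$ that is induced from the corresponding character of $\mathcal{U}^0$. For $N \ge 1$
  filter the lattice spanned by this basis: a vector lies in step $j$ if its coefficient at
  $F^{(a)} e^b$ is divisible by $\{N\}^{j-b}$. The integral form preserves every step
  (\<open>U_int_raising\<close>), and both $\{H+m\}_N$ and $e^N$ raise the step by one
  (\<open>raising_H_shift\<close>, \<open>raising_ue_power\<close>): among $N$ consecutive integers one is divisible by $N$,
  and a factor $e$ that does not lower the power of $F$ increases $b$. Hence every coefficient of
  $z_n$ applied to the generating vector is a sequence in $A$ that is coherent for the $\{N\}$-adic
  topologies of all $N$ at once, and that tends to zero for $N = 1$.

  \<^bold>\<open>From $N = 1$ to all $N$.\<close> By an argument of Habiro such a sequence tends to zero
  $\{N\}$-adically for all $N$ (\<open>vanishing_everywhere\<close>). To pass from $N$ to $pN$ with $p$ prime, note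
  that $\{N\}^p \equiv \{pN\}$ modulo $p$. So the limit modulo $\{pN\}^j$ is divisible by all powers of
  $p$, and it is zero because $A/(\{pN\}^j)$ is a free abelian group of finite rank.

  \<^bold>\<open>Return to the algebra.\<close> Every element is a sum of terms $F^{(a)} e^b u_{ab}$ with
  $u_{ab} \in \mathcal{U}^0$ (\<open>U_int_triangular\<close>, \<open>Uge0_triangular\<close>), and its coefficient at
  $F^{(a)} e^b$ in the module is the value of $u_{ab}$ at the weight. If the values at $\pm v^k$ for
  $0 \le k < n$ are divisible by $\{n\}!$, then $u_{ab} \in \mathcal{U}^0_n$ by Newton interpolation
  (\<open>U0_interpolation\<close>). As $\{n\}!$ divides $\{n!\}^n$, this applies to $z_m$ for large $m$ and all
  $b < n$, whereas $e^b$ itself lies in the ideal for $b \ge n$. So $z_m$, and with it $z_n$, lies in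
  $\mathcal{U}^*_n$.
\<close>

section \<open>Arithmetic of Laurent polynomials\<close>

lemma laurent_uminus: "a \<in> laurent \<Longrightarrow> - a \<in> laurent"
  and laurent_add: "a \<in> laurent \<Longrightarrow> b \<in> laurent \<Longrightarrow> a + b \<in> laurent"
  unfolding laurent_def
  using generate_ring.a_inv[of a ring_of_type_algebra "{qv_v, inverse qv_v}"]
    generate_ring.eng_add[of a ring_of_type_algebra "{qv_v, inverse qv_v}" b]
  by auto

lemma laurent_diff: "a \<in> laurent \<Longrightarrow> b \<in> laurent \<Longrightarrow> a - b \<in> laurent"
  using laurent_add[OF _ laurent_uminus, of a b] by simp

lemma laurent_zero: "0 \<in> laurent"
  using laurent_diff[OF laurent_one laurent_one] by simp

lemma laurent_of_nat: "of_nat n \<in> laurent"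
  by (induction n) (simp_all add: laurent_zero laurent_one laurent_add)

lemma laurent_of_int: "of_int n \<in> laurent"
  by (cases n rule: int_cases2) (simp_all add: laurent_of_nat laurent_uminus)

lemma laurent_prod: "(\<And>i. i \<in> I \<Longrightarrow> f i \<in> laurent) \<Longrightarrow> prod f I \<in> laurent"
  by (induction I rule: infinite_finite_induct) (simp_all add: laurent_one laurent_mult)

lemmas laurent_closed =
  laurent_zero laurent_one laurent_v laurent_uminus laurent_add laurent_diff laurent_mult
  laurent_power laurent_powi laurent_of_nat laurent_of_int laurent_prod

lemma laurent_induct [consumes 1, case_names one v inverse_v uminus add mult]:
  assumes "x \<in> laurent" "P 1" "P qv_v" "P (inverse qv_v)"
    and "\<And>x. x \<in> laurent \<Longrightarrow> P x \<Longrightarrow> P (- x)"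
    and "\<And>x y. x \<in> laurent \<Longrightarrow> P x \<Longrightarrow> y \<in> laurent \<Longrightarrow> P y \<Longrightarrow> P (x + y)"
    and "\<And>x y. x \<in> laurent \<Longrightarrow> P x \<Longrightarrow> y \<in> laurent \<Longrightarrow> P y \<Longrightarrow> P (x * y)"
  shows "P x"
  using assms(1) unfolding laurent_def
  by (induction rule: generate_ring.induct) (use assms(2-) in \<open>auto simp: laurent_def\<close>)

definition laurent_ideal :: "qv \<Rightarrow> qv set" where
  "laurent_ideal g = (\<lambda>c. g * c) ` laurent"

lemma laurent_idealI: "c \<in> laurent \<Longrightarrow> g * c \<in> laurent_ideal g"
  by (auto simp: laurent_ideal_def)

lemma laurent_idealE:
  assumes "x \<in> laurent_ideal g"
  obtains c where "c \<in> laurent" "x = g * c"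
  using assms by (auto simp: laurent_ideal_def)

lemma laurent_ideal_self: "g \<in> laurent_ideal g"
  using laurent_idealI[OF laurent_one, of g] by simp

lemma laurent_ideal_one: "laurent_ideal 1 = laurent"
  by (simp add: laurent_ideal_def)

lemma laurent_ideal_laurent: "x \<in> laurent_ideal g \<Longrightarrow> g \<in> laurent \<Longrightarrow> x \<in> laurent"
  by (auto elim!: laurent_idealE intro: laurent_mult)

lemma laurent_ideal_zero: "0 \<in> laurent_ideal g"
  using laurent_idealI[OF laurent_zero, of g] by simp

lemma laurent_ideal_uminus: "x \<in> laurent_ideal g \<Longrightarrow> - x \<in> laurent_ideal g"
  by (elim laurent_idealE) (metis laurent_idealI laurent_uminus mult_minus_right)

lemma laurent_ideal_add: "x \<in> laurent_ideal g \<Longrightarrow> y \<in> laurent_ideal g \<Longrightarrow> x + y \<in> laurent_ideal g"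
  by (elim laurent_idealE) (metis laurent_idealI laurent_add distrib_left)

lemma laurent_ideal_diff: "x \<in> laurent_ideal g \<Longrightarrow> y \<in> laurent_ideal g \<Longrightarrow> x - y \<in> laurent_ideal g"
  using laurent_ideal_add[OF _ laurent_ideal_uminus, of x g y] by simp

lemma laurent_ideal_mult: "x \<in> laurent_ideal g \<Longrightarrow> y \<in> laurent_ideal h \<Longrightarrow> x * y \<in> laurent_ideal (g * h)"
proof (elim laurent_idealE)
  fix c d assume "c \<in> laurent" "d \<in> laurent" "x = g * c" "y = h * d"
  thus ?thesis using laurent_idealI[OF laurent_mult, of c d "g * h"] by (simp add: mult_ac)
qed

lemma laurent_ideal_lmult: "c \<in> laurent \<Longrightarrow> x \<in> laurent_ideal g \<Longrightarrow> c * x \<in> laurent_ideal g"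
  using laurent_ideal_mult[of c 1 x g] by (simp add: laurent_ideal_one)

lemma laurent_ideal_rmult: "x \<in> laurent_ideal g \<Longrightarrow> c \<in> laurent \<Longrightarrow> x * c \<in> laurent_ideal g"
  using laurent_ideal_lmult[of c x g] by (simp add: mult.commute)

lemma laurent_ideal_subset: "g \<in> laurent_ideal h \<Longrightarrow> laurent_ideal g \<subseteq> laurent_ideal h"
  by (auto elim!: laurent_idealE[of _ g] intro: laurent_ideal_rmult)

lemma laurent_ideal_power_le:
  assumes "g \<in> laurent" "i \<le> j"
  shows "laurent_ideal (g ^ j) \<subseteq> laurent_ideal (g ^ i)"
proof (rule laurent_ideal_subset)
  have "g ^ j = g ^ i * g ^ (j - i)" using assms by (simp add: power_add[symmetric])
  thus "g ^ j \<in> laurent_ideal (g ^ i)" using assms by (simp add: laurent_idealI laurent_power)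
qed

definition qdiff :: "int \<Rightarrow> qv" where
  "qdiff x = qv_v powi x - qv_v powi (- x)"

lemma qdiff_laurent [simp]: "qdiff x \<in> laurent"
  by (simp add: qdiff_def laurent_closed)

lemma qdiff_0 [simp]: "qdiff 0 = 0"
  and qdiff_minus: "qdiff (- x) = - qdiff x"
  by (simp_all add: qdiff_def)

lemma qv_v_powi_add: "qv_v powi (x + y) = qv_v powi x * qv_v powi y"
  by (simp add: power_int_add qv_v_nonzero)

lemma qv_v_powi_inverse [simp]:
  "qv_v powi x * qv_v powi (- x) = 1" "qv_v powi (- x) * qv_v powi x = 1"
  by (simp_all add: qv_v_powi_add[symmetric])

lemma qdiff_add: "qdiff (x + y) = qv_v powi y * qdiff x + qv_v powi (- x) * qdiff y"
proof -
  have "- (x + y) = - x + - y" by simp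
  hence "qdiff (x + y) = qv_v powi x * qv_v powi y - qv_v powi (- x) * qv_v powi (- y)"
    unfolding qdiff_def by (simp only: qv_v_powi_add)
  thus ?thesis unfolding qdiff_def by (simp add: algebra_simps)
qed

lemma qdiff_dvd:
  assumes "n dvd x"
  shows "qdiff x \<in> laurent_ideal (qdiff n)"
proof -
  have *: "qdiff (n * int k) \<in> laurent_ideal (qdiff n)" for k
  proof (induction k)
    case (Suc k)
    have "qdiff (n * int (Suc k)) = qdiff (n * int k + n)" by (simp add: algebra_simps)
    thus ?case
      using Suc unfolding qdiff_add
      by (auto intro!: laurent_ideal_add laurent_ideal_lmult laurent_ideal_self laurent_closed)
  qed (simp add: laurent_ideal_zero)
  obtain z where z: "x = n * z" using assms by (elim dvdE)
  show ?thesis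
  proof (cases z rule: int_cases2)
    case (nonneg k)
    thus ?thesis using * z by simp
  next
    case (nonpos k)
    hence "qdiff x = - qdiff (n * int k)" by (simp add: z flip: qdiff_minus)
    thus ?thesis using * by (simp add: laurent_ideal_uminus)
  qed
qed

text \<open>
  One of the $N$ consecutive integers is divisible by $N$.
\<close>

lemma prod_consecutive_qdiff:
  assumes "N > 0"
  shows "(\<Prod>i<N. qdiff (x - int i)) \<in> laurent_ideal (qdiff (int N))"
proof -
  let ?r = "nat (x mod int N)"
  have r: "?r < N" "int N dvd x - int ?r"
    using assms by (simp_all add: nat_less_iff)
  have "(\<Prod>i<N. qdiff (x - int i)) = qdiff (x - int ?r) * (\<Prod>i\<in>{..<N} - {?r}. qdiff (x - int i))"
    using r by (intro prod.remove) auto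
  also have "\<dots> \<in> laurent_ideal (qdiff (int N))"
    by (intro laurent_ideal_rmult qdiff_dvd r laurent_prod qdiff_laurent)
  finally show ?thesis .
qed

text \<open>The inclusion $\mathbb{Z}[v] \subseteq \mathbb{Q}(v)$.\<close>

definition qv_of_poly :: "int poly \<Rightarrow> qv" where
  "qv_of_poly P = Fract (map_poly of_int P) 1"

lemma qv_of_poly_hom:
  "qv_of_poly (P + Q) = qv_of_poly P + qv_of_poly Q"
  "qv_of_poly (P * Q) = qv_of_poly P * qv_of_poly Q"
  "qv_of_poly 1 = 1" "qv_of_poly 0 = 0"
proof -
  have add: "map_poly rat_of_int (P + Q) = map_poly of_int P + map_poly of_int Q"
    by (rule poly_eqI) (simp add: coeff_map_poly)
  have mult: "map_poly rat_of_int (P * Q) = map_poly of_int P * map_poly of_int Q"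
    by (rule poly_eqI) (simp add: coeff_map_poly Polynomial.coeff_mult)
  show "qv_of_poly (P + Q) = qv_of_poly P + qv_of_poly Q"
    "qv_of_poly (P * Q) = qv_of_poly P * qv_of_poly Q"
    "qv_of_poly 1 = 1" "qv_of_poly 0 = 0"
    by (simp_all add: qv_of_poly_def add mult One_fract_def Zero_fract_def map_poly_1 pCons_one)
qed

lemma qv_of_poly_uminus: "qv_of_poly (- P) = - qv_of_poly P"
  using qv_of_poly_hom(1)[of P "- P"] by (simp add: qv_of_poly_hom(4) eq_neg_iff_add_eq_0 add.commute)

lemma qv_of_poly_diff: "qv_of_poly (P - Q) = qv_of_poly P - qv_of_poly Q"
  using qv_of_poly_hom(1)[of P "- Q"] by (simp add: qv_of_poly_uminus)

lemma qv_of_poly_power: "qv_of_poly (P ^ n) = qv_of_poly P ^ n"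
  by (induction n) (simp_all add: qv_of_poly_hom)

lemma qv_of_poly_of_int: "qv_of_poly (of_int n) = of_int n"
proof -
  have "qv_of_poly (of_nat k) = of_nat k" for k
    by (induction k) (simp_all add: qv_of_poly_hom)
  thus ?thesis by (cases n rule: int_cases2) (simp_all add: qv_of_poly_uminus)
qed

lemma qv_of_poly_X: "qv_of_poly [:0, 1:] = qv_v"
  by (simp add: qv_of_poly_def qv_v_def map_poly_pCons)

lemma qv_of_poly_eq_iff: "qv_of_poly P = qv_of_poly Q \<longleftrightarrow> P = Q"
  by (auto simp: qv_of_poly_def eq_fract poly_eq_iff coeff_map_poly)

lemma qv_of_poly_laurent: "qv_of_poly P \<in> laurent"
proof (induction P)
  case (pCons a P)
  have "pCons a P = of_int a + [:0, 1:] * P" by (simp add: of_int_poly)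
  thus ?case
    using pCons by (simp add: qv_of_poly_hom qv_of_poly_of_int qv_of_poly_X laurent_closed del: mult_pCons_left)
qed (simp add: qv_of_poly_hom laurent_closed)

text \<open>
  Together with \<open>qv_of_poly_eq_iff\<close> this turns divisibility questions about Laurent polynomials
  into questions about integer polynomials.
\<close>

lemma laurent_clear_denominator:
  assumes "x \<in> laurent"
  obtains s P where "x * qv_v ^ s = qv_of_poly P"
proof -
  have "\<exists>s P. x * qv_v ^ s = qv_of_poly P"
    using assms
  proof (induction rule: laurent_induct)
    case one show ?case by (rule exI[of _ 0]) (metis mult_1 power_0 qv_of_poly_hom(3))
  next
    case v show ?case by (rule exI[of _ 0]) (metis mult.right_neutral power_0 qv_of_poly_X)
  next
    case inverse_v
    have "inverse qv_v * qv_v ^ 1 = qv_of_poly 1" by (simp add: qv_v_nonzero qv_of_poly_hom)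
    thus ?case by blast
  next
    case (uminus x)
    thus ?case by (metis qv_of_poly_uminus mult_minus_left)
  next
    case (add x y)
    then obtain s P t Q where PQ: "x * qv_v ^ s = qv_of_poly P" "y * qv_v ^ t = qv_of_poly Q" by auto
    have "(x + y) * qv_v ^ (s + t) = (x * qv_v ^ s) * qv_v ^ t + (y * qv_v ^ t) * qv_v ^ s"
      by (simp only: distrib_right power_add mult_ac)
    also have "\<dots> = qv_of_poly (P * [:0, 1:] ^ t + Q * [:0, 1:] ^ s)"
      by (simp only: PQ qv_of_poly_hom qv_of_poly_power qv_of_poly_X)
    finally show ?case by blast
  next
    case (mult x y)
    then obtain s P t Q where PQ: "x * qv_v ^ s = qv_of_poly P" "y * qv_v ^ t = qv_of_poly Q" by auto
    have "(x * y) * qv_v ^ (s + t) = (x * qv_v ^ s) * (y * qv_v ^ t)"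
      by (simp only: power_add mult_ac)
    also have "\<dots> = qv_of_poly (P * Q)"
      by (simp only: PQ qv_of_poly_hom)
    finally show ?case by blast
  qed
  thus ?thesis using that by blast
qed

lemma qdiff_mult_power:
  "qdiff (int n) * qv_v ^ n = qv_of_poly ([:0, 1:] ^ (n + n) - 1)"
proof -
  have "qv_v powi (- int n) * qv_v ^ n = 1" 
    using qv_v_powi_inverse(2)[of "int n"] by simp
  thus ?thesis
    by (simp add: qdiff_def algebra_simps qv_of_poly_diff qv_of_poly_power qv_of_poly_X qv_of_poly_hom
       power_add[symmetric])
qed

lemma lead_coeff_X_power_diff_1:
  assumes "n > 0"
  shows "lead_coeff ([:0, 1:] ^ n - 1 :: int poly) = 1"
proof -
  have *: "[:0, 1:] ^ n = Polynomial.monom (1::int) n"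
    by (simp add: monom_altdef)
  have "Polynomial.degree (Polynomial.monom (1::int) n - 1) = n"
    using assms degree_add_eq_left[of "-1::int poly" "Polynomial.monom (1::int) n"]
    by (simp add: Polynomial.degree_monom_eq)
  thus ?thesis using assms by (simp add: *)
qed

lemma qdiff_nonzero:
  assumes "n > 0"
  shows "qdiff (int n) \<noteq> 0"
proof
  assume "qdiff (int n) = 0"
  hence "[:0, 1:] ^ (n + n) - 1 = (0 :: int poly)"
    using qdiff_mult_power[of n] qv_of_poly_eq_iff[of _ 0] by (simp add: qv_of_poly_hom)
  thus False using lead_coeff_X_power_diff_1[of "n + n"] assms by simp
qed

section \<open>Separatedness of $\mathbb{Z}[v, v^{-1}] / (g)$ for monic $g$\<close>

lemma monic_divmod:
  fixes P G :: "int poly"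
  assumes "lead_coeff G = 1"
  obtains Q R where "P = G * Q + R" "R = 0 \<or> Polynomial.degree R < Polynomial.degree G"
proof -
  obtain Q R where QR: "pseudo_divmod P G = (Q, R)" by force
  have "G \<noteq> 0" using assms by auto
  from pseudo_divmod[OF this QR] show ?thesis using assms that by simp
qed

lemma monic_dvd_low_degree:
  fixes R G :: "int poly"
  assumes "lead_coeff G = 1" "G dvd R" "R = 0 \<or> Polynomial.degree R < Polynomial.degree G"
  shows "R = 0"
  using assms dvd_imp_degree_le[of G R] by force

text \<open>
  Division by a monic polynomial has unique remainders over the integers, so the remainder of
  \<open>n Y\<close> is \<open>n\<close> times that of \<open>Y\<close>.
\<close>

lemma monic_dvd_smult_cancel:
  fixes G Y :: "int poly"
  assumes G: "lead_coeff G = 1" and "n \<noteq> 0" "G dvd Polynomial.smult n Y"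
  shows "G dvd Y"
proof -
  obtain Q R where QR: "Y = G * Q + R" "R = 0 \<or> Polynomial.degree R < Polynomial.degree G"
    by (rule monic_divmod[OF G])
  have "Polynomial.smult n R = Polynomial.smult n Y - G * Polynomial.smult n Q"
    by (simp add: QR(1) smult_add_right)
  hence "G dvd Polynomial.smult n R"
    using assms(3) dvd_diff[OF _ dvd_triv_left] by (simp only:)
  hence "Polynomial.smult n R = 0"
    by (rule monic_dvd_low_degree[OF G]) (use QR(2) \<open>n \<noteq> 0\<close> in auto)
  thus ?thesis using QR(1) \<open>n \<noteq> 0\<close> by simp
qed

text \<open>
  The quotient by a monic polynomial is free of finite rank over the integers, hence $p$-adically
  separated: the remainder of \<open>Y\<close> has coefficients divisible by every power of \<open>p\<close>.
\<close>

lemma monic_dvd_if_dvd_mod_powers: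
  fixes G Y :: "int poly"
  assumes G: "lead_coeff G = 1" and p: "p > 1"
    and Y: "\<And>a. \<exists>C. G dvd Y - Polynomial.smult (p ^ a) C"
  shows "G dvd Y"
proof -
  obtain Q R where QR: "Y = G * Q + R" "R = 0 \<or> Polynomial.degree R < Polynomial.degree G"
    by (rule monic_divmod[OF G])
  have dvd: "p ^ a dvd Polynomial.coeff R i" for a i
  proof -
    obtain C where C: "G dvd Y - Polynomial.smult (p ^ a) C" using Y by blast
    obtain q r where qr: "C = G * q + r" "r = 0 \<or> Polynomial.degree r < Polynomial.degree G"
      by (rule monic_divmod[OF G])
    have "R - Polynomial.smult (p ^ a) r
        = (Y - Polynomial.smult (p ^ a) C) + G * (Polynomial.smult (p ^ a) q - Q)"
      by (simp add: QR(1) qr(1) algebra_simps smult_add_right)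
    hence "G dvd R - Polynomial.smult (p ^ a) r" using C by simp
    hence "R - Polynomial.smult (p ^ a) r = 0"
    proof (rule monic_dvd_low_degree[OF G])
      show "R - Polynomial.smult (p ^ a) r = 0 \<or>
        Polynomial.degree (R - Polynomial.smult (p ^ a) r) < Polynomial.degree G"
        using QR(2) qr(2) degree_diff_less[of R "Polynomial.degree G" "Polynomial.smult (p ^ a) r"]
          degree_smult_le[of "p ^ a" r]
        by (cases "R = 0"; cases "r = 0") auto
    qed
    hence "R = Polynomial.smult (p ^ a) r" by simp
    thus ?thesis by simp
  qed
  have "Polynomial.coeff R i = 0" for i
  proof (rule ccontr)
    assume nz: "Polynomial.coeff R i \<noteq> 0"
    define c where "c = nat \<bar>Polynomial.coeff R i\<bar>"
    have "p ^ c \<le> \<bar>Polynomial.coeff R i\<bar>"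
      using dvd_imp_le_int[OF nz dvd[of c i]] p by simp
    moreover have "int c < 2 ^ c" by (metis of_nat_less_two_power)
    moreover have "(2::int) ^ c \<le> p ^ c" using p by (intro power_mono) auto
    ultimately show False using nz unfolding c_def by simp
  qed
  hence "R = 0" by (simp add: poly_eq_iff)
  thus ?thesis by (simp add: QR(1))
qed

text \<open>
  Up to a power of $v$ these are the monic integer polynomials whose constant term is a unit. The
  condition on the constant term makes $v$ invertible modulo the polynomial, so that nothing is lost
  when powers of $v$ are cleared.
\<close>

definition monic_laurent :: "qv \<Rightarrow> bool" where
  "monic_laurent g \<longleftrightarrow>
     (\<exists>s G. g * qv_v ^ s = qv_of_poly G \<and> lead_coeff G = 1 \<and> poly G 0 dvd 1)"

lemma monic_laurent_one: "monic_laurent 1"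
  unfolding monic_laurent_def by (intro exI[of _ 0] exI[of _ 1]) (simp add: qv_of_poly_hom)

lemma monic_laurent_mult:
  assumes "monic_laurent g" "monic_laurent h"
  shows "monic_laurent (g * h)"
proof -
  obtain s G t H where "g * qv_v ^ s = qv_of_poly G" "lead_coeff G = 1" "poly G 0 dvd 1"
    "h * qv_v ^ t = qv_of_poly H" "lead_coeff H = 1" "poly H 0 dvd 1"
    using assms unfolding monic_laurent_def by blast
  hence "g * h * qv_v ^ (s + t) = qv_of_poly (G * H)" "lead_coeff (G * H) = 1" "poly (G * H) 0 dvd 1"
    using mult_dvd_mono[of "poly G 0" 1 "poly H 0" 1]
    by (simp_all only: qv_of_poly_hom power_add lead_coeff_mult poly_mult mult_1)
       (metis mult.assoc mult.left_commute)
  thus ?thesis unfolding monic_laurent_def by blast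
qed

lemma monic_laurent_power: "monic_laurent g \<Longrightarrow> monic_laurent (g ^ n)"
  by (induction n) (simp_all add: monic_laurent_one monic_laurent_mult)

lemma monic_laurent_prod: "(\<And>i. i \<in> I \<Longrightarrow> monic_laurent (f i)) \<Longrightarrow> monic_laurent (prod f I)"
  by (induction I rule: infinite_finite_induct) (auto simp: monic_laurent_one intro!: monic_laurent_mult)

lemma monic_laurent_qdiff:
  assumes "n > 0"
  shows "monic_laurent (qdiff (int n))"
proof -
  have "poly ([:0, 1:] ^ (n + n) - 1 :: int poly) 0 dvd 1"
    using assms by (simp add: poly_power power_0_left)
  thus ?thesis
    unfolding monic_laurent_def
    using qdiff_mult_power[of n] lead_coeff_X_power_diff_1[of "n + n"] assms by blast
qed

lemma X_power_invertible_mod: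
  fixes G :: "int poly"
  assumes "poly G 0 dvd 1"
  obtains D where "G dvd [:0, 1:] ^ t * D - 1"
proof -
  obtain g C where G: "G = pCons g C" by (cases G) auto
  have "g dvd 1" using assms by (simp add: G)
  hence g: "g * g = 1" by (auto simp: zdvd1_eq abs_if split: if_splits)
  \<comment> \<open>$G = g + XC$ with $g = \<plusminus> 1$, so $-gC$ is an inverse of $X$ modulo $G$.\<close>
  have "[:0, 1:] * (- Polynomial.smult g C) - 1 = - (Polynomial.smult g G)"
    by (simp add: G g one_pCons)
  hence *: "G dvd [:0, 1:] * (- Polynomial.smult g C) - 1" by (simp add: dvd_smult)
  have "G dvd ([:0, 1:] * (- Polynomial.smult g C)) ^ t - 1"
  proof (induction t)
    case (Suc t)
    let ?Z = "[:0, 1:] * (- Polynomial.smult g C)"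
    have "?Z ^ Suc t - 1 = ?Z * (?Z ^ t - 1) + (?Z - 1)" by (simp only: power_Suc algebra_simps) 
    thus ?case using Suc * by (metis dvd_add dvd_mult)
  qed simp
  thus ?thesis using that by (simp only: power_mult_distrib)
qed

lemma laurent_ideal_iff_dvd:
  assumes g: "g * qv_v ^ s = qv_of_poly G" "poly G 0 dvd 1"
    and x: "x * qv_v ^ t = qv_of_poly Y"
  shows "x \<in> laurent_ideal g \<longleftrightarrow> G dvd Y"
proof
  assume "x \<in> laurent_ideal g"
  then obtain c where c: "c \<in> laurent" "x = g * c" by (rule laurent_idealE)
  obtain u C where C: "c * qv_v ^ u = qv_of_poly C" by (rule laurent_clear_denominator[OF c(1)])
  have "qv_of_poly ([:0, 1:] ^ (s + u) * Y) = qv_v ^ (s + u) * (x * qv_v ^ t)"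
    by (simp only: x qv_of_poly_hom qv_of_poly_power qv_of_poly_X)
  also have "\<dots> = (g * qv_v ^ s) * (c * qv_v ^ u) * qv_v ^ t"
    by (simp only: c power_add mult_ac)
  also have "\<dots> = qv_of_poly (G * (C * [:0, 1:] ^ t))"
    by (simp only: g C qv_of_poly_hom qv_of_poly_power qv_of_poly_X mult_ac)
  finally have "[:0, 1:] ^ (s + u) * Y = G * (C * [:0, 1:] ^ t)" by (simp only: qv_of_poly_eq_iff)
  hence dvd: "G dvd [:0, 1:] ^ (s + u) * Y" by (metis dvd_triv_left)
  obtain D where D: "G dvd [:0, 1:] ^ (s + u) * D - 1" by (rule X_power_invertible_mod[OF g(2)])
  have "Y = D * ([:0, 1:] ^ (s + u) * Y) - Y * ([:0, 1:] ^ (s + u) * D - 1)"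
    by (simp only: algebra_simps)
  thus "G dvd Y" using dvd D by (metis dvd_diff dvd_mult)
next
  assume "G dvd Y"
  then obtain Q where Q: "Y = G * Q" by (elim dvdE)
  have "x = x * qv_v ^ t * inverse (qv_v ^ t)" by (simp add: qv_v_nonzero)
  also have "\<dots> = g * (qv_v ^ s * qv_of_poly Q * inverse qv_v ^ t)"
    by (simp only: x Q qv_of_poly_hom g(1)[symmetric] power_inverse mult_ac)
  finally have "x = g * (qv_v ^ s * qv_of_poly Q * inverse qv_v ^ t)" .
  thus "x \<in> laurent_ideal g"
    using laurent_idealI[of "qv_v ^ s * qv_of_poly Q * inverse qv_v ^ t" g]
    by (simp add: laurent_closed qv_of_poly_laurent)
qed

text \<open>The quotient by a monic element has no torsion over the integers.\<close>

lemma laurent_ideal_cancel_int: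
  assumes "monic_laurent g" "y \<in> laurent" "n \<noteq> 0" "of_int n * y \<in> laurent_ideal g"
  shows "y \<in> laurent_ideal g"
proof -
  obtain s G where G: "g * qv_v ^ s = qv_of_poly G" "lead_coeff G = 1" "poly G 0 dvd 1"
    using assms(1) unfolding monic_laurent_def by blast
  obtain t Y where Y: "y * qv_v ^ t = qv_of_poly Y" by (rule laurent_clear_denominator[OF assms(2)])
  have "(of_int n * y) * qv_v ^ t = qv_of_poly (Polynomial.smult n Y)"
    using qv_of_poly_hom(2)[of "of_int n" Y] Y qv_of_poly_of_int[of n]
    by (simp add: mult.assoc of_int_poly)
  hence "G dvd Polynomial.smult n Y" using assms(4) laurent_ideal_iff_dvd[OF G(1,3)] by blast
  hence "G dvd Y" by (rule monic_dvd_smult_cancel[OF G(2) assms(3)])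
  thus ?thesis using laurent_ideal_iff_dvd[OF G(1,3) Y] by blast
qed

lemma laurent_ideal_separated:
  assumes "monic_laurent g" "y \<in> laurent" "p > 1"
    and "\<And>a. \<exists>c\<in>laurent. y - of_int p ^ a * c \<in> laurent_ideal g"
  shows "y \<in> laurent_ideal g"
proof -
  obtain s G where G: "g * qv_v ^ s = qv_of_poly G" "lead_coeff G = 1" "poly G 0 dvd 1"
    using assms(1) unfolding monic_laurent_def by blast
  obtain t Y where Y: "y * qv_v ^ t = qv_of_poly Y" by (rule laurent_clear_denominator[OF assms(2)])
  have "G dvd Y"
  proof (rule monic_dvd_if_dvd_mod_powers[OF G(2) assms(3)])
    fix a
    obtain c where c: "c \<in> laurent" "y - of_int p ^ a * c \<in> laurent_ideal g"
      using assms(4) by blast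
    obtain u C where C: "c * qv_v ^ u = qv_of_poly C" by (rule laurent_clear_denominator[OF c(1)])
    have "(y - of_int p ^ a * c) * qv_v ^ (t + u)
        = (y * qv_v ^ t) * qv_v ^ u - of_int (p ^ a) * ((c * qv_v ^ u) * qv_v ^ t)"
      by (simp only: of_int_power power_add algebra_simps)
    also have "\<dots> = qv_of_poly (Y * [:0, 1:] ^ u - of_int (p ^ a) * (C * [:0, 1:] ^ t))"
      by (simp only: C Y qv_of_poly_hom qv_of_poly_diff qv_of_poly_power qv_of_poly_X qv_of_poly_of_int)
    finally have dvd: "G dvd Y * [:0, 1:] ^ u - of_int (p ^ a) * (C * [:0, 1:] ^ t)"
      using c(2) laurent_ideal_iff_dvd[OF G(1,3)] by blast
    obtain D where D: "G dvd [:0, 1:] ^ u * D - 1" by (rule X_power_invertible_mod[OF G(3)])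
    have "Y - of_int (p ^ a) * (C * [:0, 1:] ^ t * D)
        = (Y * [:0, 1:] ^ u - of_int (p ^ a) * (C * [:0, 1:] ^ t)) * D - ([:0, 1:] ^ u * D - 1) * Y"
      by (simp only: algebra_simps)
    hence "G dvd Y - of_int (p ^ a) * (C * [:0, 1:] ^ t * D)" using dvd D by (metis dvd_diff dvd_mult2)
    thus "\<exists>C. G dvd Y - Polynomial.smult (p ^ a) C" by (auto simp: of_int_poly)
  qed
  thus ?thesis using laurent_ideal_iff_dvd[OF G(1,3) Y] by blast
qed

section \<open>Passing from $v = \<plusminus> 1$ to all roots of unity\<close>

text \<open>
  The inner binomial coefficients are divisible by $p$; for $p = 2$ also the sign of the last term
  matters only modulo $2$.
\<close>

lemma prime_power_diff:
  fixes x y :: qv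
  assumes "prime p" "x \<in> laurent" "y \<in> laurent"
  shows "(x - y) ^ p - (x ^ p - y ^ p) \<in> laurent_ideal (of_nat p)"
proof -
  have p: "p > 0" using assms(1) by (simp add: prime_gt_0_nat)
  let ?f = "\<lambda>k. of_nat (p choose k) * x ^ k * (- y) ^ (p - k)"
  have "(x - y) ^ p = (\<Sum>k\<le>p. ?f k)" using binomial_ring[of x "- y" p] by simp
  also have "\<dots> = ?f 0 + ?f p + (\<Sum>k\<in>{1..<p}. ?f k)"
  proof -
    have "{..p} = insert 0 (insert p {1..<p})" using p by auto
    thus ?thesis using p by (simp add: add.assoc)
  qed
  finally have eq: "(x - y) ^ p - (x ^ p - y ^ p) = ((- y) ^ p + y ^ p) + (\<Sum>k\<in>{1..<p}. ?f k)"
    by simp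
  have "(- y) ^ p + y ^ p \<in> laurent_ideal (of_nat p)"
  proof (cases "p = 2")
    case True
    hence "(- y) ^ p + y ^ p = of_nat p * y ^ p" by simp
    thus ?thesis using assms by (metis laurent_idealI laurent_power)
  next
    case False
    hence "odd p" using assms(1) primes_dvd_imp_eq[of 2 p] by auto
    thus ?thesis by (simp add: laurent_ideal_zero)
  qed
  moreover have "?f k \<in> laurent_ideal (of_nat p)" if "k \<in> {1..<p}" for k
  proof -
    have "p dvd p choose k" by (rule dvd_choose_prime) (use that assms(1) in auto)
    then obtain m where "p choose k = p * m" by (elim dvdE)
    hence "?f k = of_nat p * (of_nat m * x ^ k * (- y) ^ (p - k))" by (simp add: mult.assoc)
    also have "\<dots> \<in> laurent_ideal (of_nat p)"
      by (intro laurent_idealI laurent_closed assms)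
    finally show ?thesis .
  qed
  hence "(\<Sum>k\<in>A. ?f k) \<in> laurent_ideal (of_nat p)" if "A \<subseteq> {1..<p}" for A
    using that by (induction A rule: infinite_finite_induct) (auto intro: laurent_ideal_zero laurent_ideal_add)
  ultimately show ?thesis unfolding eq by (blast intro: laurent_ideal_add)
qed

text \<open>
  The congruence $\{N\}^p \equiv \{pN\}$ modulo $p$.
\<close>

lemma qdiff_prime_power:
  assumes "prime p"
  obtains c where "c \<in> laurent" "qdiff (int N) ^ p = qdiff (int (p * N)) + of_nat p * c"
proof -
  have *: "(qv_v powi x) ^ p = qv_v powi (int p * x)" for x
    by (simp add: power_int_mult mult.commute[of "int p"])
  have "qdiff (int N) ^ p - qdiff (int (p * N)) \<in> laurent_ideal (of_nat p)"
    using prime_power_diff[OF assms laurent_powi[of "int N"] laurent_powi[of "- int N"]]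
    by (simp only: * qdiff_def) simp
  thus ?thesis using that by (elim laurent_idealE) (metis add.commute diff_add_cancel)
qed

text \<open>
  In the binomial expansion of the power $a + j$ each term contains $g^j$ or $p^a$.
\<close>

lemma power_sum_mod:
  assumes "g \<in> laurent" "p \<in> laurent" "c \<in> laurent"
  shows "\<exists>d\<in>laurent. (g + p * c) ^ (a + j) - p ^ a * d \<in> laurent_ideal (g ^ j)"
proof -
  let ?S = "{x. \<exists>d\<in>laurent. x - p ^ a * d \<in> laurent_ideal (g ^ j)}"
  let ?f = "\<lambda>k. of_nat ((a + j) choose k) * g ^ k * (p * c) ^ (a + j - k)"
  have add: "x + y \<in> ?S" if xy: "x \<in> ?S" "y \<in> ?S" for x y
  proof -
    obtain d e where de: "d \<in> laurent" "e \<in> laurent" "x - p ^ a * d \<in> laurent_ideal (g ^ j)"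
      "y - p ^ a * e \<in> laurent_ideal (g ^ j)" using xy by blast
    have "x + y - p ^ a * (d + e) = (x - p ^ a * d) + (y - p ^ a * e)" by (simp add: algebra_simps)
    moreover have "\<dots> \<in> laurent_ideal (g ^ j)" using de by (intro laurent_ideal_add)
    ultimately have "x + y - p ^ a * (d + e) \<in> laurent_ideal (g ^ j)" by (simp only:)
    thus ?thesis using laurent_add[OF de(1,2)] by blast
  qed
  have zero: "0 \<in> ?S" using laurent_zero laurent_ideal_zero by force
  have summand: "?f k \<in> ?S" for k
  proof (cases "j \<le> k")
    case True
    hence "g ^ k = g ^ j * g ^ (k - j)" by (simp add: power_add[symmetric])
    hence "?f k - p ^ a * 0 = g ^ j * (of_nat ((a + j) choose k) * g ^ (k - j) * (p * c) ^ (a + j - k))"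
      by (simp only: mult_ac mult_zero_right diff_zero)
    also have "\<dots> \<in> laurent_ideal (g ^ j)"
      by (intro laurent_idealI laurent_closed assms)
    finally show ?thesis using laurent_zero by blast
  next
    case False
    hence e: "a + j - k = a + (j - k)" by simp
    let ?d = "of_nat ((a + j) choose k) * g ^ k * c ^ a * (p * c) ^ (j - k)"
    have "?f k - p ^ a * ?d = 0"
      by (simp add: e power_add power_mult_distrib)
    hence "?f k - p ^ a * ?d \<in> laurent_ideal (g ^ j)" by (simp only: laurent_ideal_zero)
    moreover have "?d \<in> laurent" by (intro laurent_closed assms)
    ultimately show ?thesis by blast
  qed
  have "(\<Sum>k\<in>A. ?f k) \<in> ?S" for A
  proof (induction A rule: infinite_finite_induct)
    case (insert x F)
    thus ?case using add[OF summand insert.IH] by simp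
  qed (use zero in auto)
  hence "(\<Sum>k\<le>a + j. ?f k) \<in> ?S" .
  thus ?thesis by (simp add: binomial_ring)
qed

text \<open>
  For large $m$ the term $y_m$ is divisible by a high power of $\{N\}^p \equiv \{pN\}$ modulo $p$,
  hence by $p^a$ modulo $\{pN\}^j$. As $y_n \equiv y_m$ modulo $\{pN\}^j$, the same holds for
  $y_n$ and every $a$, and the quotient is $p$-adically separated.
\<close>

lemma vanishing_prime_step:
  fixes y :: "nat \<Rightarrow> qv"
  assumes "prime p" "N > 0" and y: "\<And>n. y n \<in> laurent"
    and coherent: "\<exists>n0. \<forall>m\<ge>n0. \<forall>n\<ge>n0. y m - y n \<in> laurent_ideal (qdiff (int (p * N)) ^ j)"
    and vanishing: "\<And>i. \<exists>n0. \<forall>n\<ge>n0. y n \<in> laurent_ideal (qdiff (int N) ^ i)"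
  shows "\<exists>n0. \<forall>n\<ge>n0. y n \<in> laurent_ideal (qdiff (int (p * N)) ^ j)"
proof -
  obtain n0 where n0: "\<And>m n. m \<ge> n0 \<Longrightarrow> n \<ge> n0 \<Longrightarrow> y m - y n \<in> laurent_ideal (qdiff (int (p * N)) ^ j)"
    using coherent by blast
  have p: "int p > 1" using assms(1) prime_gt_1_nat by simp
  have "y n \<in> laurent_ideal (qdiff (int (p * N)) ^ j)" if n: "n \<ge> n0" for n
  proof (rule laurent_ideal_separated[OF _ y p])
    show "monic_laurent (qdiff (int (p * N)) ^ j)"
      by (rule monic_laurent_power[OF monic_laurent_qdiff]) (use assms prime_gt_0_nat in auto)
    fix a
    obtain m0 where m0: "\<And>m. m \<ge> m0 \<Longrightarrow> y m \<in> laurent_ideal (qdiff (int N) ^ (p * (a + j)))"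
      using vanishing[of "p * (a + j)"] by blast
    let ?m = "m0 + n0"
    have "y ?m \<in> laurent_ideal ((qdiff (int N) ^ p) ^ (a + j))"
      unfolding power_mult[symmetric] by (rule m0) simp
    then obtain c where c: "c \<in> laurent" "y ?m = (qdiff (int N) ^ p) ^ (a + j) * c"
      by (rule laurent_idealE)
    obtain b where b: "b \<in> laurent" "qdiff (int N) ^ p = qdiff (int (p * N)) + of_nat p * b"
      by (rule qdiff_prime_power[OF assms(1)])
    obtain d where d: "d \<in> laurent" "(qdiff (int N) ^ p) ^ (a + j) - of_nat p ^ a * d
        \<in> laurent_ideal (qdiff (int (p * N)) ^ j)"
      using power_sum_mod[of "qdiff (int (p * N))" "of_nat p" b a j] b laurent_of_nat by auto
    have "y n - of_int (int p) ^ a * (d * c) = ((qdiff (int N) ^ p) ^ (a + j) - of_nat p ^ a * d) * c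
        - (y ?m - y n)"
      by (simp add: c(2) algebra_simps)
    also have "\<dots> \<in> laurent_ideal (qdiff (int (p * N)) ^ j)"
      by (intro laurent_ideal_diff laurent_ideal_rmult d c n0 n) simp
    finally show "\<exists>c\<in>laurent. y n - of_int (int p) ^ a * c \<in> laurent_ideal (qdiff (int (p * N)) ^ j)"
      using c d laurent_mult by blast
  qed
  thus ?thesis by blast
qed

text \<open>
  Injectivity of the map from the completion of $A$ along all products of the $\{N\}$ to the
  $\{1\}$-adic completion (Habiro), by induction along the prime factors of $N$.
\<close>

lemma vanishing_everywhere:
  fixes y :: "nat \<Rightarrow> qv"
  assumes y: "\<And>n. y n \<in> laurent" and "N > 0"
    and coherent: "\<And>N j. N > 0 \<Longrightarrow>
      \<exists>n0. \<forall>m\<ge>n0. \<forall>n\<ge>n0. y m - y n \<in> laurent_ideal (qdiff (int N) ^ j)"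
    and vanishing: "\<And>j. \<exists>n0. \<forall>n\<ge>n0. y n \<in> laurent_ideal (qdiff 1 ^ j)"
  shows "\<exists>n0. \<forall>n\<ge>n0. y n \<in> laurent_ideal (qdiff (int N) ^ j)"
  using \<open>N > 0\<close>
proof (induction N arbitrary: j rule: less_induct)
  case (less N)
  show ?case
  proof (cases "N = 1")
    case False
    then obtain p where p: "prime p" "p dvd N" using less.prems prime_factor_nat[of N] by auto
    then obtain M where M: "N = p * M" by (elim dvdE)
    have "M > 0" "M < N" using M less.prems p(1) prime_gt_1_nat[of p] by auto
    have "\<exists>n0. \<forall>n\<ge>n0. y n \<in> laurent_ideal (qdiff (int M) ^ i)" for i
      by (rule less.IH[OF \<open>M < N\<close> \<open>M > 0\<close>])
    from vanishing_prime_step[OF p(1) \<open>M > 0\<close> y coherent[OF less.prems[unfolded M]] this]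
    show ?thesis unfolding M .
  qed (use vanishing in simp)
qed

section \<open>Quantum integers and Gaussian binomial coefficients\<close>

lemma qint_eq: "qint n = qdiff (int n) / qdiff 1"
  by (simp add: qint_def qdiff_def power_int_minus power_inverse)

lemma qint_0 [simp]: "qint 0 = 0"
  by (simp add: qint_def)

lemma qint_nonzero: "n > 0 \<Longrightarrow> qint n \<noteq> 0"
  using qdiff_nonzero[of n] qdiff_nonzero[of 1] by (simp add: qint_eq)

lemma qfact_0 [simp]: "qfact 0 = 1"
  and qfact_Suc: "qfact (Suc n) = qfact n * qint (Suc n)"
  by (simp_all add: qfact_def mult.commute)

lemma qfact_nonzero [simp]: "qfact n \<noteq> 0"
  by (induction n) (simp_all add: qfact_Suc qint_nonzero)

lemma qfact_1: "qfact (Suc 0) = 1"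
  using qdiff_nonzero[of 1] by (simp add: qfact_Suc qint_eq)

definition qbinom :: "nat \<Rightarrow> nat \<Rightarrow> qv" where
  "qbinom a b = qfact (a + b) / (qfact a * qfact b)"

lemma qbinom_0 [simp]: "qbinom a 0 = 1" "qbinom 0 b = 1"
  by (simp_all add: qbinom_def)

text \<open>
  The Pascal rule, which shows that Gaussian binomial coefficients are Laurent polynomials.
\<close>

lemma qbinom_Suc_Suc:
  "qbinom (Suc a) (Suc b) = qv_v powi int (Suc b) * qbinom a (Suc b)
     + qv_v powi (- int (Suc a)) * qbinom (Suc a) b"
proof -
  have "qdiff (int (Suc a + Suc b)) = qv_v powi int (Suc b) * qdiff (int (Suc a))
      + qv_v powi (- int (Suc a)) * qdiff (int (Suc b))"
    using qdiff_add[of "int (Suc a)" "int (Suc b)"] by simp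
  hence int: "qint (Suc a + Suc b) = qv_v powi int (Suc b) * qint (Suc a)
      + qv_v powi (- int (Suc a)) * qint (Suc b)"
    by (simp add: qint_eq add_divide_distrib)
  have "qfact (Suc a + Suc b) = qfact (Suc (a + b)) * qint (Suc a + Suc b)"
    using qfact_Suc[of "Suc (a + b)"] by simp
  thus ?thesis
    unfolding qbinom_def int
    using qint_nonzero[of "Suc a"] qint_nonzero[of "Suc b"]
    by (simp add: qfact_Suc field_simps)
qed

lemma qbinom_laurent: "qbinom a b \<in> laurent"
proof (induction "a + b" arbitrary: a b)
  case (Suc n)
  show ?case
  proof (cases a; cases b)
    fix a' b' assume "a = Suc a'" "b = Suc b'"
    thus ?thesis
      using Suc.hyps(1)[of a' "Suc b'"] Suc.hyps(1)[of "Suc a'" b'] Suc.hyps(2)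
      by (simp only: qbinom_Suc_Suc) (auto intro!: laurent_closed)
  qed (simp_all add: laurent_one)
qed (simp add: laurent_one)

section \<open>An action of $U$ for every weight $\<plusminus> v^k$\<close>

text \<open>
  The Boolean is the sign, so that the two weights $\pm v^x$ are treated uniformly; \<open>weight_diff s x\<close>
  is $\kappa - \kappa^{-1}$ for the weight $\kappa$ (\<open>weight_diff_eq\<close>).
\<close>

definition weight :: "bool \<Rightarrow> int \<Rightarrow> qv" where
  "weight s x = (if s then - 1 else 1) * qv_v powi x"

definition weight_diff :: "bool \<Rightarrow> int \<Rightarrow> qv" where
  "weight_diff s x = (if s then - 1 else 1) * qdiff x"

lemma weight_laurent: "weight s x \<in> laurent" and weight_diff_laurent: "weight_diff s x \<in> laurent"
  by (simp_all add: weight_def weight_diff_def laurent_closed)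

type_synonym coeffs = "nat \<Rightarrow> nat \<Rightarrow> qv"

text \<open>
  The action of the generators on coefficient families: \<open>f a b\<close> is the coefficient at
  $F^{(a)} e^b$ applied to a vector on which $K$ acts by the weight $\pm v^k$. The commutation of
  $e = (v - v^{-1}) E$ with $F^{(a+1)}$ produces the second summand for \<open>GE\<close>. For \<open>GF\<close> and \<open>a = 0\<close> the
  truncated index is harmless because $[0] = 0$.
\<close>

fun gen_act :: "bool \<Rightarrow> int \<Rightarrow> gen \<Rightarrow> coeffs \<Rightarrow> coeffs" where
  "gen_act s k GK f a b = weight s (k + 2 * int b - 2 * int a) * f a b"
| "gen_act s k GKinv f a b = inverse (weight s (k + 2 * int b - 2 * int a)) * f a b"
| "gen_act s k GE f a b =
     inverse (qdiff 1) * ((if b = 0 then 0 else f a (b - 1))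
       + weight_diff s (k + 2 * int b - int a) * f (Suc a) b)"
| "gen_act s k GF f a b = qint a * f (a - 1) b"

fun word_act :: "bool \<Rightarrow> int \<Rightarrow> gen word \<Rightarrow> coeffs \<Rightarrow> coeffs" where
  "word_act s k (Word gs) = foldr (gen_act s k) gs"

definition free_act :: "bool \<Rightarrow> int \<Rightarrow> free_alg \<Rightarrow> coeffs \<Rightarrow> coeffs" where
  "free_act s k x f a b =
     (\<Sum>w\<in>Poly_Mapping.keys x. Poly_Mapping.lookup x w * word_act s k w f a b)"

lemma word_act_plus: "word_act s k (u + w) f = word_act s k u (word_act s k w f)"
  by (cases u; cases w) simp

lemma gen_act_add: "gen_act s k g (\<lambda>a b. f a b + h a b) = (\<lambda>a b. gen_act s k g f a b + gen_act s k g h a b)"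
  and gen_act_scale: "gen_act s k g (\<lambda>a b. c * f a b) = (\<lambda>a b. c * gen_act s k g f a b)"
  by (cases g; auto simp: fun_eq_iff algebra_simps)+

lemma word_act_add: "word_act s k w (\<lambda>a b. f a b + h a b) = (\<lambda>a b. word_act s k w f a b + word_act s k w h a b)"
  and word_act_scale: "word_act s k w (\<lambda>a b. c * f a b) = (\<lambda>a b. c * word_act s k w f a b)"
proof -
  obtain gs where w: "w = Word gs" by (cases w)
  show "word_act s k w (\<lambda>a b. f a b + h a b) = (\<lambda>a b. word_act s k w f a b + word_act s k w h a b)"
    "word_act s k w (\<lambda>a b. c * f a b) = (\<lambda>a b. c * word_act s k w f a b)"
    unfolding w by (induction gs) (simp_all add: gen_act_add gen_act_scale)
qed

lemma word_act_sum:
  "word_act s k w (\<lambda>a b. \<Sum>i\<in>I. c i * f i a b) = (\<lambda>a b. \<Sum>i\<in>I. c i * word_act s k w (f i) a b)"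
proof (induction I rule: infinite_finite_induct)
  case (insert i I)
  thus ?case by (simp add: word_act_add word_act_scale)
qed (use word_act_scale[of s k w 0] in simp_all)

lemma free_act_zero: "free_act s k 0 f a b = 0"
  by (simp add: free_act_def)

lemma free_act_add: "free_act s k (x + y) f a b = free_act s k x f a b + free_act s k y f a b"
  unfolding free_act_def by (rule setsum_keys_plus_distrib) (auto simp: algebra_simps)

lemma free_act_single: "free_act s k (Poly_Mapping.single w c) f a b = c * word_act s k w f a b"
  by (auto simp: free_act_def)

lemma free_act_sum: "free_act s k (sum g I) f a b = (\<Sum>i\<in>I. free_act s k (g i) f a b)"
  by (induction I rule: infinite_finite_induct) (simp_all add: free_act_zero free_act_add)

lemma free_act_uminus: "free_act s k (- x) f a b = - free_act s k x f a b"
  using free_act_add[of s k x "- x" f a b] by (simp add: free_act_zero eq_neg_iff_add_eq_0 add.commute)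

lemma free_act_diff: "free_act s k (x - y) f a b = free_act s k x f a b - free_act s k y f a b"
  using free_act_add[of s k x "- y" f a b] by (simp add: free_act_uminus)

lemma free_act_mult: "free_act s k (x * y) f = free_act s k x (free_act s k y f)"
proof (intro ext)
  fix a b
  have "free_act s k (x * y) f a b = free_act s k
     ((\<Sum>u\<in>Poly_Mapping.keys x. Poly_Mapping.single u (Poly_Mapping.lookup x u)) *
      (\<Sum>w\<in>Poly_Mapping.keys y. Poly_Mapping.single w (Poly_Mapping.lookup y w))) f a b"
    using sum_single_lookup[of x] sum_single_lookup[of y] by simp
  also have "\<dots> = (\<Sum>u\<in>Poly_Mapping.keys x. \<Sum>w\<in>Poly_Mapping.keys y.
      Poly_Mapping.lookup x u * (Poly_Mapping.lookup y w * word_act s k u (word_act s k w f) a b))"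
    unfolding sum_product
    by (simp add: free_act_sum free_act_single Poly_Mapping.mult_single word_act_plus mult.assoc)
  also have "\<dots> = free_act s k x (free_act s k y f) a b"
    unfolding free_act_def[of s k x] free_act_def[of s k y, abs_def]
    by (simp add: word_act_sum sum_distrib_left)
  finally show "free_act s k (x * y) f a b = free_act s k x (free_act s k y f) a b" .
qed

lemma free_act_scalar: "free_act s k (fscalar c) f a b = c * f a b"
  by (simp add: fscalar_def free_act_single zero_word_def)

lemma free_act_gen: "free_act s k (fgen g) f a b = gen_act s k g f a b"
  by (simp add: fgen_def free_act_single)

lemma free_act_null: "free_act s k x (\<lambda>_ _. 0) a b = 0"
  using word_act_scale[of s k _ 0 "\<lambda>_ _. 0"] by (simp add: free_act_def)

lemma weight_add: "weight s (x + y) = qv_v powi y * weight s x"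
  by (simp add: weight_def qv_v_powi_add)

lemma weight_nonzero: "weight s x \<noteq> 0"
  by (simp add: weight_def qv_v_nonzero)

lemma weight_diff_eq: "weight_diff s x = weight s x - inverse (weight s x)"
  by (simp add: weight_def weight_diff_def qdiff_def power_int_minus)

text \<open>The identity behind the relation for $EF - FE$.\<close>

lemma qdiff_commutator:
  "qdiff (x + 1) * qdiff y - qdiff x * qdiff (y + 1) = qdiff 1 * qdiff (y - x)"
proof -
  have "qdiff (x + 1) * qdiff y - qdiff x * qdiff (y + 1)
      = (qv_v powi (x + 1) * qv_v powi y - qv_v powi x * qv_v powi (y + 1))
        + (qv_v powi (x) * qv_v powi (- (y + 1)) - qv_v powi (x + 1) * qv_v powi (- y))
        + (qv_v powi (- x) * qv_v powi (y + 1) - qv_v powi (- (x + 1)) * qv_v powi y)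
        + (qv_v powi (- (x + 1)) * qv_v powi (- y) - qv_v powi (- x) * qv_v powi (- (y + 1)))"
    by (simp only: qdiff_def algebra_simps)
  also have "\<dots> = qv_v powi (1 + (y - x)) + qv_v powi (- 1 + - (y - x))
      - qv_v powi (1 + - (y - x)) - qv_v powi (- 1 + (y - x))"
    by (simp add: algebra_simps flip: qv_v_powi_add)
  also have "\<dots> = qdiff 1 * qdiff (y - x)"
    unfolding qv_v_powi_add qdiff_def by (simp add: algebra_simps)
  finally show ?thesis .
qed

text \<open>
  Powers of $v$ account for the relations of $K$ with $E$ and $F$; for $EF - FE$ the diagonal
  coefficients are matched by \<open>qdiff_commutator\<close>.
\<close>

lemma usl2_relators_act: "x \<in> usl2_relators \<Longrightarrow> free_act s k x f a b = 0"
proof -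
  have q1: "qv_v - inverse qv_v = qdiff 1" by (simp add: qdiff_def power_int_minus)
  have q1nz: "qdiff 1 \<noteq> 0" using qdiff_nonzero[of 1] by simp
  have one: "free_act s k 1 f a b = f a b"
    using free_act_scalar[of s k 1 f a b] by (simp add: fscalar_def)
  let ?w = "k + 2 * int b - 2 * int a"
  have w2: "weight s (k + 2 * int b - 2 * int (Suc a)) = inverse qv_v ^ 2 * weight s ?w"
    using weight_add[of s ?w "- 2"] by (simp add: power_int_minus power_inverse algebra_simps)
  have w3: "weight s (k + 2 * int (b - 1) - 2 * int a) = inverse qv_v ^ 2 * weight s ?w" if "b > 0"
    using weight_add[of s ?w "- 2"] that
    by (simp add: power_int_minus power_inverse algebra_simps of_nat_diff)
  have w4: "weight s (k + 2 * int b - 2 * int (a - 1)) = qv_v ^ 2 * weight s ?w" if "a > 0"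
    using weight_add[of s ?w 2] that by (simp add: algebra_simps of_nat_diff)
  have vv: "qv_v ^ 2 * (inverse qv_v ^ 2 * z) = z" "inverse qv_v ^ 2 * (qv_v ^ 2 * z) = z" for z
    by (simp_all add: qv_v_nonzero field_simps)
  assume "x \<in> usl2_relators"
  then consider "x = fgen GK * fgen GKinv - 1" | "x = fgen GKinv * fgen GK - 1"
    | "x = fgen GK * fgen GE - fscalar (qv_v ^ 2) * fgen GE * fgen GK"
    | "x = fgen GK * fgen GF - fscalar (inverse qv_v ^ 2) * fgen GF * fgen GK"
    | "x = fgen GE * fgen GF - fgen GF * fgen GE
       - fscalar (inverse (qv_v - inverse qv_v)) * (fgen GK - fgen GKinv)"
    unfolding usl2_relators_def by auto
  thus "free_act s k x f a b = 0"
  proof cases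
    case 3
    show ?thesis
      unfolding 3 free_act_diff free_act_mult free_act_scalar free_act_gen gen_act.simps w2
      using w3 by (auto simp: distrib_left mult_ac vv)
  next
    case 4
    show ?thesis
      unfolding 4 free_act_diff free_act_mult free_act_scalar free_act_gen gen_act.simps
      using w4 by (cases "a = 0") (auto simp: mult_ac vv)
  next
    case 5
    have c: "qint (Suc a) * weight_diff s (k + 2 * int b - int a)
        - qint a * weight_diff s (k + 2 * int b - int (a - 1)) = weight_diff s ?w"
    proof (cases a)
      case (Suc n)
      show ?thesis
        using qdiff_commutator[of "int a" "k + 2 * int b - int a"] q1nz
        by (simp add: Suc qint_eq weight_diff_def field_simps)
    qed (use qint_nonzero[of 1] in \<open>simp add: qint_eq q1nz\<close>)
    have "inverse (qdiff 1) * ((if b = 0 then 0 else qint a * f (a - 1) (b - 1))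
          + weight_diff s (k + 2 * int b - int a) * (qint (Suc a) * f a b))
        - qint a * (inverse (qdiff 1) * ((if b = 0 then 0 else f (a - 1) (b - 1))
          + weight_diff s (k + 2 * int b - int (a - 1)) * f (Suc (a - 1)) b))
      = inverse (qdiff 1) * ((qint (Suc a) * weight_diff s (k + 2 * int b - int a)
        - qint a * weight_diff s (k + 2 * int b - int (a - 1))) * f a b)"
      by (cases "a = 0") (auto simp: algebra_simps)
    hence comm: "inverse (qdiff 1) * ((if b = 0 then 0 else qint a * f (a - 1) (b - 1))
          + weight_diff s (k + 2 * int b - int a) * (qint (Suc a) * f a b))
        - qint a * (inverse (qdiff 1) * ((if b = 0 then 0 else f (a - 1) (b - 1))
          + weight_diff s (k + 2 * int b - int (a - 1)) * f (Suc (a - 1)) b))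
      = inverse (qdiff 1) * (weight s ?w * f a b - inverse (weight s ?w) * f a b)"
      unfolding c weight_diff_eq[of s ?w] by (simp only: left_diff_distrib)
    show ?thesis
      unfolding 5 free_act_diff free_act_mult free_act_scalar free_act_gen gen_act.simps q1
        diff_Suc_1 comm by simp
  qed (simp_all add: free_act_diff free_act_mult free_act_gen one weight_nonzero)
qed

lemma usl2_ideal_act:
  assumes "x \<in> usl2_ideal"
  shows "free_act s k x f a b = 0"
proof -
  let ?I = "{x. \<forall>f a b. free_act s k x f a b = 0}"
  have "ideal ?I ring_of_type_algebra"
  proof (rule idealI)
    have "\<ominus>\<^bsub>ring_of_type_algebra\<^esub> x = - x" for x :: free_alg by simp
    hence "inv\<^bsub>add_monoid ring_of_type_algebra\<^esub> x = - x" for x :: free_alg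
      by (simp add: a_inv_def)
    thus "subgroup ?I (add_monoid ring_of_type_algebra)"
      by (auto simp: subgroup_def free_act_zero free_act_add free_act_uminus)
  next
    fix x y :: free_alg assume "x \<in> ?I"
    hence "free_act s k x f = (\<lambda>_ _. 0)" for f by (simp add: fun_eq_iff)
    thus "y \<otimes>\<^bsub>ring_of_type_algebra\<^esub> x \<in> ?I" "x \<otimes>\<^bsub>ring_of_type_algebra\<^esub> y \<in> ?I"
      by (simp_all add: free_act_mult free_act_null)
  qed (rule ring_of_type_algebra_ring)
  moreover have "usl2_relators \<subseteq> ?I" using usl2_relators_act by blast
  ultimately have "usl2_ideal \<subseteq> ?I"
    unfolding usl2_ideal_def by (rule ring.genideal_minimal[OF ring_of_type_algebra_ring])
  thus ?thesis using assms by auto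
qed

lift_definition usl2_act :: "bool \<Rightarrow> int \<Rightarrow> usl2 \<Rightarrow> coeffs \<Rightarrow> coeffs" is free_act
proof -
  fix s k x y assume "usl2_rel x y"
  hence "free_act s k (x - y) f a b = 0" for f a b
    by (simp add: usl2_rel_def usl2_ideal_act)
  thus "free_act s k x = free_act s k y" by (simp add: fun_eq_iff free_act_diff)
qed

lemma usl2_act_add: "usl2_act s k (x + y) f a b = usl2_act s k x f a b + usl2_act s k y f a b"
  by (induction x rule: usl2.abs_induct; induction y rule: usl2.abs_induct)
     (simp add: usl2_act.abs_eq plus_usl2.abs_eq free_act_add)

lemma usl2_act_uminus: "usl2_act s k (- x) f a b = - usl2_act s k x f a b"
  by (induction x rule: usl2.abs_induct) (simp add: usl2_act.abs_eq uminus_usl2.abs_eq free_act_uminus)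

lemma usl2_act_diff: "usl2_act s k (x - y) f a b = usl2_act s k x f a b - usl2_act s k y f a b"
  using usl2_act_add[of s k x "- y" f a b] by (simp add: usl2_act_uminus)

lemma usl2_act_zero: "usl2_act s k 0 f a b = 0"
  using usl2_act_diff[of s k 0 0 f a b] by simp

lemma usl2_act_mult: "usl2_act s k (x * y) f = usl2_act s k x (usl2_act s k y f)"
  by (induction x rule: usl2.abs_induct; induction y rule: usl2.abs_induct)
     (simp add: usl2_act.abs_eq times_usl2.abs_eq free_act_mult)

lemma usl2_act_scalar: "usl2_act s k (usl2_scalar c) f a b = c * f a b"
  by (simp add: usl2_scalar.abs_eq usl2_act.abs_eq free_act_scalar)

lemma usl2_act_one: "usl2_act s k 1 f = f"
  using usl2_act_scalar[of s k 1 f] by (simp add: usl2_scalar_one fun_eq_iff)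

lemma usl2_act_uK: "usl2_act s k uK f a b = weight s (k + 2 * int b - 2 * int a) * f a b"
  by (simp add: uK_def usl2_act.abs_eq free_act_gen)

lemma usl2_act_uKinv:
  "usl2_act s k uKinv f a b = inverse (weight s (k + 2 * int b - 2 * int a)) * f a b"
  by (simp add: uKinv_def usl2_act.abs_eq free_act_gen)

lemma usl2_act_uF: "usl2_act s k uF f a b = qint a * f (a - 1) b"
  by (simp add: uF_def usl2_act.abs_eq free_act_gen)

lemma usl2_act_ue:
  "usl2_act s k ue f a b = (if b = 0 then 0 else f a (b - 1))
     + weight_diff s (k + 2 * int b - int a) * f (Suc a) b"
proof -
  have "qv_v - inverse qv_v = qdiff 1" "qdiff 1 \<noteq> 0"
    using qdiff_nonzero[of 1] by (simp_all add: qdiff_def power_int_minus)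
  moreover have "usl2_act s k uE f a b = inverse (qdiff 1) * ((if b = 0 then 0 else f a (b - 1))
       + weight_diff s (k + 2 * int b - int a) * f (Suc a) b)"
    by (simp add: uE_def usl2_act.abs_eq free_act_gen)
  ultimately show ?thesis by (simp add: ue_def usl2_act_mult usl2_act_scalar)
qed

lemma usl2_act_uFdiv:
  "usl2_act s k (uFdiv n) f a b = (if n \<le> a then qbinom (a - n) n * f (a - n) b else 0)"
proof -
  have "usl2_act s k (uF ^ n) f a b
      = (if n \<le> a then qfact a / qfact (a - n) * f (a - n) b else 0)" for a
  proof (induction n arbitrary: a)
    case (Suc n)
    show ?case
    proof (cases a)
      case (Suc a')
      thus ?thesis by (simp add: usl2_act_mult usl2_act_uF Suc.IH qfact_Suc)
    qed (simp add: usl2_act_mult usl2_act_uF)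
  qed (simp add: usl2_act_one)
  thus ?thesis by (simp add: uFdiv_def usl2_act_mult usl2_act_scalar qbinom_def field_simps)
qed

lemma usl2_act_H_factor:
  "usl2_act s k (H_factor m) f a b = weight_diff s (k + 2 * int b - 2 * int a + m) * f a b"
proof -
  let ?w = "k + 2 * int b - 2 * int a"
  have "weight s (?w + m) = qv_v powi m * weight s ?w"
       "inverse (weight s (?w + m)) = qv_v powi (- m) * inverse (weight s ?w)"
    by (simp_all add: weight_add power_int_minus)
  thus ?thesis
    by (simp add: H_factor_def usl2_act_diff usl2_act_mult usl2_act_scalar usl2_act_uK
        usl2_act_uKinv weight_diff_eq algebra_simps)
qed

lemma usl2_act_H_shift:
  "usl2_act s k (H_shift m i) f a b
     = (\<Prod>j<i. weight_diff s (k + 2 * int b - 2 * int a + m - int j)) * f a b"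
proof (induction i arbitrary: f)
  case (Suc i)
  thus ?case by (simp add: H_shift_Suc usl2_act_mult usl2_act_H_factor algebra_simps)
qed (simp add: H_shift_0 usl2_act_one)

section \<open>The filtrations act by raising divisibility\<close>

text \<open>
  The filtration of the module lattice by divisibility. The exponent is a truncated difference: at
  $F^{(a)} e^b$ with $b \ge j$ any Laurent polynomial is admitted, since high powers of $e$ already
  lie deep in the filtration of the algebra.
\<close>

definition coeff_filt :: "nat \<Rightarrow> nat \<Rightarrow> coeffs set" where
  "coeff_filt N j = {f. \<forall>a b. f a b \<in> laurent_ideal (qdiff (int N) ^ (j - b))}"

lemma coeff_filtD: "f \<in> coeff_filt N j \<Longrightarrow> f a b \<in> laurent_ideal (qdiff (int N) ^ (j - b))"
  by (simp add: coeff_filt_def)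

lemma coeff_filtD_le:
  assumes "f \<in> coeff_filt N j" "i \<le> j - b"
  shows "f a b \<in> laurent_ideal (qdiff (int N) ^ i)"
  using coeff_filtD[OF assms(1), of a b] laurent_ideal_power_le[OF qdiff_laurent assms(2)] by blast

text \<open>
  The step numbers add up under multiplication and \<open>U_int\<close> lies in \<open>raising N 0\<close>, so that for the
  ideals of the filtrations membership has to be checked on generators only.
\<close>

definition raising :: "nat \<Rightarrow> nat \<Rightarrow> usl2 set" where
  "raising N d = {x. \<forall>s k j. \<forall>f\<in>coeff_filt N j. usl2_act s k x f \<in> coeff_filt N (j + d)}"

lemma raisingD:
  assumes "x \<in> raising N d" "f \<in> coeff_filt N j"
  shows "usl2_act s k x f \<in> coeff_filt N (j + d)"
  using assms by (simp add: raising_def)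

lemma raising_zero: "0 \<in> raising N d"
  by (simp add: raising_def coeff_filt_def usl2_act_zero laurent_ideal_zero)

lemma raising_add: "x \<in> raising N d \<Longrightarrow> y \<in> raising N d \<Longrightarrow> x + y \<in> raising N d"
  by (simp add: raising_def coeff_filt_def usl2_act_add laurent_ideal_add)

lemma raising_uminus: "x \<in> raising N d \<Longrightarrow> - x \<in> raising N d"
  by (simp add: raising_def coeff_filt_def usl2_act_uminus laurent_ideal_uminus)

lemma raising_mult:
  assumes "x \<in> raising N d" "y \<in> raising N e"
  shows "x * y \<in> raising N (d + e)"
  unfolding raising_def
proof (intro CollectI allI ballI)
  fix s k j f assume "f \<in> coeff_filt N j"
  thus "usl2_act s k (x * y) f \<in> coeff_filt N (j + (d + e))"
    using raisingD[OF assms(1) raisingD[OF assms(2)], of f j s k s k]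
    by (simp add: usl2_act_mult add_ac)
qed

lemma raising_one: "1 \<in> raising N 0"
  by (simp add: raising_def usl2_act_one)

lemma raising_le:
  assumes "d \<le> e"
  shows "raising N e \<subseteq> raising N d"
proof
  fix x assume x: "x \<in> raising N e"
  show "x \<in> raising N d"
    unfolding raising_def coeff_filt_def[of N "_ + d"]
  proof (intro CollectI allI ballI)
    fix s k j f a b assume "f \<in> coeff_filt N j"
    from coeff_filtD_le[OF raisingD[OF x this]]
    show "usl2_act s k x f a b \<in> laurent_ideal (qdiff (int N) ^ (j + d - b))" using assms by simp
  qed
qed

lemma raising_sum: "(\<And>i. i \<in> I \<Longrightarrow> f i \<in> raising N d) \<Longrightarrow> sum f I \<in> raising N d"
  by (induction I rule: infinite_finite_induct) (auto simp: raising_zero intro!: raising_add)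

lemma raising_zeroI:
  assumes "\<And>s k j f a b. f \<in> coeff_filt N j \<Longrightarrow>
    usl2_act s k x f a b \<in> laurent_ideal (qdiff (int N) ^ (j - b))"
  shows "x \<in> raising N 0"
  using assms by (auto simp: raising_def coeff_filt_def)

lemma raising_scalar: "c \<in> laurent \<Longrightarrow> usl2_scalar c \<in> raising N 0"
  by (rule raising_zeroI) (simp add: usl2_act_scalar laurent_ideal_lmult coeff_filtD)

lemma raising_uK: "uK \<in> raising N 0" and raising_uKinv: "uKinv \<in> raising N 0"
proof -
  have "inverse (weight s x) = weight s (- x)" for s x
    by (simp add: weight_def power_int_minus)
  thus "uK \<in> raising N 0" "uKinv \<in> raising N 0"
    by (intro raising_zeroI; simp add: usl2_act_uK usl2_act_uKinv laurent_ideal_lmult coeff_filtD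
        weight_laurent)+
qed

lemma raising_ue: "ue \<in> raising N 0"
proof (rule raising_zeroI)
  fix s k j f a b assume f: "f \<in> coeff_filt N j"
  have "(if b = 0 then 0 else f a (b - 1)) \<in> laurent_ideal (qdiff (int N) ^ (j - b))"
    using coeff_filtD_le[OF f, of "j - b" "b - 1" a] by (auto simp: laurent_ideal_zero)
  from laurent_ideal_add[OF this laurent_ideal_lmult[OF weight_diff_laurent coeff_filtD[OF f]]]
  show "usl2_act s k ue f a b \<in> laurent_ideal (qdiff (int N) ^ (j - b))"
    unfolding usl2_act_ue .
qed

lemma raising_uFdiv: "uFdiv n \<in> raising N 0"
  by (rule raising_zeroI)
     (simp add: usl2_act_uFdiv laurent_ideal_zero laurent_ideal_lmult qbinom_laurent coeff_filtD)

text \<open>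
  The generators have Laurent polynomial matrix entries and never decrease the power of $e$.
\<close>

lemma U_int_raising:
  assumes "x \<in> U_int"
  shows "x \<in> raising N 0"
  using assms unfolding U_int_def
proof (induction rule: laurent_subalgebra_induct)
  case (incl x)
  thus ?case using raising_uK raising_uKinv raising_ue raising_uFdiv by auto
next
  case (mult x y)
  thus ?case using raising_mult[of x N 0 y 0] by simp
qed (auto intro: raising_scalar raising_one raising_uminus raising_add)

lemma prod_weight_diff:
  assumes "N > 0"
  shows "(\<Prod>i<N. weight_diff s (x - int i)) \<in> laurent_ideal (qdiff (int N))"
proof -
  have "(\<Prod>i<N. weight_diff s (x - int i))
      = (if s then - 1 else 1) ^ N * (\<Prod>i<N. qdiff (x - int i))"
    unfolding weight_diff_def prod.distrib by simp
  thus ?thesis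
    using prod_consecutive_qdiff[OF assms]
    by (auto intro!: laurent_ideal_lmult laurent_closed)
qed

lemma laurent_ideal_Suc_diff:
  assumes "x \<in> laurent_ideal (qdiff n * qdiff n ^ (j - b))"
  shows "x \<in> laurent_ideal (qdiff n ^ (j + 1 - b))"
proof -
  have "j + 1 - b \<le> Suc (j - b)" by simp
  from laurent_ideal_power_le[OF qdiff_laurent this, of n] show ?thesis using assms by auto
qed

lemma raising_H_shift:
  assumes "N > 0"
  shows "H_shift m N \<in> raising N 1"
  unfolding raising_def coeff_filt_def[of N "_ + 1"]
proof (intro CollectI allI ballI)
  fix s k j f a b assume f: "f \<in> coeff_filt N j"
  have "usl2_act s k (H_shift m N) f a b \<in> laurent_ideal (qdiff (int N) * qdiff (int N) ^ (j - b))"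
    unfolding usl2_act_H_shift
    by (intro laurent_ideal_mult prod_weight_diff assms coeff_filtD f)
  thus "usl2_act s k (H_shift m N) f a b \<in> laurent_ideal (qdiff (int N) ^ (j + 1 - b))"
    by (rule laurent_ideal_Suc_diff)
qed

text \<open>
  Expand $e^n$ into paths: each factor either lowers $a$ or raises $b$. The path without a raising
  step contributes the displayed product; every other path raises $b$ at least once, which gains a
  factor $\{N\}$ in the filtration.
\<close>

lemma ue_power_act:
  assumes f: "f \<in> coeff_filt N j"
  shows "usl2_act s k (ue ^ n) f a b
      - (\<Prod>i<n. weight_diff s (k + 2 * int b - int a - int i)) * f (a + n) b
    \<in> laurent_ideal (qdiff (int N) ^ (j + 1 - b))"
proof (induction n arbitrary: a)
  case (Suc n)
  let ?g = "usl2_act s k (ue ^ n) f"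
  let ?P = "\<lambda>n a. \<Prod>i<n. weight_diff s (k + 2 * int b - int a - int i)"
  have g: "?g \<in> coeff_filt N j"
    using raisingD[OF U_int_raising f, of "ue ^ n"] by (simp add: U_int_closed U_int_gens)
  have 1: "(if b = 0 then 0 else ?g a (b - 1)) \<in> laurent_ideal (qdiff (int N) ^ (j + 1 - b))"
    using coeff_filtD_le[OF g, of "j + 1 - b" "b - 1" a] by (auto simp: laurent_ideal_zero)
  have 2: "weight_diff s (k + 2 * int b - int a) * (?g (Suc a) b - ?P n (Suc a) * f (Suc a + n) b)
      \<in> laurent_ideal (qdiff (int N) ^ (j + 1 - b))"
    by (intro laurent_ideal_lmult weight_diff_laurent Suc.IH)
  have 3: "?P (Suc n) a = weight_diff s (k + 2 * int b - int a) * ?P n (Suc a)"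
    by (subst prod.lessThan_Suc_shift) (simp add: algebra_simps)
  have "usl2_act s k (ue ^ Suc n) f a b - ?P (Suc n) a * f (a + Suc n) b
      = (if b = 0 then 0 else ?g a (b - 1))
        + weight_diff s (k + 2 * int b - int a) * (?g (Suc a) b - ?P n (Suc a) * f (Suc a + n) b)"
    unfolding 3 by (simp add: usl2_act_mult usl2_act_ue algebra_simps)
  thus ?case using laurent_ideal_add[OF 1 2] by (simp only:)
qed (simp add: usl2_act_one laurent_ideal_zero)

lemma raising_ue_power:
  assumes "N > 0"
  shows "ue ^ N \<in> raising N 1"
  unfolding raising_def coeff_filt_def[of N "_ + 1"]
proof (intro CollectI allI ballI)
  fix s k j f a b assume f: "f \<in> coeff_filt N j"
  let ?P = "\<Prod>i<N. weight_diff s (k + 2 * int b - int a - int i)"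
  have "?P * f (a + N) b \<in> laurent_ideal (qdiff (int N) * qdiff (int N) ^ (j - b))"
    by (intro laurent_ideal_mult prod_weight_diff assms coeff_filtD f)
  hence "?P * f (a + N) b \<in> laurent_ideal (qdiff (int N) ^ (j + 1 - b))"
    by (rule laurent_ideal_Suc_diff)
  from laurent_ideal_add[OF ue_power_act[OF f, of s k N a b] this]
  show "usl2_act s k (ue ^ N) f a b \<in> laurent_ideal (qdiff (int N) ^ (j + 1 - b))" by simp
qed

lemma H_shift_add: "H_shift m (i + n) = H_shift m i * H_shift (m - int i) n"
  by (induction n) (simp_all add: H_shift_0 H_shift_Suc mult.assoc algebra_simps)

lemma raising_H_shift_div:
  assumes "N > 0"
  shows "H_shift m n \<in> raising N (n div N)"
proof -
  have *: "H_shift m (N * d) \<in> raising N d" for d m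
  proof (induction d arbitrary: m)
    case (Suc d)
    thus ?case
      using raising_mult[OF raising_H_shift[OF assms] Suc] by (simp add: H_shift_add)
  qed (simp add: H_shift_0 raising_one)
  show ?thesis
    using raising_mult[OF * U_int_raising[OF H_shift_U_int]]
      H_shift_add[of m "N * (n div N)" "n mod N"] by simp
qed

lemma raising_ue_power_div:
  assumes "N > 0"
  shows "ue ^ n \<in> raising N (n div N)"
proof -
  have *: "ue ^ (N * d) \<in> raising N d" for d
  proof (induction d)
    case (Suc d)
    thus ?case
      using raising_mult[OF raising_ue_power[OF assms] Suc] by (simp add: power_add)
  qed (simp add: raising_one)
  have "ue ^ (n mod N) \<in> U_int" by (intro U_int_closed U_int_gens)
  from raising_mult[OF * U_int_raising[OF this], of "n div N"]
  show ?thesis by (simp flip: power_add)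
qed

lemma laurent_subalgebra_mono: "S \<subseteq> T \<Longrightarrow> laurent_subalgebra S \<subseteq> laurent_subalgebra T"
  by (intro subsetI, erule laurent_subalgebra_induct)
     (auto intro: laurent_subalgebra_closed laurent_subalgebra_scalar laurent_subalgebra_incl)

lemma U0_subset_U_int: "U0 \<subseteq> U_int" and U_plus_subset_U_int: "U_plus \<subseteq> U_int"
  unfolding U0_def U_plus_def U_int_def by (rule laurent_subalgebra_mono; auto)+

lemma span_prod_raising:
  assumes "x \<in> span_prod A B" "A \<subseteq> raising N d" "B \<subseteq> raising N e"
  shows "x \<in> raising N (d + e)"
  using assms(1)
  by (induction rule: span_prod_induct) (use assms(2,3) in \<open>auto intro: raising_mult raising_add\<close>)

lemma Uge0_subset_U_int: "Uge0 \<subseteq> U_int"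
proof
  fix x assume "x \<in> Uge0"
  thus "x \<in> U_int" unfolding Uge0_def
    by (induction rule: span_prod_induct)
       (use U0_subset_U_int U_plus_subset_U_int in \<open>auto intro!: U_int_closed\<close>)
qed

lemma ideal_raising:
  assumes "ring (usl2_subring S)" "S \<subseteq> U_int"
  shows "ideal (S \<inter> raising N d) (usl2_subring S)"
proof -
  interpret S: ring "usl2_subring S" by (rule assms)
  have "a * x \<in> raising N d" "x * a \<in> raising N d" if "a \<in> S" "x \<in> raising N d" for a x
    using that assms(2) raising_mult[OF U_int_raising[of a] that(2)]
      raising_mult[OF that(2) U_int_raising[of a]] by auto
  thus ?thesis
    unfolding ideal_usl2_subring_iff[OF assms(1)]
    using S.zero_closed S.a_closed S.m_closed by (auto intro: raising_zero raising_add)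
qed

lemma U0_filt_raising:
  assumes "N > 0"
  shows "U0_filt n \<subseteq> raising N (n div N)"
proof -
  have "U0_filt n \<subseteq> U0 \<inter> raising N (n div N)"
    unfolding U0_filt_def
    by (rule ring.genideal_minimal[OF U0_ring ideal_raising[OF U0_ring U0_subset_U_int]])
       (auto simp: H_shift_U0 raising_H_shift_div[OF assms])
  thus ?thesis by blast
qed

lemma U_plus_filt_raising:
  assumes "N > 0"
  shows "U_plus_filt n \<subseteq> raising N (n div N)"
proof
  fix x assume "x \<in> U_plus_filt n"
  then obtain q where "q \<in> U_plus" "x = ue ^ n * q" by (auto simp: U_plus_filt_def)
  thus "x \<in> raising N (n div N)"
    using raising_mult[OF raising_ue_power_div[OF assms] U_int_raising, of q n] U_plus_subset_U_int
    by auto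
qed

lemma Uge0_filt_raising:
  assumes "N > 0" and d: "\<And>i. i \<le> n \<Longrightarrow> d \<le> i div N + (n - i) div N"
  shows "Uge0_filt n \<subseteq> raising N d"
proof
  fix x assume "x \<in> Uge0_filt n"
  then obtain f where f: "x = (\<Sum>i\<le>n. f i)" "\<forall>i\<le>n. f i \<in> Uge0_part i (n - i)"
    by (auto simp: Uge0_filt_def)
  have "f i \<in> raising N d" if "i \<le> n" for i
    using span_prod_raising[OF f(2)[rule_format, OF that] U0_filt_raising U_plus_filt_raising]
      raising_le[OF d[OF that], of N] assms(1) by blast
  thus "x \<in> raising N d" unfolding f(1) by (auto intro: raising_sum)
qed

lemma U_int_filt_raising:
  assumes "N > 0" and d: "\<And>i. i \<le> n \<Longrightarrow> d \<le> i div N + (n - i) div N"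
  shows "U_int_filt n \<subseteq> raising N d"
proof -
  have "H_shift m i * ue ^ (n - i) \<in> U_int \<inter> raising N d" if "i \<le> n" for m i
  proof
    show "H_shift m i * ue ^ (n - i) \<in> U_int" by (intro U_int_closed H_shift_U_int U_int_gens)
    show "H_shift m i * ue ^ (n - i) \<in> raising N d"
      by (rule set_mp[OF raising_le[OF d[OF that]]])
         (intro raising_mult raising_H_shift_div raising_ue_power_div assms(1))
  qed
  hence "U_int_filt n \<subseteq> U_int \<inter> raising N d"
    unfolding U_int_filt_def
    by (intro ring.genideal_minimal[OF U_int_ring ideal_raising[OF U_int_ring]]) auto
  thus ?thesis by blast
qed

text \<open>
  For $N = 1$ each factor of the ideal contributes one step.
\<close>

lemma ideal_powers_raising:
  assumes "S \<subseteq> U_int" "J \<subseteq> raising 1 1"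
  shows "ideal_powers (usl2_subring S) J n \<subseteq> raising 1 n"
proof (induction n)
  case 0
  thus ?case using assms(1) U_int_raising by (auto simp: ideal_powers_0)
next
  case (Suc n)
  show ?case
    using span_prod_raising[OF _ Suc assms(2)]
    by (auto simp: ideal_powers_Suc ideal_prod_usl2_subring)
qed

section \<open>Coherent sequences that vanish at $v = \<plusminus> 1$\<close>

text \<open>
  The generating vector of the module.
\<close>

definition vacuum :: coeffs where
  "vacuum a b = (if a = 0 \<and> b = 0 then 1 else 0)"

lemma vacuum_filt: "vacuum \<in> coeff_filt N 0"
  by (auto simp: coeff_filt_def vacuum_def laurent_ideal_one laurent_zero laurent_one)

text \<open>
  Each coefficient satisfies the hypotheses of \<open>vanishing_everywhere\<close>. The explicit modulus of
  coherence then turns its conclusion about large indices into one about all \<open>n\<close> beyond a bound that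
  does not depend on the coefficient or the weight.
\<close>

lemma vacuum_coeffs_vanish:
  fixes z :: "nat \<Rightarrow> usl2"
  assumes vanishing: "\<And>n. z n \<in> raising 1 n"
    and coherent: "\<And>N d m n. N > 0 \<Longrightarrow> N * Suc d \<le> n \<Longrightarrow> n \<le> m \<Longrightarrow> z m - z n \<in> raising N d"
    and "N > 0" "N * Suc d \<le> n"
  shows "usl2_act s k (z n) vacuum \<in> coeff_filt N d"
  unfolding coeff_filt_def
proof (intro CollectI allI)
  fix a b
  define y where "y = (\<lambda>n. usl2_act s k (z n) vacuum a b)"
  have close: "y m - y n \<in> laurent_ideal (qdiff (int N) ^ (d - b))"
    if "N > 0" "N * Suc d \<le> n" "n \<le> m" for m n d N
    using coeff_filtD[OF raisingD[OF coherent[OF that] vacuum_filt], of s k a b]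
    by (simp add: y_def usl2_act_diff)
  have small: "y n \<in> laurent_ideal (qdiff 1 ^ (n - b))" for n
    using coeff_filtD[OF raisingD[OF vanishing vacuum_filt], of s k n a b] by (simp add: y_def)
  have "\<exists>n0. \<forall>n\<ge>n0. y n \<in> laurent_ideal (qdiff (int N) ^ (d - b))"
  proof (rule vanishing_everywhere[OF _ \<open>N > 0\<close>])
    show "y n \<in> laurent" for n
      by (rule laurent_ideal_laurent[OF small]) (simp add: laurent_power)
    show "\<exists>n0. \<forall>n\<ge>n0. y n \<in> laurent_ideal (qdiff 1 ^ j)" for j
    proof (intro exI allI impI)
      fix n assume "j + b \<le> n"
      hence "j \<le> n - b" by simp
      from laurent_ideal_power_le[OF qdiff_laurent this, of 1]
      show "y n \<in> laurent_ideal (qdiff 1 ^ j)" using small[of n] by blast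
    qed
    fix N :: nat and j assume N: "N > 0"
    have *: "y m - y n \<in> laurent_ideal (qdiff (int N) ^ j)" if "N * Suc (j + b) \<le> n" "n \<le> m" for m n
      using close[OF N that] by simp
    show "\<exists>n0. \<forall>m\<ge>n0. \<forall>n\<ge>n0. y m - y n \<in> laurent_ideal (qdiff (int N) ^ j)"
    proof (intro exI allI impI)
      fix m n assume mn: "N * Suc (j + b) \<le> m" "N * Suc (j + b) \<le> n"
      show "y m - y n \<in> laurent_ideal (qdiff (int N) ^ j)"
      proof (cases "n \<le> m")
        case False
        thus ?thesis using laurent_ideal_uminus[OF *[OF mn(1), of n]] by simp
      qed (use * mn in blast)
    qed
  qed
  then obtain n0 where "\<And>n. n \<ge> n0 \<Longrightarrow> y n \<in> laurent_ideal (qdiff (int N) ^ (d - b))" by blast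
  from laurent_ideal_diff[OF this close[OF assms(3,4)], of "n0 + n" "n0 + n"]
  show "usl2_act s k (z n) vacuum a b \<in> laurent_ideal (qdiff (int N) ^ (d - b))"
    by (simp add: y_def)
qed

section \<open>Triangular decomposition\<close>

lemma usl2_scalar_zero: "usl2_scalar 0 = 0"
  using usl2_scalar_diff[of 0 0] by simp

lemma usl2_scalar_add: "usl2_scalar (a + b) = usl2_scalar a + usl2_scalar b"
proof -
  have "usl2_scalar (- b) = - usl2_scalar b" using usl2_scalar_diff[of 0 b] by (simp add: usl2_scalar_zero)
  thus ?thesis using usl2_scalar_diff[of a "- b"] by simp
qed

lemma U0_commute:
  assumes "x \<in> U0" "y \<in> U0"
  shows "x * y = y * x"
proof -
  have gens: "x * t = t * x" if x: "x \<in> U0" and t: "t * uK = uK * t" "t * uKinv = uKinv * t" for x t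
    using x unfolding U0_def
  proof (induction rule: laurent_subalgebra_induct)
    case (incl x)
    thus ?case using t by auto
  next
    case (mult x y)
    thus ?case by (metis mult.assoc)
  qed (auto simp: usl2_scalar_commute algebra_simps)
  have "x * uK = uK * x" "x * uKinv = uKinv * x"
    by (rule gens[OF assms(1)]; simp add: uK_uKinv uKinv_uK)+
  from gens[OF assms(2) this] show ?thesis by simp
qed

definition normalizes_U0 :: "usl2 \<Rightarrow> bool" where
  "normalizes_U0 t \<longleftrightarrow> (\<forall>x\<in>U0. \<exists>y\<in>U0. x * t = t * y)"

lemma normalizes_U0_mult: "normalizes_U0 s \<Longrightarrow> normalizes_U0 t \<Longrightarrow> normalizes_U0 (s * t)"
  unfolding normalizes_U0_def by (metis mult.assoc)

lemma normalizes_U0_scalar: "normalizes_U0 (usl2_scalar c)"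
  unfolding normalizes_U0_def using usl2_scalar_commute by metis

lemma normalizes_U0_power: "normalizes_U0 t \<Longrightarrow> normalizes_U0 (t ^ n)"
  using normalizes_U0_scalar[of 1]
  by (induction n) (simp_all add: usl2_scalar_one normalizes_U0_mult)

lemma normalizes_U0I:
  assumes K: "uK * t = t * k" "k \<in> U0" and Kinv: "uKinv * t = t * l" "l \<in> U0"
  shows "normalizes_U0 t"
  unfolding normalizes_U0_def
proof
  fix x assume "x \<in> U0"
  thus "\<exists>y\<in>U0. x * t = t * y"
    unfolding U0_def
  proof (induction rule: laurent_subalgebra_induct)
    case (scalar c)
    thus ?case using usl2_scalar_commute by (metis laurent_subalgebra_scalar)
  next
    case (incl x)
    thus ?case using assms by (auto simp: U0_def)
  next
    case one
    thus ?case by (auto intro!: bexI[of _ 1] laurent_subalgebra_closed)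
  next
    case (uminus x)
    then obtain y where "y \<in> U0" "x * t = t * y" by (auto simp: U0_def)
    thus ?case by (auto simp: U0_def intro!: bexI[of _ "- y"] laurent_subalgebra_closed)
  next
    case (add x x')
    then obtain y y' where "y \<in> U0" "x * t = t * y" "y' \<in> U0" "x' * t = t * y'"
      by (auto simp: U0_def)
    thus ?case
      by (auto simp: U0_def algebra_simps intro!: bexI[of _ "y + y'"] laurent_subalgebra_closed)
  next
    case (mult x x')
    then obtain y y' where y: "y \<in> U0" "x * t = t * y" "y' \<in> U0" "x' * t = t * y'"
      by (auto simp: U0_def)
    have "x * x' * t = t * (y * y')"
      by (metis y(2,4) mult.assoc)
    thus ?case using y by (auto simp: U0_def intro!: laurent_subalgebra_closed)
  qed
qed

lemma uKinv_uF: "uKinv * uF = usl2_scalar (qv_v ^ 2) * uF * uKinv"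
proof -
  have 1: "uF * uKinv = usl2_scalar (inverse qv_v ^ 2) * (uKinv * uF)"
  proof -
    have "uF * uKinv = uKinv * (uK * uF) * uKinv" by (simp add: mult.assoc[symmetric] uKinv_uK)
    also have "\<dots> = usl2_scalar (inverse qv_v ^ 2) * (uKinv * uF)"
      by (simp add: uK_uF mult.assoc usl2_scalar_left_commute[of uKinv] uK_uKinv)
    finally show ?thesis .
  qed
  have "usl2_scalar (qv_v ^ 2) * uF * uKinv = usl2_scalar (qv_v ^ 2 * inverse qv_v ^ 2) * (uKinv * uF)"
    by (simp add: mult.assoc 1 usl2_scalar_mult)
  thus ?thesis by (simp add: qv_v_nonzero usl2_scalar_one power_mult_distrib[symmetric])
qed

lemma uKinv_ue: "uKinv * ue = usl2_scalar (inverse qv_v ^ 2) * ue * uKinv"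
proof -
  have "usl2_scalar (inverse qv_v ^ 2) * ue * uKinv
      = usl2_scalar (inverse qv_v ^ 2 * qv_v ^ 2) * (uKinv * ue)"
    by (simp add: mult.assoc ue_uKinv usl2_scalar_mult)
  thus ?thesis by (simp add: qv_v_nonzero usl2_scalar_one power_mult_distrib[symmetric])
qed

lemma normalizes_U0_uF: "normalizes_U0 uF" and normalizes_U0_ue: "normalizes_U0 ue"
proof -
  have U0: "usl2_scalar (qv_v ^ 2) * uK \<in> U0" "usl2_scalar (inverse qv_v ^ 2) * uK \<in> U0"
    "usl2_scalar (qv_v ^ 2) * uKinv \<in> U0" "usl2_scalar (inverse qv_v ^ 2) * uKinv \<in> U0"
    by (intro U0_closed usl2_scalar_U0 U0_uK laurent_power laurent_v)+
  show "normalizes_U0 uF"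
    by (rule normalizes_U0I[OF _ U0(2) _ U0(3)])
       (simp_all only: uK_uF uKinv_uF mult.assoc usl2_scalar_left_commute[of uF])
  show "normalizes_U0 ue"
    by (rule normalizes_U0I[OF _ U0(1) _ U0(4)])
       (simp_all only: uK_ue uKinv_ue mult.assoc usl2_scalar_left_commute[of ue])
qed

lemma normalizes_U0_monomial: "normalizes_U0 (uFdiv a * ue ^ b)"
  unfolding uFdiv_def
  by (intro normalizes_U0_mult normalizes_U0_scalar normalizes_U0_power normalizes_U0_uF
      normalizes_U0_ue)

lemma H_factor_uF: "H_factor k * uF = uF * H_factor (k - 2)"
proof -
  have "qv_v powi (k - 2) = qv_v powi k * inverse qv_v ^ 2"
    by (simp add: power_int_diff qv_v_nonzero field_simps)
  moreover have "qv_v powi (- (k - 2)) = qv_v powi (- k) * qv_v ^ 2"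
    using power_int_add[of qv_v "- k" 2] by (simp add: qv_v_nonzero add.commute)
  ultimately show ?thesis
    unfolding H_factor_def
    by (simp add: right_diff_distrib left_diff_distrib usl2_scalar_left_commute[of uF] uK_uF uKinv_uF
        usl2_scalar_mult mult.assoc)
qed

lemma ue_uF: "ue * uF = uF * ue + H_factor 0"
proof -
  let ?c = "qv_v - inverse qv_v"
  have c: "?c \<noteq> 0" using qdiff_nonzero[of 1] by (simp add: qdiff_def power_int_minus)
  have "ue * uF - uF * ue = usl2_scalar ?c * (uE * uF - uF * uE)"
    by (simp add: ue_def right_diff_distrib mult.assoc usl2_scalar_left_commute)
  also have "\<dots> = usl2_scalar (?c * inverse ?c) * (uK - uKinv)"
    by (simp only: uE_uF usl2_scalar_mult mult.assoc)
  also have "\<dots> = H_factor 0"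
    using c by (simp add: H_factor_def usl2_scalar_one)
  finally show ?thesis by (simp add: algebra_simps)
qed

text \<open>
  The scalar identity in the induction step for the commutator of $e$ with a power of $F$.
\<close>

lemma H_factor_recurrence:
  "H_factor 0 + usl2_scalar (qint n) * H_factor (- int n - 1)
     = usl2_scalar (qint (Suc n)) * H_factor (- int n)"
proof -
  have q1: "qdiff 1 \<noteq> 0" using qdiff_nonzero[of 1] by simp
  let ?a = "qv_v powi (- int n)" and ?b = "qv_v powi int n"
  have S: "int (Suc n) = int n + 1" by simp
  have a: "qv_v powi (- int n - 1) = ?a * qv_v powi (- 1)"
    using qv_v_powi_add[of "- int n" "- 1"] by simp
  have b: "qv_v powi (- (- int n - 1)) = ?b * qv_v powi 1"
    using qv_v_powi_add[of "int n" 1] by (simp add: add.commute)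
  have 1: "1 + qint n * qv_v powi (- int n - 1) = qint (Suc n) * ?a"
    using qdiff_add[of 1 "int n"] qv_v_powi_inverse(2)[of "int n"] q1 unfolding a qint_eq S
    by (simp add: field_simps del: qv_v_powi_inverse) 
  have 2: "1 + qint n * qv_v powi (- (- int n - 1)) = qint (Suc n) * ?b"
    using qdiff_add[of "int n" 1] qv_v_powi_inverse(1)[of "int n"] q1 unfolding b qint_eq S
    by (simp add: field_simps del: qv_v_powi_inverse)
  have "H_factor 0 + usl2_scalar (qint n) * H_factor (- int n - 1)
    = usl2_scalar (1 + qint n * qv_v powi (- int n - 1)) * uK
      - usl2_scalar (1 + qint n * qv_v powi (- (- int n - 1))) * uKinv"
    by (simp add: H_factor_def usl2_scalar_add usl2_scalar_mult usl2_scalar_one algebra_simps mult.assoc)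
  also have "\<dots> = usl2_scalar (qint (Suc n)) * H_factor (- int n)"
    unfolding 1 2 by (simp add: H_factor_def usl2_scalar_mult algebra_simps mult.assoc)
  finally show ?thesis .
qed

lemma ue_uF_power:
  "ue * uF ^ Suc n = uF ^ Suc n * ue + usl2_scalar (qint (Suc n)) * (uF ^ n * H_factor (- int n))"
proof (induction n)
  case 0
  have "qint (Suc 0) = 1" using qfact_1 qfact_Suc[of 0] by simp
  thus ?case by (simp add: ue_uF usl2_scalar_one)
next
  case (Suc n)
  have e: "- int n - 2 = - int (Suc n) - 1" by simp
  have "ue * uF ^ Suc (Suc n) = (ue * uF ^ Suc n) * uF" by (simp only: power_Suc2 mult.assoc)
  also have "\<dots> = uF ^ Suc n * (ue * uF)
      + usl2_scalar (qint (Suc n)) * (uF ^ n * (H_factor (- int n) * uF))"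
    by (simp only: Suc distrib_right mult.assoc)
  also have "\<dots> = uF ^ Suc n * uF * ue + uF ^ Suc n * H_factor 0
      + usl2_scalar (qint (Suc n)) * (uF ^ n * uF * H_factor (- int (Suc n) - 1))"
    by (simp only: ue_uF H_factor_uF e distrib_left mult.assoc add.assoc)
  also have "\<dots> = uF ^ Suc (Suc n) * ue
      + uF ^ Suc n * (H_factor 0 + usl2_scalar (qint (Suc n)) * H_factor (- int (Suc n) - 1))"
    by (simp only: power_Suc2 distrib_left mult.assoc add.assoc usl2_scalar_left_commute[of "uF ^ n"]
        usl2_scalar_left_commute[of uF])
  also have "\<dots> = uF ^ Suc (Suc n) * ue
      + usl2_scalar (qint (Suc (Suc n))) * (uF ^ Suc n * H_factor (- int (Suc n)))"
    by (simp only: H_factor_recurrence usl2_scalar_left_commute[of "uF ^ Suc n"])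
  finally show ?case .
qed

text \<open>
  With divided powers and $e = (v - v^{-1}) E$ no denominators are left in the commutator.
\<close>

lemma ue_uFdiv: "ue * uFdiv (Suc n) = uFdiv (Suc n) * ue + uFdiv n * H_factor (- int n)"
proof -
  have "inverse (qfact (Suc n)) * qint (Suc n) = inverse (qfact n)"
    by (simp add: qfact_Suc qint_nonzero)
  hence "usl2_scalar (inverse (qfact (Suc n))) * (usl2_scalar (qint (Suc n)) * x)
      = usl2_scalar (inverse (qfact n)) * x" for x
    by (simp only: mult.assoc[symmetric] usl2_scalar_mult[symmetric])
  moreover have "ue * uFdiv (Suc n) = usl2_scalar (inverse (qfact (Suc n))) * (ue * uF ^ Suc n)"
    by (simp only: uFdiv_def usl2_scalar_left_commute[of ue])
  ultimately show ?thesis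
    unfolding ue_uF_power by (simp only: uFdiv_def distrib_left mult.assoc)
qed

lemma uFdiv_0: "uFdiv 0 = 1"
  by (simp add: uFdiv_def usl2_scalar_one)

lemma uFdiv_mult: "uFdiv a * uFdiv b = usl2_scalar (qbinom a b) * uFdiv (a + b)"
proof -
  have "uFdiv a * uFdiv b = usl2_scalar (inverse (qfact a) * inverse (qfact b)) * uF ^ (a + b)"
    by (simp only: uFdiv_def usl2_scalar_mult power_add mult.assoc usl2_scalar_left_commute[of "uF ^ a"])
  also have "inverse (qfact a) * inverse (qfact b) = qbinom a b * inverse (qfact (a + b))"
    by (simp add: qbinom_def field_simps)
  finally show ?thesis by (simp only: uFdiv_def usl2_scalar_mult mult.assoc)
qed

text \<open>
  The span of $F^{(a)} e^b \mathcal{U}^0$ with $a$ in a given set: all of $\mathbb{N}$ serves for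
  $\mathcal{U}$, and $\{0\}$ for $\mathcal{U}^{\ge 0}$. The factor from $\mathcal{U}^0$ stands on the right so
  that it acts on the generating vector by its value at the weight.
\<close>

definition triangular :: "nat set \<Rightarrow> usl2 set" where
  "triangular D = {x. \<exists>d u. x = (\<Sum>a<d. \<Sum>b<d. uFdiv a * ue ^ b * u a b) \<and> (\<forall>a b. u a b \<in> U0)
     \<and> (\<forall>a b. u a b = 0 \<or> a < d \<and> b < d \<and> a \<in> D)}"

lemma triangularE:
  assumes "x \<in> triangular D"
  obtains d u where "x = (\<Sum>a<d. \<Sum>b<d. uFdiv a * ue ^ b * u a b)" "\<And>a b. u a b \<in> U0"
    "\<And>a b. u a b = 0 \<or> a < d \<and> b < d \<and> a \<in> D"
  using assms unfolding triangular_def by blast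

lemma triangularI:
  assumes "x = (\<Sum>a<d. \<Sum>b<d. uFdiv a * ue ^ b * u a b)" "\<And>a b. u a b \<in> U0"
    "\<And>a b. u a b = 0 \<or> a < d \<and> b < d \<and> a \<in> D"
  shows "x \<in> triangular D"
  unfolding triangular_def by (rule CollectI, rule exI[of _ d], rule exI[of _ u]) (use assms in blast)

lemma double_sum_extend:
  fixes f :: "nat \<Rightarrow> nat \<Rightarrow> 'a::comm_monoid_add"
  assumes "d \<le> e" "\<And>a b. a \<ge> d \<or> b \<ge> d \<Longrightarrow> f a b = 0"
  shows "(\<Sum>a<d. \<Sum>b<d. f a b) = (\<Sum>a<e. \<Sum>b<e. f a b)"
proof -
  have "(\<Sum>a<d. \<Sum>b<d. f a b) = (\<Sum>a<d. \<Sum>b<e. f a b)"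
    by (intro sum.cong sum.mono_neutral_left) (use assms in auto)
  also have "\<dots> = (\<Sum>a<e. \<Sum>b<e. f a b)"
    by (intro sum.mono_neutral_left) (use assms in auto)
  finally show ?thesis .
qed

lemma triangular_add:
  assumes "x \<in> triangular D" "y \<in> triangular D"
  shows "x + y \<in> triangular D"
proof -
  obtain d u where x: "x = (\<Sum>a<d. \<Sum>b<d. uFdiv a * ue ^ b * u a b)" "\<And>a b. u a b \<in> U0"
    "\<And>a b. u a b = 0 \<or> a < d \<and> b < d \<and> a \<in> D" using triangularE[OF assms(1)] by blast
  obtain e w where y: "y = (\<Sum>a<e. \<Sum>b<e. uFdiv a * ue ^ b * w a b)" "\<And>a b. w a b \<in> U0"
    "\<And>a b. w a b = 0 \<or> a < e \<and> b < e \<and> a \<in> D" using triangularE[OF assms(2)] by blast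
  have x0: "a \<ge> d \<or> b \<ge> d \<Longrightarrow> u a b = 0" and y0: "a \<ge> e \<or> b \<ge> e \<Longrightarrow> w a b = 0" for a b
    using x(3)[of a b] y(3)[of a b] by auto
  have "x = (\<Sum>a<d + e. \<Sum>b<d + e. uFdiv a * ue ^ b * u a b)"
    unfolding x(1) by (rule double_sum_extend) (use x0 in auto)
  moreover have "y = (\<Sum>a<d + e. \<Sum>b<d + e. uFdiv a * ue ^ b * w a b)"
    unfolding y(1) by (rule double_sum_extend) (use y0 in auto)
  ultimately have eq: "x + y = (\<Sum>a<d + e. \<Sum>b<d + e. uFdiv a * ue ^ b * (u a b + w a b))"
    by (simp add: sum.distrib distrib_left)
  show ?thesis
  proof (rule triangularI[OF eq])
    show "u a b + w a b \<in> U0" for a b using x(2) y(2) by (intro U0_closed)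
    show "u a b + w a b = 0 \<or> a < d + e \<and> b < d + e \<and> a \<in> D" for a b
      using x(3)[of a b] y(3)[of a b] by auto
  qed
qed

lemma triangular_monomial:
  assumes "u \<in> U0" "a \<in> D"
  shows "uFdiv a * ue ^ b * u \<in> triangular D"
proof -
  let ?w = "\<lambda>a' b'. if a' = a \<and> b' = b then u else 0"
  have "uFdiv a * ue ^ b * u = (\<Sum>a'<Suc (a + b). \<Sum>b'<Suc (a + b). uFdiv a' * ue ^ b' * ?w a' b')"
  proof -
    have "(\<Sum>b'<Suc (a + b). uFdiv a' * ue ^ b' * ?w a' b')
        = (if a' = a then uFdiv a * ue ^ b * u else 0)" for a'
      using sum.delta[of "{..<Suc (a + b)}" b "\<lambda>b'. uFdiv a' * ue ^ b' * u"]
      by (cases "a' = a") (simp_all add: if_distrib cong: if_cong)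
    thus ?thesis by simp
  qed
  thus ?thesis
    by (rule triangularI) (use assms U0_closed(2) in auto)
qed

lemma triangular_zero: "0 \<in> triangular D"
  by (rule triangularI[where d = 0 and u = "\<lambda>_ _. 0"]) (simp_all add: U0_closed)

lemma triangular_sum: "(\<And>i. i \<in> I \<Longrightarrow> f i \<in> triangular D) \<Longrightarrow> sum f I \<in> triangular D"
  by (induction I rule: infinite_finite_induct) (auto simp: triangular_zero intro!: triangular_add)

text \<open>Closure under left multiplication need only be checked on monomials.\<close>

lemma triangular_lmult:
  assumes "\<And>a b u. a \<in> D \<Longrightarrow> u \<in> U0 \<Longrightarrow> x * (uFdiv a * ue ^ b * u) \<in> triangular D"
    and "y \<in> triangular D"
  shows "x * y \<in> triangular D"
proof -
  obtain d u where y: "y = (\<Sum>a<d. \<Sum>b<d. uFdiv a * ue ^ b * u a b)" "\<And>a b. u a b \<in> U0"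
    "\<And>a b. u a b = 0 \<or> a < d \<and> b < d \<and> a \<in> D" using triangularE[OF assms(2)] by blast
  have "x * (uFdiv a * ue ^ b * u a b) \<in> triangular D" for a b
    using assms(1)[OF _ y(2)] y(3)[of a b] triangular_zero by (cases "a \<in> D") auto
  thus ?thesis unfolding y(1) by (auto simp: sum_distrib_left intro!: triangular_sum)
qed

lemma triangular_U0_lmult:
  assumes "x \<in> U0" "y \<in> triangular D"
  shows "x * y \<in> triangular D"
proof (rule triangular_lmult[OF _ assms(2)])
  fix a b u assume u: "a \<in> D" "u \<in> U0"
  obtain x' where x': "x' \<in> U0" "x * (uFdiv a * ue ^ b) = uFdiv a * ue ^ b * x'"
    using normalizes_U0_monomial assms(1) unfolding normalizes_U0_def by blast
  have "x * (uFdiv a * ue ^ b * u) = uFdiv a * ue ^ b * (x' * u)"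
    using x'(2) by (simp only: mult.assoc[symmetric])
  thus "x * (uFdiv a * ue ^ b * u) \<in> triangular D"
    using triangular_monomial x'(1) u by (simp add: U0_closed)
qed

text \<open>
  Commuting $e$ past $F^{(a)}$ lowers $a$ by one, so the set of exponents must be closed downwards.
\<close>

lemma triangular_ue_lmult:
  assumes "y \<in> triangular D" "\<And>a. Suc a \<in> D \<Longrightarrow> a \<in> D"
  shows "ue * y \<in> triangular D"
proof (rule triangular_lmult[OF _ assms(1)])
  fix a b u assume u: "a \<in> D" "u \<in> U0"
  show "ue * (uFdiv a * ue ^ b * u) \<in> triangular D"
  proof (cases a)
    case 0
    hence "ue * (uFdiv a * ue ^ b * u) = uFdiv a * ue ^ Suc b * u"
      by (simp add: uFdiv_0 mult.assoc)
    thus ?thesis by (simp only: triangular_monomial u)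
  next
    case (Suc n)
    have "ue * (uFdiv a * ue ^ b * u) = (ue * uFdiv a) * ue ^ b * u" by (simp only: mult.assoc)
    also have "\<dots> = uFdiv a * ue ^ Suc b * u + uFdiv n * (H_factor (- int n) * ue ^ b) * u"
      unfolding Suc ue_uFdiv by (simp only: distrib_right mult.assoc power_Suc)
    finally have eq: "ue * (uFdiv a * ue ^ b * u)
      = uFdiv a * ue ^ Suc b * u + uFdiv n * (H_factor (- int n) * ue ^ b) * u" .
    obtain h where h: "h \<in> U0" "H_factor (- int n) * ue ^ b = ue ^ b * h"
      using normalizes_U0_power[OF normalizes_U0_ue] H_factor_U0 unfolding normalizes_U0_def by blast
    have "ue * (uFdiv a * ue ^ b * u) = uFdiv a * ue ^ Suc b * u + uFdiv n * ue ^ b * (h * u)"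
      unfolding eq h(2) by (simp only: mult.assoc)
    thus ?thesis
      using triangular_monomial[OF u(2,1)] triangular_monomial[OF U0_closed(6)[OF h(1) u(2)] assms(2)] u(1)
      by (simp only: Suc) (intro triangular_add)
  qed
qed

lemma triangular_uFdiv_lmult:
  assumes "y \<in> triangular UNIV"
  shows "uFdiv n * y \<in> triangular UNIV"
proof (rule triangular_lmult[OF _ assms])
  fix a b u assume u: "u \<in> U0"
  have "uFdiv n * (uFdiv a * ue ^ b * u) = (uFdiv n * uFdiv a) * (ue ^ b * u)" by (simp only: mult.assoc)
  also have "\<dots> = uFdiv (n + a) * ue ^ b * (usl2_scalar (qbinom n a) * u)"
    unfolding uFdiv_mult by (metis mult.assoc usl2_scalar_left_commute)
  finally show "uFdiv n * (uFdiv a * ue ^ b * u) \<in> triangular UNIV"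
    using triangular_monomial[of "usl2_scalar (qbinom n a) * u" "n + a" UNIV b] u
    by (simp only: UNIV_I) (simp add: U0_closed usl2_scalar_U0 qbinom_laurent)
qed

lemma triangular_one: "0 \<in> D \<Longrightarrow> 1 \<in> triangular D"
  using triangular_monomial[of 1 0 D 0] U0_closed(1) by (simp add: uFdiv_0)

lemma triangular_subalgebra_lmult:
  assumes "x \<in> laurent_subalgebra S" "y \<in> triangular D"
    and gens: "\<And>s y. s \<in> S \<Longrightarrow> y \<in> triangular D \<Longrightarrow> s * y \<in> triangular D"
  shows "x * y \<in> triangular D"
  using assms(1,2)
proof (induction arbitrary: y rule: laurent_subalgebra_induct)
  case (scalar c)
  thus ?case by (intro triangular_U0_lmult usl2_scalar_U0)
next
  case (uminus x)
  have "- x * y = (- 1) * (x * y)" by simp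
  thus ?case using uminus triangular_U0_lmult[OF U0_closed(3)[OF U0_closed(1)]] by (simp only:)
next
  case (add x x')
  thus ?case by (simp add: distrib_right triangular_add)
qed (simp_all add: gens mult.assoc)

text \<open>
  The span contains $1$ and is stable under left multiplication by the generators.
\<close>

lemma U_int_triangular:
  assumes "x \<in> U_int"
  shows "x \<in> triangular UNIV"
proof -
  have "x * 1 \<in> triangular UNIV"
    by (rule triangular_subalgebra_lmult[OF assms[unfolded U_int_def] triangular_one])
       (auto intro: triangular_U0_lmult U0_uK triangular_ue_lmult triangular_uFdiv_lmult)
  thus ?thesis by simp
qed

lemma Uge0_triangular:
  assumes "x \<in> Uge0"
  shows "x \<in> triangular {0}"
  using assms unfolding Uge0_def
proof (induction rule: span_prod_induct)
  case (prod u p)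
  have "p * 1 \<in> triangular {0}"
    by (rule triangular_subalgebra_lmult[OF prod(2)[unfolded U_plus_def] triangular_one])
       (auto intro: triangular_ue_lmult)
  thus ?case using triangular_U0_lmult[OF prod(1)] by simp
qed (rule triangular_add)

lemma usl2_act_scale: "usl2_act s k x (\<lambda>a b. c * f a b) = (\<lambda>a b. c * usl2_act s k x f a b)"
proof -
  have "(\<lambda>a b. c * f a b) = usl2_act s k (usl2_scalar c) f" for f by (simp add: usl2_act_scalar fun_eq_iff)
  thus ?thesis by (simp only: usl2_act_mult[symmetric] usl2_scalar_commute)
qed

lemma usl2_act_sum: "usl2_act s k (sum x I) f a b = (\<Sum>i\<in>I. usl2_act s k (x i) f a b)"
  by (induction I rule: infinite_finite_induct) (simp_all add: usl2_act_zero usl2_act_add)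

text \<open>
  The value at $K = \pm v^k$ of an element of $\mathcal{U}^0$, read off from its action on the
  generating vector.
\<close>

definition U0_value :: "bool \<Rightarrow> int \<Rightarrow> usl2 \<Rightarrow> qv" where
  "U0_value s k u = usl2_act s k u vacuum 0 0"

lemma usl2_act_U0_vacuum:
  assumes "u \<in> U0"
  shows "usl2_act s k u vacuum = (\<lambda>a b. U0_value s k u * vacuum a b)"
proof -
  have "\<exists>c. usl2_act s k u vacuum = (\<lambda>a b. c * vacuum a b)"
    using assms unfolding U0_def
  proof (induction rule: laurent_subalgebra_induct)
    case (incl x)
    have "usl2_act s k uK vacuum = (\<lambda>a b. weight s k * vacuum a b)"
      "usl2_act s k uKinv vacuum = (\<lambda>a b. inverse (weight s k) * vacuum a b)"
      by (simp_all add: fun_eq_iff usl2_act_uK usl2_act_uKinv vacuum_def)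
    thus ?case using incl by blast
  next
    case one
    show ?case by (rule exI[of _ 1]) (simp add: usl2_act_one)
  next
    case (scalar c)
    show ?case by (rule exI[of _ c]) (simp add: usl2_act_scalar fun_eq_iff)
  next
    case (uminus x)
    then obtain c where "usl2_act s k x vacuum = (\<lambda>a b. c * vacuum a b)" by blast
    thus ?case by (intro exI[of _ "- c"]) (simp add: usl2_act_uminus fun_eq_iff)
  next
    case (add x y)
    then obtain c d where "usl2_act s k x vacuum = (\<lambda>a b. c * vacuum a b)"
      "usl2_act s k y vacuum = (\<lambda>a b. d * vacuum a b)" by blast
    thus ?case by (intro exI[of _ "c + d"]) (simp add: usl2_act_add fun_eq_iff algebra_simps)
  next
    case (mult x y)
    then obtain c d where "usl2_act s k x vacuum = (\<lambda>a b. c * vacuum a b)"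
      "usl2_act s k y vacuum = (\<lambda>a b. d * vacuum a b)" by blast
    thus ?case by (intro exI[of _ "d * c"]) (simp add: usl2_act_mult usl2_act_scale mult.assoc)
  qed
  thus ?thesis unfolding U0_value_def by (auto simp: vacuum_def)
qed

lemma U0_value_laurent: "u \<in> U0 \<Longrightarrow> U0_value s k u \<in> laurent"
  using coeff_filtD[OF raisingD[OF U_int_raising[of u 1] vacuum_filt], of s k 0 0] U0_subset_U_int
  by (auto simp: U0_value_def laurent_ideal_one)

lemma U0_value_add: "U0_value s k (x + y) = U0_value s k x + U0_value s k y"
  and U0_value_diff: "U0_value s k (x - y) = U0_value s k x - U0_value s k y"
  and U0_value_scalar: "U0_value s k (usl2_scalar c) = c"
  and U0_value_uK: "U0_value s k uK = weight s k"
  by (simp_all add: U0_value_def usl2_act_add usl2_act_diff usl2_act_scalar usl2_act_uK vacuum_def)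

lemma U0_value_mult: "y \<in> U0 \<Longrightarrow> U0_value s k (x * y) = U0_value s k x * U0_value s k y"
  unfolding U0_value_def[of s k "x * y"] U0_value_def[of s k x]
  by (simp add: usl2_act_mult usl2_act_U0_vacuum usl2_act_scale)

lemma usl2_act_monomial_vacuum:
  assumes "u \<in> U0"
  shows "usl2_act s k (uFdiv a * ue ^ b * u) vacuum a' b'
    = (if a' = a \<and> b' = b then U0_value s k u else 0)"
proof -
  have "usl2_act s k (ue ^ b) vacuum = (\<lambda>a' b'. if a' = 0 \<and> b' = b then 1 else 0)"
  proof (induction b)
    case (Suc b)
    show ?case by (auto simp: fun_eq_iff usl2_act_mult Suc usl2_act_ue)
  qed (simp add: usl2_act_one vacuum_def fun_eq_iff)
  hence "usl2_act s k (uFdiv a * ue ^ b) vacuum a' b' = (if a' = a \<and> b' = b then 1 else 0)"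
    by (auto simp: usl2_act_mult usl2_act_uFdiv)
  thus ?thesis
    by (simp add: usl2_act_mult[of s k "uFdiv a * ue ^ b"] usl2_act_U0_vacuum[OF assms] usl2_act_scale)
qed

lemma triangular_coefficient:
  assumes "\<And>a b. u a b \<in> U0" "a < d" "b < d"
  shows "usl2_act s k (\<Sum>a<d. \<Sum>b<d. uFdiv a * ue ^ b * u a b) vacuum a b = U0_value s k (u a b)"
proof -
  have "usl2_act s k (\<Sum>a<d. \<Sum>b<d. uFdiv a * ue ^ b * u a b) vacuum a b
      = (\<Sum>a'<d. \<Sum>b'<d. if a = a' \<and> b = b' then U0_value s k (u a' b') else 0)"
    by (simp add: usl2_act_sum usl2_act_monomial_vacuum assms(1))
  also have "\<dots> = (\<Sum>a'<d. if a = a' then U0_value s k (u a b) else 0)"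
    using assms(3) by (intro sum.cong) auto
  also have "\<dots> = U0_value s k (u a b)" using assms(2) by simp
  finally show ?thesis .
qed

section \<open>Interpolation at the weights $\<plusminus> v^k$\<close>

definition qdiff_fact :: "nat \<Rightarrow> qv" where
  "qdiff_fact n = (\<Prod>i<n. qdiff (int (Suc i)))"

lemma qdiff_fact_0 [simp]: "qdiff_fact 0 = 1"
  and qdiff_fact_Suc: "qdiff_fact (Suc n) = qdiff_fact n * qdiff (int (Suc n))"
  by (simp_all add: qdiff_fact_def)

lemma qdiff_fact_nonzero: "qdiff_fact n \<noteq> 0"
proof -
  have "qdiff (int (Suc i)) \<noteq> 0" for i by (rule qdiff_nonzero) simp
  thus ?thesis by (simp add: qdiff_fact_def del: of_nat_Suc)
qed

lemma qdiff_fact_qfact: "qdiff_fact n = qdiff 1 ^ n * qfact n"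
  using qdiff_nonzero[of 1]
  by (induction n) (simp_all add: qdiff_fact_Suc qfact_Suc qint_eq)

text \<open>The quotient $\{n\}!/\{k\}!$.\<close>

definition qdiff_fact_ratio :: "nat \<Rightarrow> nat \<Rightarrow> qv" where
  "qdiff_fact_ratio n k = (\<Prod>i\<in>{k..<n}. qdiff (int (Suc i)))"

lemma qdiff_fact_ratio_laurent: "qdiff_fact_ratio n k \<in> laurent"
  by (simp add: qdiff_fact_ratio_def laurent_prod)

lemma monic_qdiff_fact_ratio: "monic_laurent (qdiff_fact_ratio n k)"
  unfolding qdiff_fact_ratio_def by (intro monic_laurent_prod monic_laurent_qdiff) simp

lemma qdiff_fact_ratio_mult:
  assumes "k \<le> n"
  shows "qdiff_fact k * qdiff_fact_ratio n k = qdiff_fact n"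
  unfolding qdiff_fact_def qdiff_fact_ratio_def lessThan_atLeast0
  using assms by (intro prod.atLeastLessThan_concat) auto

lemma usl2_scalar_U0_filt_mult: "c \<in> laurent \<Longrightarrow> x \<in> U0_filt n \<Longrightarrow> usl2_scalar c * x \<in> U0_filt n"
  using U0_filtD[of n] usl2_scalar_U0 by blast

lemma U0_filt_uminus: "x \<in> U0_filt n \<Longrightarrow> - x \<in> U0_filt n"
proof -
  assume "x \<in> U0_filt n"
  moreover have "- 1 \<in> U0" by (intro U0_closed)
  ultimately have "- 1 * x \<in> U0_filt n" using U0_filtD[of n] by blast
  thus ?thesis by simp
qed

lemma U0_filt_diff: "x \<in> U0_filt n \<Longrightarrow> y \<in> U0_filt n \<Longrightarrow> x - y \<in> U0_filt n"
proof -
  assume "x \<in> U0_filt n" "y \<in> U0_filt n"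
  hence "x + - y \<in> U0_filt n" using U0_filtD[of n] U0_filt_uminus[of y n] by blast
  thus ?thesis by simp
qed

text \<open>
  The combination of $\{H+m+1\}_{i+1}$ and $\{H+m\}_{i+1}$ in which the term with $K^{-1}$ in the
  one differing factor cancels. It exhibits $\{i+1\}\{H+m\}_i$ as an element of $\mathcal{U}^0_{i+1}$.
\<close>

lemma qdiff_H_shift:
  "usl2_scalar (qdiff (int (Suc i))) * H_shift m i
     = usl2_scalar (qv_v powi (int i - 2 * m - 1)) * uKinv
       * (usl2_scalar (qv_v powi (m + 1)) * H_shift (m + 1) (Suc i)
          - usl2_scalar (qv_v powi (m - int i)) * H_shift m (Suc i))"
proof -
  let ?s = "\<lambda>k. usl2_scalar (qv_v powi k)"
  have s: "?s a * (?s b * x) = ?s (a + b) * x" for a b x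
    by (simp only: mult.assoc[symmetric] usl2_scalar_mult[symmetric] qv_v_powi_add)
  have H1: "H_shift (m + 1) (Suc i) = H_factor (m + 1) * H_shift m i"
    using H_shift_add[of "m + 1" 1 i] by (simp add: H_shift_1)
  have H2: "H_shift m (Suc i) = H_factor (m - int i) * H_shift m i"
    unfolding H_shift_Suc by (rule U0_commute[OF H_shift_U0 H_factor_U0])
  have "?s (m + 1) * H_factor (m + 1) - ?s (m - int i) * H_factor (m - int i)
      = (?s (2 * m + 2) - ?s (2 * m - 2 * int i)) * uK"
    unfolding H_factor_def right_diff_distrib left_diff_distrib s
    by (simp add: algebra_simps)
  also have "?s (2 * m + 2) - ?s (2 * m - 2 * int i)
      = usl2_scalar (qv_v powi (2 * m + 1 - int i) * qdiff (int (Suc i)))"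
    unfolding qdiff_def right_diff_distrib usl2_scalar_diff qv_v_powi_add[symmetric]
    by (simp add: algebra_simps)
  finally have *: "?s (m + 1) * H_factor (m + 1) - ?s (m - int i) * H_factor (m - int i)
      = usl2_scalar (qv_v powi (2 * m + 1 - int i) * qdiff (int (Suc i))) * uK" .
  have "?s (m + 1) * H_shift (m + 1) (Suc i) - ?s (m - int i) * H_shift m (Suc i)
      = (?s (m + 1) * H_factor (m + 1) - ?s (m - int i) * H_factor (m - int i)) * H_shift m i"
    by (simp only: H1 H2 left_diff_distrib mult.assoc)
  also have "\<dots> = ?s (2 * m + 1 - int i) * (usl2_scalar (qdiff (int (Suc i))) * (uK * H_shift m i))"
    unfolding * by (simp only: usl2_scalar_mult mult.assoc)
  finally have **: "?s (m + 1) * H_shift (m + 1) (Suc i) - ?s (m - int i) * H_shift m (Suc i)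
      = ?s (2 * m + 1 - int i) * (usl2_scalar (qdiff (int (Suc i))) * (uK * H_shift m i))" .
  have "?s (int i - 2 * m - 1) * uKinv
      * (?s (2 * m + 1 - int i) * (usl2_scalar (qdiff (int (Suc i))) * (uK * H_shift m i)))
    = ?s (int i - 2 * m - 1) * (?s (2 * m + 1 - int i)
        * (usl2_scalar (qdiff (int (Suc i))) * ((uKinv * uK) * H_shift m i)))"
    by (simp only: mult.assoc usl2_scalar_left_commute[of uKinv])
  also have "\<dots> = usl2_scalar (qdiff (int (Suc i))) * H_shift m i"
    unfolding s uKinv_uK by (simp add: usl2_scalar_one)
  finally show ?thesis unfolding ** by simp
qed

text \<open>
  Descending induction from $i = n$; each step gains the factor $\{i+1\}$ by \<open>qdiff_H_shift\<close>.
\<close>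

lemma ratio_H_shift_U0_filt:
  assumes "i \<le> n"
  shows "usl2_scalar (qdiff_fact_ratio n i) * H_shift m i \<in> U0_filt n"
  using assms
proof (induction i arbitrary: m rule: inc_induct)
  case base
  thus ?case by (simp add: qdiff_fact_ratio_def usl2_scalar_one H_shift_U0_filt)
next
  case (step i)
  let ?c = "usl2_scalar (qdiff_fact_ratio n (Suc i))"
  let ?t = "usl2_scalar (qv_v powi (int i - 2 * m - 1)) * uKinv"
  have "qdiff_fact_ratio n i = qdiff_fact_ratio n (Suc i) * qdiff (int (Suc i))"
    using step.hyps prod.atLeast_Suc_lessThan[of i n "\<lambda>i. qdiff (int (Suc i))"]
    by (simp add: qdiff_fact_ratio_def mult.commute)
  hence "usl2_scalar (qdiff_fact_ratio n i) * H_shift m i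
      = ?c * (usl2_scalar (qdiff (int (Suc i))) * H_shift m i)"
    by (simp only: usl2_scalar_mult mult.assoc)
  also have "\<dots> = ?t * (usl2_scalar (qv_v powi (m + 1)) * (?c * H_shift (m + 1) (Suc i))
          - usl2_scalar (qv_v powi (m - int i)) * (?c * H_shift m (Suc i)))"
    unfolding qdiff_H_shift usl2_scalar_left_commute[of ?t, symmetric]
    by (simp only: right_diff_distrib usl2_scalar_left_commute[of "usl2_scalar (qv_v powi (m + 1))"]
        usl2_scalar_left_commute[of "usl2_scalar (qv_v powi (m - int i))"])
  also have "\<dots> \<in> U0_filt n"
  proof -
    have "?t \<in> U0" by (intro U0_closed usl2_scalar_U0 laurent_powi U0_uK)
    moreover have "usl2_scalar (qv_v powi (m + 1)) * (?c * H_shift (m + 1) (Suc i))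
          - usl2_scalar (qv_v powi (m - int i)) * (?c * H_shift m (Suc i)) \<in> U0_filt n"
      by (intro U0_filt_diff usl2_scalar_U0_filt_mult laurent_powi step.IH)
    ultimately show ?thesis using U0_filtD[of n] by blast
  qed
  finally show ?case .
qed

text \<open>
  Division with remainder by $\{H+m\}$, which is quadratic in $K$ up to a unit; so the remainder is
  linear in $K$.
\<close>

lemma U0_divide_H_factor:
  assumes "u \<in> U0"
  obtains a b w where "a \<in> laurent" "b \<in> laurent" "w \<in> U0"
    "u = usl2_scalar a + usl2_scalar b * uK + w * H_factor m"
proof -
  let ?s = "\<lambda>k. usl2_scalar (qv_v powi k)"
  let ?H = "H_factor m"
  let ?rep = "\<lambda>u. \<exists>a b w. a \<in> laurent \<and> b \<in> laurent \<and> w \<in> U0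
    \<and> u = usl2_scalar a + usl2_scalar b * uK + w * ?H"
  have repI: "?rep u" if "a \<in> laurent" "b \<in> laurent" "w \<in> U0"
    "u = usl2_scalar a + usl2_scalar b * uK + w * ?H" for u a b w using that by blast
  have s1: "?s a * ?s b = ?s (a + b)" for a b
    by (simp only: usl2_scalar_mult[symmetric] qv_v_powi_add)
  have s: "?s a * (?s b * x) = ?s (a + b) * x" for a b x
    by (simp only: mult.assoc[symmetric] s1)
  have zero: "usl2_scalar 0 = 0" by (rule usl2_scalar_zero)
  \<comment> \<open>The reductions of $K^{-1}$ and $K^2$ modulo $\{H+m\}$.\<close>
  have Kinv: "uKinv = ?s (2 * m) * uK - ?s m * ?H"
    unfolding H_factor_def right_diff_distrib s by (simp add: usl2_scalar_one)
  have KK: "uK * uK = ?s (- 2 * m) + ?s (- m) * uK * ?H"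
  proof -
    have "?s (- m) * uK * ?H = ?s (- m) * (?s m * (uK * uK)) - ?s (- m) * (?s (- m) * (uK * uKinv))"
      unfolding H_factor_def
      by (simp only: right_diff_distrib mult.assoc usl2_scalar_left_commute[of uK])
    thus ?thesis unfolding s uK_uKinv by (simp add: usl2_scalar_one)
  qed
  have add: "?rep (x + y)" if "?rep x" "?rep y" for x y
  proof -
    obtain a b w c d w' where *: "a \<in> laurent" "b \<in> laurent" "w \<in> U0"
      "x = usl2_scalar a + usl2_scalar b * uK + w * ?H"
      "c \<in> laurent" "d \<in> laurent" "w' \<in> U0"
      "y = usl2_scalar c + usl2_scalar d * uK + w' * ?H" using \<open>?rep x\<close> \<open>?rep y\<close> by blast
    show ?thesis
      by (rule repI[of "a + c" "b + d" "w + w'"])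
         (use * in \<open>simp_all add: laurent_add U0_closed usl2_scalar_add algebra_simps\<close>)
  qed
  have scale: "?rep (usl2_scalar c * x)" if "c \<in> laurent" "?rep x" for c x
  proof -
    obtain a b w where *: "a \<in> laurent" "b \<in> laurent" "w \<in> U0"
      "x = usl2_scalar a + usl2_scalar b * uK + w * ?H" using \<open>?rep x\<close> by blast
    show ?thesis
      by (rule repI[of "c * a" "c * b" "usl2_scalar c * w"])
         (use * \<open>c \<in> laurent\<close> in \<open>simp_all add: laurent_mult U0_closed usl2_scalar_U0
            usl2_scalar_mult distrib_left mult.assoc\<close>)
  qed
  have multiple: "?rep (w * ?H)" if "w \<in> U0" for w
    by (rule repI[of 0 0 w]) (use that in \<open>simp_all add: zero laurent_zero\<close>)
  have repK: "?rep uK"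
    by (rule repI[of 0 1 0]) (simp_all add: zero laurent_zero laurent_one usl2_scalar_one U0_closed)
  have repS: "?rep (usl2_scalar c)" if "c \<in> laurent" for c
    by (rule repI[of c 0 0]) (use that in \<open>simp_all add: zero laurent_zero U0_closed\<close>)
  have repKK: "?rep (uK * uK)"
    unfolding KK by (intro add repS multiple laurent_powi U0_closed usl2_scalar_U0 U0_uK)
  have "?rep u"
    using assms[unfolded U0_def]
  proof (induction rule: laurent_subalgebra_induct)
    case (scalar c)
    thus ?case by (rule repS)
  next
    case one
    thus ?case using repS[OF laurent_one] by (simp only: usl2_scalar_one)
  next
    case (incl x)
    have "uKinv = ?s (2 * m) * uK + (- ?s m) * ?H" using Kinv by simp
    moreover have "?rep (?s (2 * m) * uK + (- ?s m) * ?H)"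
      by (intro add scale repK multiple laurent_powi U0_closed usl2_scalar_U0)
    ultimately have "?rep uKinv" by (simp only:)
    thus ?case using incl repK by (elim insertE emptyE) (simp_all only:)
  next
    case (uminus x)
    have "- x = usl2_scalar (- 1) * x"
      using usl2_scalar_diff[of 0 1] by (simp add: zero usl2_scalar_one)
    moreover have "?rep (usl2_scalar (- 1) * x)"
      by (intro scale uminus.IH laurent_uminus laurent_one)
    ultimately show ?case by (simp only:)
  next
    case (add x y)
    thus ?case by (intro \<open>\<And>x y. ?rep x \<Longrightarrow> ?rep y \<Longrightarrow> ?rep (x + y)\<close>)
  next
    case (mult x y)
    then obtain a b w c d w' where *: "a \<in> laurent" "b \<in> laurent" "w \<in> U0"
      "x = usl2_scalar a + usl2_scalar b * uK + w * ?H"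
      "c \<in> laurent" "d \<in> laurent" "w' \<in> U0"
      "y = usl2_scalar c + usl2_scalar d * uK + w' * ?H" by blast
    let ?x = "usl2_scalar a + usl2_scalar b * uK"
    have U0: "?x \<in> U0" "y \<in> U0"
      using mult.hyps by (auto simp: U0_def[symmetric] intro!: U0_closed usl2_scalar_U0 U0_uK *)
    have Hy: "?H * y = y * ?H" by (rule U0_commute[OF H_factor_U0 U0(2)])
    have "x * y = ?x * y + w * (?H * y)" by (simp only: *(4) distrib_right mult.assoc)
    also have "\<dots> = ?x * y + (w * y) * ?H" by (simp only: Hy mult.assoc)
    also have "?x * y = ?x * (usl2_scalar c + usl2_scalar d * uK) + (?x * w') * ?H"
      by (subst *(8)) (simp only: distrib_left[of ?x] mult.assoc)
    finally have "x * y = ?x * (usl2_scalar c + usl2_scalar d * uK) + (?x * w' + w * y) * ?H"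
      by (simp only: distrib_right[of _ _ ?H] add.assoc)
    also have "?x * (usl2_scalar c + usl2_scalar d * uK)
      = usl2_scalar (a * c) + usl2_scalar (a * d + b * c) * uK + usl2_scalar (b * d) * (uK * uK)"
      by (simp add: distrib_left distrib_right mult.assoc usl2_scalar_mult usl2_scalar_add
          usl2_scalar_commute[of c uK, symmetric] usl2_scalar_left_commute[of uK] add.assoc)
    finally have eq: "x * y = usl2_scalar (a * c) + usl2_scalar (a * d + b * c) * uK
      + usl2_scalar (b * d) * (uK * uK) + (?x * w' + w * y) * ?H" .
    have "?rep (usl2_scalar (a * c) + usl2_scalar (a * d + b * c) * uK
      + usl2_scalar (b * d) * (uK * uK) + (?x * w' + w * y) * ?H)"
      by (intro add scale repS repK repKK multiple laurent_closed U0_closed U0 *)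
    thus ?case by (simp only: eq)
  qed
  thus ?thesis using that by blast
qed

lemma U0_value_H_shift:
  "U0_value s k (H_shift m i) = (\<Prod>j<i. weight_diff s (k + m - int j))"
  by (simp add: U0_value_def usl2_act_H_shift vacuum_def)

lemma weight_diff_prod:
  "(\<Prod>j<i. weight_diff s (x - int j)) = (if s then - 1 else 1) ^ i * (\<Prod>j<i. qdiff (x - int j))"
  unfolding weight_diff_def prod.distrib by simp

text \<open>
  This product is the value of $\{H\}_i$ at $v^{k+i}$, so the formula shows that the values of
  $\{H\}_i$ at natural powers of $v$ are divisible by $\{i\}!$.
\<close>

lemma falling_qdiff:
  "(\<Prod>j<i. qdiff (int (k + i) - int j)) = qdiff_fact i * qbinom k i"
proof -
  have "qdiff_fact k * (\<Prod>j<i. qdiff (int (k + i) - int j)) = qdiff_fact (k + i)"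
  proof (induction i)
    case (Suc i)
    have "(\<Prod>j<Suc i. qdiff (int (k + Suc i) - int j))
        = qdiff (int (Suc (k + i))) * (\<Prod>j<i. qdiff (int (k + i) - int j))"
      by (subst prod.lessThan_Suc_shift) (simp add: algebra_simps)
    thus ?case using Suc by (simp add: qdiff_fact_Suc mult_ac)
  qed simp
  moreover have "qdiff_fact k * (qdiff_fact i * qbinom k i) = qdiff_fact (k + i)"
    by (simp add: qbinom_def qdiff_fact_qfact power_add field_simps)
  ultimately show ?thesis using qdiff_fact_nonzero[of k] by (metis mult_left_cancel)
qed

lemma U0_value_H_shift_ideal:
  "U0_value s (int k) (H_shift 0 i) \<in> laurent_ideal (qdiff_fact i)"
proof (cases "i \<le> k")
  case True
  then obtain l where "k = l + i" using le_Suc_ex by (metis add.commute)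
  thus ?thesis
    using falling_qdiff[of l i]
    by (auto simp: U0_value_H_shift weight_diff_prod
        intro!: laurent_ideal_lmult laurent_idealI laurent_closed qbinom_laurent)
next
  case False
  hence "(\<Prod>j<i. weight_diff s (int k - int j)) = 0"
    by (intro prod_zero bexI[of _ k]) (auto simp: weight_diff_def)
  thus ?thesis by (simp only: U0_value_H_shift add_0_right laurent_ideal_zero)
qed

lemma U0_value_H_shift_diagonal:
  "U0_value s (int k) (H_shift 0 k) = (if s then - 1 else 1) ^ k * qdiff_fact k"
  using falling_qdiff[of 0 k] by (simp add: U0_value_H_shift weight_diff_prod)

lemma laurent_ideal_cancel:
  assumes "g \<noteq> 0" "y * g \<in> laurent_ideal (g * h)"
  shows "y \<in> laurent_ideal h"
proof -
  obtain c where c: "c \<in> laurent" "y * g = g * h * c" by (rule laurent_idealE[OF assms(2)])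
  hence "y = h * c" using assms(1) by (simp add: mult.commute[of y] mult.assoc)
  thus ?thesis using laurent_idealI[OF c(1)] by simp
qed

text \<open>
  Newton interpolation. Successive division by $\{H\}, \{H-1\}, \ldots$ expands \<open>u\<close> into terms
  $(a_i + b_i K) \{H\}_i$ with $i < n$ and a multiple of $\{H\}_n$. At $\pm v^k$ the terms with $i > k$
  vanish and $\{H\}_k$ takes the value $\pm \{k\}!$. So if the terms with $i < k$ are already known to lie
  in $\mathcal{U}^0_n$, then $a_k \pm b_k v^k$ is divisible by $\{n\}!/\{k\}!$ for both signs. Since the
  quotient by this monic element is torsion free, the same holds for $a_k$ and $b_k$, and the $k$-th term lies in
  $\mathcal{U}^0_n$ by \<open>ratio_H_shift_U0_filt\<close>.
\<close>

lemma U0_interpolation: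
  assumes "u \<in> U0" and vals: "\<And>s k. k < n \<Longrightarrow> U0_value s (int k) u \<in> laurent_ideal (qdiff_fact n)"
  shows "u \<in> U0_filt n"
proof -
  \<comment> \<open>The divisibility of the values is carried along, as it is what the next step evaluates.\<close>
  have "\<exists>w\<in>U0. u - w * H_shift 0 k \<in> U0_filt n \<and>
      (\<forall>s i. U0_value s (int i) (u - w * H_shift 0 k) \<in> laurent_ideal (qdiff_fact n))" if "k \<le> n" for k
    using that
  proof (induction k)
    case 0
    have "(0::usl2) \<in> U0_filt n" using U0_filtD[of n] by blast
    moreover have "U0_value s i 0 = 0" for s i by (simp add: U0_value_def usl2_act_zero)
    ultimately show ?case using assms(1) by (intro bexI[of _ u]) (auto simp: H_shift_0 laurent_ideal_zero)
  next
    case (Suc k)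
    let ?r = "qdiff_fact_ratio n k" and ?H = "H_shift 0 k"
    obtain w where w: "w \<in> U0" "u - w * ?H \<in> U0_filt n"
      "\<And>s i. U0_value s (int i) (u - w * ?H) \<in> laurent_ideal (qdiff_fact n)" using Suc by auto
    obtain a b w' where ab: "a \<in> laurent" "b \<in> laurent" "w' \<in> U0"
      "w = usl2_scalar a + usl2_scalar b * uK + w' * H_factor (- int k)"
      by (rule U0_divide_H_factor[OF w(1)])
    let ?l = "usl2_scalar a + usl2_scalar b * uK"
    have k: "k < n" using Suc.prems by simp
    have fact: "qdiff_fact k * ?r = qdiff_fact n" using k by (intro qdiff_fact_ratio_mult) simp
    have lin: "a + b * weight s (int k) \<in> laurent_ideal ?r" for s
    proof -
      have "H_factor (- int k) * ?H = H_shift 0 (Suc k)"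
        unfolding H_shift_Suc by (simp add: U0_commute[OF H_factor_U0 H_shift_U0])
      hence wH: "w * ?H = ?l * ?H + w' * H_shift 0 (Suc k)"
        unfolding ab(4) by (simp add: distrib_right mult.assoc)
      have "U0_value s (int k) (H_shift 0 (Suc k)) = 0"
        by (simp add: U0_value_H_shift weight_diff_def)
      hence "U0_value s (int k) (w * ?H) = (a + b * weight s (int k)) * U0_value s (int k) ?H"
        unfolding wH U0_value_add U0_value_mult[OF H_shift_U0]
        by (simp add: U0_value_add U0_value_mult U0_uK U0_value_scalar U0_value_uK)
      moreover have "U0_value s (int k) (w * ?H) \<in> laurent_ideal (qdiff_fact n)"
        using laurent_ideal_diff[OF vals[OF k, of s] w(3)[of s k]] by (simp add: U0_value_diff)
      ultimately have "(a + b * weight s (int k)) * qdiff_fact k \<in> laurent_ideal (qdiff_fact n)"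
        unfolding U0_value_H_shift_diagonal
        by (cases s; cases "even k") (auto dest: laurent_ideal_uminus)
      thus ?thesis unfolding fact[symmetric] by (rule laurent_ideal_cancel[OF qdiff_fact_nonzero])
    qed
    have sum: "a + b * qv_v powi int k \<in> laurent_ideal ?r"
      and diff: "a - b * qv_v powi int k \<in> laurent_ideal ?r"
      using lin[of False] lin[of True] by (simp_all add: weight_def)
    \<comment> \<open>The two signs give $2a$ and $2b$, and the factor $2$ can be cancelled.\<close>
    have a: "a \<in> laurent_ideal ?r"
      using laurent_ideal_add[OF sum diff]
      by (intro laurent_ideal_cancel_int[OF monic_qdiff_fact_ratio ab(1), of 2]) simp_all
    have b2: "of_int 2 * b = (qv_v powi (- int k)) * ((a + b * qv_v powi int k) - (a - b * qv_v powi int k))"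
      using qv_v_powi_inverse(1)[of "int k"] by (simp add: algebra_simps del: qv_v_powi_inverse)
    have "of_int 2 * b \<in> laurent_ideal ?r"
      unfolding b2 by (intro laurent_ideal_lmult laurent_powi laurent_ideal_diff sum diff)
    hence b: "b \<in> laurent_ideal ?r"
      by (rule laurent_ideal_cancel_int[OF monic_qdiff_fact_ratio ab(2), rotated]) simp
    obtain a' b' where ab': "a' \<in> laurent" "a = ?r * a'" "b' \<in> laurent" "b = ?r * b'"
      using a b by (elim laurent_idealE)
    let ?l' = "usl2_scalar a' + usl2_scalar b' * uK"
    have l': "?l' \<in> U0" by (intro U0_closed usl2_scalar_U0 ab' U0_uK)
    have l: "?l * ?H = ?l' * (usl2_scalar ?r * ?H)"
      unfolding ab'(2,4) 
      by (simp add: distrib_right usl2_scalar_mult mult.assoc usl2_scalar_left_commute[of uK]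
          usl2_scalar_left_commute[of "usl2_scalar a'"] usl2_scalar_left_commute[of "usl2_scalar b'"])
    have eq: "u - w' * H_shift 0 (Suc k) = (u - w * ?H) + ?l' * (usl2_scalar ?r * ?H)"
    proof -
      have "H_factor (- int k) * ?H = H_shift 0 (Suc k)"
        unfolding H_shift_Suc by (simp add: U0_commute[OF H_factor_U0 H_shift_U0])
      hence "w * ?H = ?l * ?H + w' * H_shift 0 (Suc k)"
        unfolding ab(4) by (simp add: distrib_right mult.assoc)
      thus ?thesis unfolding l[symmetric] by simp
    qed
    have "?l' * (usl2_scalar ?r * ?H) \<in> U0_filt n"
      using U0_filtD[of n] l' ratio_H_shift_U0_filt[of k n 0] k by auto
    hence "u - w' * H_shift 0 (Suc k) \<in> U0_filt n" unfolding eq using U0_filtD[of n] w(2) by auto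
    moreover have "U0_value s (int i) (u - w' * H_shift 0 (Suc k)) \<in> laurent_ideal (qdiff_fact n)" for s i
    proof -
      have "usl2_scalar ?r * ?H \<in> U0" by (intro U0_closed usl2_scalar_U0 qdiff_fact_ratio_laurent H_shift_U0)
      hence "U0_value s (int i) (?l' * (usl2_scalar ?r * ?H))
        = U0_value s (int i) ?l' * (U0_value s (int i) ?H * ?r)"
        by (simp add: U0_value_mult H_shift_U0 U0_value_scalar)
      also have "\<dots> \<in> laurent_ideal (qdiff_fact k * ?r)"
        by (intro laurent_ideal_lmult U0_value_laurent l' laurent_ideal_mult U0_value_H_shift_ideal
            laurent_ideal_self)
      finally show ?thesis unfolding eq U0_value_add fact by (intro laurent_ideal_add w(3))
    qed
    ultimately show ?case using ab(3) by blast
  qed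
  then obtain w where w: "w \<in> U0" "u - w * H_shift 0 n \<in> U0_filt n" by blast
  have "w * H_shift 0 n \<in> U0_filt n" using U0_filtD[of n] w(1) H_shift_U0_filt by blast
  hence "(u - w * H_shift 0 n) + w * H_shift 0 n \<in> U0_filt n" using U0_filtD[of n] w(2) by blast
  thus ?thesis by simp
qed

section \<open>Injectivity\<close>

text \<open>
  Each $\{k\}$ with $1 \le k \le n$ divides $\{n!\}$.
\<close>

lemma qdiff_fact_dvd_power: "qdiff (int (fact n)) ^ n \<in> laurent_ideal (qdiff_fact n)"
proof -
  have *: "qdiff (int (fact n)) ^ k \<in> laurent_ideal (qdiff_fact k)" if "k \<le> n" for k
    using that
  proof (induction k)
    case (Suc k)
    have "Suc k dvd fact n" using Suc.prems by (intro dvd_fact) auto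
    hence "int (Suc k) dvd int (fact n)" by (simp only: int_dvd_int_iff)
    hence "qdiff (int (fact n)) \<in> laurent_ideal (qdiff (int (Suc k)))" by (rule qdiff_dvd)
    thus ?case
      unfolding qdiff_fact_Suc power_Suc2
      by (intro laurent_ideal_mult Suc.IH) (use Suc.prems in simp_all)
  qed (simp add: laurent_ideal_self)
  show ?thesis by (rule *) simp
qed

text \<open>
  The step $2n$ leaves the exponent $2n - b \ge n$ at every $F^{(a)} e^b$ with $b \le n$.
\<close>

lemma coefficients_in_U0_filt:
  fixes u :: "nat \<Rightarrow> nat \<Rightarrow> usl2"
  assumes x: "x = (\<Sum>a<d. \<Sum>b<d. uFdiv a * ue ^ b * u a b)"
    and u: "\<And>a b. u a b \<in> U0" "\<And>a b. u a b = 0 \<or> a < d \<and> b < d \<and> a \<in> D"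
    and act: "\<And>s k. usl2_act s k x vacuum \<in> coeff_filt (fact n) (2 * n)" and "b \<le> n"
  shows "u a b \<in> U0_filt n"
proof (cases "a < d \<and> b < d")
  case True
  show ?thesis
  proof (rule U0_interpolation[OF u(1)])
    fix s k
    have "n \<le> 2 * n - b" using assms(5) by simp
    moreover have "usl2_act s (int k) x vacuum a b = U0_value s (int k) (u a b)"
      unfolding x by (rule triangular_coefficient) (use u(1) True in auto)
    ultimately have "U0_value s (int k) (u a b) \<in> laurent_ideal (qdiff (int (fact n)) ^ n)"
      using coeff_filtD_le[OF act, of n b s "int k" a] by (simp only:)
    thus "U0_value s (int k) (u a b) \<in> laurent_ideal (qdiff_fact n)"
      using laurent_ideal_subset[OF qdiff_fact_dvd_power] by blast
  qed
next
  case False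
  hence "u a b = 0" using u(2)[of a b] by auto
  thus ?thesis using U0_filtD[of n] by simp
qed

lemma triangular_in_ideal:
  assumes "ideal I (usl2_subring S)" "ring (usl2_subring S)"
    and D: "\<And>a. a \<in> D \<Longrightarrow> uFdiv a \<in> S" and S: "ue \<in> S" "U0 \<subseteq> S"
    and I: "U0_filt n \<subseteq> I" "ue ^ n \<in> I"
    and x: "x \<in> triangular D"
    and act: "\<And>s k. usl2_act s k x vacuum \<in> coeff_filt (fact n) (2 * n)"
  shows "x \<in> I"
proof -
  note ideal = assms(1)[unfolded ideal_usl2_subring_iff[OF assms(2)]]
  interpret S: ring "usl2_subring S" by (rule assms(2))
  have mult: "y * z \<in> S" if "y \<in> S" "z \<in> S" for y z using S.m_closed that by simp
  have pow: "ue ^ b \<in> S" for b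
    by (induction b) (use S.one_closed S(1) mult in auto)
  obtain d u where xu: "x = (\<Sum>a<d. \<Sum>b<d. uFdiv a * ue ^ b * u a b)" "\<And>a b. u a b \<in> U0"
    "\<And>a b. u a b = 0 \<or> a < d \<and> b < d \<and> a \<in> D" using triangularE[OF x] by blast
  have term_in: "uFdiv a * ue ^ b * u a b \<in> I" for a b
  proof (cases "a \<in> D")
    case True
    show ?thesis
    proof (cases "b \<le> n")
      case le: True
      have "u a b \<in> I" using coefficients_in_U0_filt[OF xu act le] I(1) by blast
      thus ?thesis using ideal mult[OF D[OF True] pow] by blast
    next
      case False
      hence "ue ^ b = ue ^ n * ue ^ (b - n)" by (simp add: power_add[symmetric])
      hence "ue ^ b \<in> I" using ideal I(2) pow by auto
      hence "uFdiv a * ue ^ b \<in> I" using ideal D[OF True] by blast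
      moreover have "u a b \<in> S" using xu(2)[of a b] S(2) by blast
      ultimately show ?thesis using ideal by blast
    qed
  next
    case False
    thus ?thesis using xu(3)[of a b] ideal by auto
  qed
  have sum: "sum f A \<in> I" if "\<And>i. i \<in> A \<Longrightarrow> f i \<in> I" for f :: "nat \<Rightarrow> usl2" and A
    using that by (induction A rule: infinite_finite_induct) (use ideal in auto)
  show ?thesis unfolding xu(1) by (intro sum term_in)
qed

lemma completion_coset:
  assumes "x \<in> carrier (completion R I)"
  shows "\<exists>a \<in> carrier R. x n = I n +>\<^bsub>R\<^esub> a"
  using assms by (auto simp: completion_def FactRing_simps)

lemma completion_project:
  assumes "x \<in> carrier (completion R I)" "m \<le> n"
  shows "set_add R (I m) (x n) = x m"
  using assms by (simp add: completion_def)

text \<open>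
  Injectivity in terms of representatives: the difference of two representing sequences of points
  with the same image is coherent and lies in every \<open>J n\<close>.
\<close>

lemma completion_map_inj:
  assumes ring: "ring (usl2_subring S)"
    and I: "\<And>n. ideal (I n) (usl2_subring S)" and J: "\<And>n. ideal (J n) (usl2_subring S)"
    and IJ: "\<And>n. I n \<subseteq> J n"
    and sep: "\<And>z n. (\<And>n. z n \<in> J n) \<Longrightarrow> (\<And>m n. n \<le> m \<Longrightarrow> z m - z n \<in> I n) \<Longrightarrow> z n \<in> I n"
  shows "inj_on (completion_map (usl2_subring S) J) (carrier (completion (usl2_subring S) I))"
proof (rule inj_onI)
  let ?R = "usl2_subring S"
  fix x y
  assume x: "x \<in> carrier (completion ?R I)" and y: "y \<in> carrier (completion ?R I)"
    and xy: "completion_map ?R J x = completion_map ?R J y"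
  interpret R: ring ?R by (rule ring)
  note Ii = I[unfolded ideal_usl2_subring_iff[OF ring]]
  note Ji = J[unfolded ideal_usl2_subring_iff[OF ring]]
  have neg: "- a \<in> T" if "ideal T ?R" "a \<in> T" for a T
  proof -
    interpret T: ideal T ?R by (rule that)
    have "a \<in> S" using T.Icarr[OF that(2)] by simp
    hence "\<ominus>\<^bsub>?R\<^esub> a + a = 0" using R.l_neg[of a] by simp
    hence "\<ominus>\<^bsub>?R\<^esub> a = - a" by (simp only: eq_neg_iff_add_eq_0)
    thus ?thesis using T.a_inv_closed[OF that(2)] by simp
  qed
  have coset: "T +>\<^bsub>?R\<^esub> a = {t + a | t. t \<in> T}" for T a
    by (auto simp: a_r_coset_def')
  have coset_eq: "T +>\<^bsub>?R\<^esub> a = T +>\<^bsub>?R\<^esub> b \<longleftrightarrow> a - b \<in> T" if T: "ideal T ?R" for T a b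
  proof
    have T0: "0 \<in> T" using T unfolding ideal_usl2_subring_iff[OF ring] by blast
    assume "T +>\<^bsub>?R\<^esub> a = T +>\<^bsub>?R\<^esub> b"
    hence "0 + a \<in> {t + b | t. t \<in> T}" using T0 unfolding coset by blast
    thus "a - b \<in> T" by auto
  next
    assume ab: "a - b \<in> T"
    have add: "s + t \<in> T" if "s \<in> T" "t \<in> T" for s t
      using T that unfolding ideal_usl2_subring_iff[OF ring] by blast
    have "t + a = (t + (a - b)) + b" "t + b = (t + - (a - b)) + a" for t by simp_all
    thus "T +>\<^bsub>?R\<^esub> a = T +>\<^bsub>?R\<^esub> b"
      unfolding coset using add[OF _ ab] add[OF _ neg[OF T ab]] by blast
  qed
  have rep: "\<exists>a. \<forall>n. a n \<in> S \<and> x n = I n +>\<^bsub>?R\<^esub> a n" if "x \<in> carrier (completion ?R I)" for x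
    by (intro choice allI) (use completion_coset[OF that] in \<open>simp add: Bex_def\<close>)
  obtain a where a: "\<And>n. a n \<in> S" "\<And>n. x n = I n +>\<^bsub>?R\<^esub> a n" using rep[OF x] by blast
  obtain b where b: "\<And>n. b n \<in> S" "\<And>n. y n = I n +>\<^bsub>?R\<^esub> b n" using rep[OF y] by blast
  have I_dec: "set_add ?R (I n) (I m +>\<^bsub>?R\<^esub> c m) = I n +>\<^bsub>?R\<^esub> c n \<Longrightarrow> c m - c n \<in> I n" for c :: "nat \<Rightarrow> usl2" and m n
  proof -
    assume eq: "set_add ?R (I n) (I m +>\<^bsub>?R\<^esub> c m) = I n +>\<^bsub>?R\<^esub> c n"
    have "0 + (0 + c m) \<in> set_add ?R (I n) (I m +>\<^bsub>?R\<^esub> c m)"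
      unfolding set_add_def' coset using Ii[of n] Ii[of m] by force
    hence "c m \<in> I n +>\<^bsub>?R\<^esub> c n" unfolding eq by simp
    thus "c m - c n \<in> I n" unfolding coset by auto
  qed
  have "a m - a n \<in> I n" "b m - b n \<in> I n" if "n \<le> m" for m n
    by (intro I_dec; simp only: a(2)[symmetric] b(2)[symmetric] completion_project[OF x that]
        completion_project[OF y that])+
  hence coherent: "(a m - b m) - (a n - b n) \<in> I n" if "n \<le> m" for m n
  proof -
    have "(a m - b m) - (a n - b n) = (a m - a n) + - (b m - b n)" by simp
    thus ?thesis using \<open>\<And>m n. n \<le> m \<Longrightarrow> a m - a n \<in> I n\<close>[OF that]
      neg[OF I \<open>\<And>m n. n \<le> m \<Longrightarrow> b m - b n \<in> I n\<close>[OF that]] Ii[of n] by metis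
  qed
  have "a n - b n \<in> J n" for n
  proof -
    have "J n +>\<^bsub>?R\<^esub> a n = J n +>\<^bsub>?R\<^esub> b n"
      using fun_cong[OF xy, of n] set_add_coset[OF I J IJ, of "a n" n] set_add_coset[OF I J IJ, of "b n" n] a b
      by (simp add: completion_map_def)
    thus ?thesis using coset_eq[OF J] by blast
  qed
  hence "a n - b n \<in> I n" for n by (rule sep) (rule coherent)
  thus "x = y" using coset_eq[OF I] by (simp add: fun_eq_iff a(2) b(2))
qed

lemma div_sum_bound:
  assumes "N > 0" "N * Suc d \<le> n" "i \<le> (n::nat)"
  shows "d \<le> i div N + (n - i) div N"
proof -
  have "i < N * Suc (i div N)" "n - i < N * Suc ((n - i) div N)"
    using assms(1) dividend_less_times_div by (simp_all add: dividend_less_times_div)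
  hence "n < N * Suc (i div N) + N * Suc ((n - i) div N)" using assms(3) by linarith
  hence "N * Suc d < N * (Suc (i div N) + Suc ((n - i) div N))"
    using assms(2) unfolding distrib_left by linarith
  hence "Suc d < Suc (i div N) + Suc ((n - i) div N)" by (simp only: mult_less_cancel1)
  thus ?thesis by simp
qed

text \<open>
  The common core of the three cases. A kernel sequence is examined at an index \<open>m\<close> far beyond \<open>n\<close>,
  where its coefficients are divisible enough for \<open>detect\<close> to apply; coherence then brings the
  conclusion back to index \<open>n\<close>.
\<close>

lemma completion_map_ideal_powers_inj:
  assumes ring: "ring (usl2_subring S)" and "S \<subseteq> U_int"
    and I: "\<And>n. ideal (I n) (usl2_subring S)"
    and powers: "\<And>n. I n \<subseteq> ideal_powers (usl2_subring S) (I 1) n"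
    and raise: "\<And>N d n. N > 0 \<Longrightarrow> (\<And>i. i \<le> n \<Longrightarrow> d \<le> i div N + (n - i) div N) \<Longrightarrow> I n \<subseteq> raising N d"
    and detect: "\<And>n x. x \<in> S \<Longrightarrow>
      (\<And>s k. usl2_act s k x vacuum \<in> coeff_filt (fact n) (2 * n)) \<Longrightarrow> x \<in> I n"
  shows "inj_on (completion_map (usl2_subring S) (ideal_powers (usl2_subring S) (I 1)))
    (carrier (completion (usl2_subring S) I))"
proof (rule completion_map_inj[OF ring I ideal_ideal_powers[OF I] powers])
  note ideal = I[unfolded ideal_usl2_subring_iff[OF ring]]
  fix z :: "nat \<Rightarrow> usl2" and n
  assume z: "\<And>n. z n \<in> ideal_powers (usl2_subring S) (I 1) n"
    and coherent: "\<And>m n. n \<le> m \<Longrightarrow> z m - z n \<in> I n"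
  have zS: "z n \<in> S" for n
    using z[of n] ideal_ideal_powers[OF I[of 1], of n]
    unfolding ideal_usl2_subring_iff[OF ring] by blast
  have "I 1 \<subseteq> raising 1 1" by (rule raise) simp_all
  hence J: "z n \<in> raising 1 n" for n using ideal_powers_raising[OF assms(2)] z by blast
  \<comment> \<open>With $N = n!$ this index is at least $N(d+1)$ for $d = 2n$, the bound of \<open>vacuum_coeffs_vanish\<close>, and at least $n$.\<close>
  let ?m = "fact n * Suc (2 * n) + n"
  have "usl2_act s k (z ?m) vacuum \<in> coeff_filt (fact n) (2 * n)" for s k
  proof (rule vacuum_coeffs_vanish[OF J])
    fix N d m n :: nat assume *: "N > 0" "N * Suc d \<le> n" "n \<le> m"
    show "z m - z n \<in> raising N d"
      using raise[OF *(1) div_sum_bound[OF *(1,2)]] coherent[OF *(3)] by blast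
  qed auto
  hence m: "z ?m \<in> I n" by (intro detect zS)
  have diff: "z ?m - z n \<in> I n" by (rule coherent) simp
  have "z n = z ?m + - 1 * (z ?m - z n)" by simp
  moreover have "- 1 \<in> S"
  proof -
    interpret R: ring "usl2_subring S" by (rule ring)
    have "\<ominus>\<^bsub>usl2_subring S\<^esub> 1 + 1 = 0" using R.l_neg[OF R.one_closed] by simp
    hence "\<ominus>\<^bsub>usl2_subring S\<^esub> 1 = - 1" by (simp only: eq_neg_iff_add_eq_0)
    thus ?thesis using R.a_inv_closed[OF R.one_closed] by simp
  qed
  hence "- 1 * (z ?m - z n) \<in> I n" using ideal[of n] diff by blast
  hence "z ?m + - 1 * (z ?m - z n) \<in> I n" using ideal[of n] m by blast
  ultimately show "z n \<in> I n" by (simp only:)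
qed

lemma i_hat_U0_inj: "inj_on i_hat_U0 (carrier hat_U0)"
  unfolding i_hat_U0_def hat_U0_def
proof (rule completion_map_ideal_powers_inj[OF U0_ring U0_subset_U_int U0_filt_ideal U0_filt_subset])
  fix N d n :: nat assume "N > 0" and "\<And>i. i \<le> n \<Longrightarrow> d \<le> i div N + (n - i) div N"
  from this(2)[of n] have "d \<le> n div N" by simp
  from raising_le[OF this] show "U0_filt n \<subseteq> raising N d"
    using U0_filt_raising[OF \<open>N > 0\<close>] by blast
next
  fix n x assume x: "x \<in> U0" and act: "\<And>s k. usl2_act s k x vacuum \<in> coeff_filt (fact n) (2 * n)"
  show "x \<in> U0_filt n"
  proof (rule U0_interpolation[OF x])
    fix s k
    have "U0_value s (int k) x \<in> laurent_ideal (qdiff (int (fact n)) ^ n)"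
      unfolding U0_value_def by (rule coeff_filtD_le[OF act]) simp
    thus "U0_value s (int k) x \<in> laurent_ideal (qdiff_fact n)"
      using laurent_ideal_subset[OF qdiff_fact_dvd_power] by blast
  qed
qed

lemma U0_filt_subset_Uge0_filt: "U0_filt n \<subseteq> Uge0_filt n"
proof
  fix x assume x: "x \<in> U0_filt n"
  have "1 \<in> U_plus_filt 0" by (simp add: U_plus_filt_def U_plus_closed)
  from Uge0_part_filt[OF span_prodI[OF x this]] show "x \<in> Uge0_filt n" by simp
qed

lemma ue_power_Uge0_filt: "ue ^ n \<in> Uge0_filt n"
proof -
  have "ue ^ n * 1 \<in> U_plus_filt n"
    unfolding U_plus_filt_def by (rule imageI) (rule U_plus_closed(1))
  moreover have "1 \<in> U0_filt 0" by (simp add: U0_filt_0 U0_closed)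
  ultimately show ?thesis using Uge0_part_filt[OF span_prodI, of 1 0 "ue ^ n" n] by simp
qed

lemma i_hat_Uge0_inj: "inj_on i_hat_Uge0 (carrier hat_Uge0)"
  unfolding i_hat_Uge0_def hat_Uge0_def
proof (rule completion_map_ideal_powers_inj[OF Uge0_ring Uge0_subset_U_int Uge0_filt_ideal
      Uge0_filt_subset Uge0_filt_raising])
  fix n x assume x: "x \<in> Uge0" and act: "\<And>s k. usl2_act s k x vacuum \<in> coeff_filt (fact n) (2 * n)"
  show "x \<in> Uge0_filt n"
  proof (rule triangular_in_ideal[OF Uge0_filt_ideal Uge0_ring _ _ _ U0_filt_subset_Uge0_filt
        ue_power_Uge0_filt Uge0_triangular[OF x] act])
    show "uFdiv a \<in> Uge0" if "a \<in> {0}" for a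
      using that U0_Uge0[OF U0_closed(1)] by (simp add: uFdiv_0)
    show "ue \<in> Uge0" by (rule U_plus_Uge0[OF U_plus_ue])
    show "U0 \<subseteq> Uge0" using U0_Uge0 by blast
  qed
qed

lemma U0_filt_subset_U_int_filt: "U0_filt n \<subseteq> U_int_filt n"
proof -
  note ideal = U_int_filt_ideal[unfolded ideal_usl2_subring_iff[OF U_int_ring], of n]
  have "ideal (U0 \<inter> U_int_filt n) (usl2_subring U0)"
    unfolding ideal_usl2_subring_iff[OF U0_ring]
    using ideal U0_closed U0_subset_U_int by (auto intro: U0_closed)
  moreover have "H_shift m n \<in> U_int_filt n" for m using U_int_filt_gens[of n n m] by simp
  ultimately have "U0_filt n \<subseteq> U0 \<inter> U_int_filt n"
    unfolding U0_filt_def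
    by (intro ring.genideal_minimal[OF U0_ring]) (auto simp: H_shift_U0)
  thus ?thesis by blast
qed

lemma uFdiv_U_int: "uFdiv a \<in> U_int"
proof (cases "a = 0")
  case False
  thus ?thesis unfolding U_int_def by (intro laurent_subalgebra_incl) auto
qed (simp add: uFdiv_0 U_int_closed)

lemma i_hat_U_int_inj: "inj_on i_hat_U_int (carrier hat_U_int)"
  unfolding i_hat_U_int_def hat_U_int_def
proof (rule completion_map_ideal_powers_inj[OF U_int_ring order.refl U_int_filt_ideal
      U_int_filt_subset U_int_filt_raising])
  fix n x assume x: "x \<in> U_int" and act: "\<And>s k. usl2_act s k x vacuum \<in> coeff_filt (fact n) (2 * n)"
  have "ue ^ n \<in> U_int_filt n" using U_int_filt_gens[of 0 n 0] by (simp add: H_shift_0)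
  from triangular_in_ideal[OF U_int_filt_ideal U_int_ring uFdiv_U_int U_int_gens(3) U0_subset_U_int
      U0_filt_subset_U_int_filt this U_int_triangular[OF x] act]
  show "x \<in> U_int_filt n" .
qed

theorem proposition6p9:
  shows "(i_hat_U0 \<in> ring_hom hat_U0 dot_U0 \<and> inj_on i_hat_U0 (carrier hat_U0)) \<and>
         (i_hat_Uge0 \<in> ring_hom hat_Uge0 dot_Uge0 \<and> inj_on i_hat_Uge0 (carrier hat_Uge0)) \<and>
         (i_hat_U_int \<in> ring_hom hat_U_int dot_U_int \<and> inj_on i_hat_U_int (carrier hat_U_int))"
  by (intro conjI i_hat_ring_hom i_hat_U0_inj i_hat_Uge0_inj i_hat_U_int_inj)

end
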